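(* Let $f\in C^1([0,\infty))$ satisfy $f(0)=f(1)=0$, $f(u)>0$ for $u\in(0,1)$, $f(u)<0$ for $u\in(1,\infty)$, and $f'(0)=0$. Let $\phi\in L^2(\mathbb{R})\cap L^\infty(\mathbb{R})$ satisfy $\phi\ge 0$, $\phi(-x)=\phi(x)$ for all $x$, and $\phi$ non-increasing on $(0,\infty)$. Let $u(x,t)$ be the solution of $u_t=u_{xx}+f(u)$, $x\in\mathbb{R}$, $t>0$, with $u(x,0)=\phi(x)$. Suppose that there exists $T\ge0$ such that $E[u(\cdot,T)]<0$. Then $\lim_{t\to\infty}u(x,t)=1$ locally uniformly in $\mathbb{R}$.
   Context: The solution $u$ is the unique classical solution of the Cauchy problem in $C^2_1(\mathbb{R}\times(0,\infty))\cap L^\infty(\mathbb{R}\times(0,\infty))$ ($C^2$ in $x$, $C^1$ in $t$) with $u\in C([0,\infty);L^2(\mathbb{R}))\cap C((0,\infty);H^2(\mathbb{R}))$. The energy is $E[u]=\int_{\mathbb{R}}\left(\tfrac12 u_x^2+V(u)\right)dx$ with $V(u)=-\int_0^u f(s)\,ds$, defined for nonnegative $u\in H^1(\mathbb{R})\cap L^\infty(\mathbb{R})$; the condition $E[u(\cdot,T)]<0$ with $T=0$ presupposes $\phi\in H^1(\mathbb{R})$. *)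

theory Defs
  imports "HOL-Analysis.Analysis"
begin

section \<open>Function spaces on the real line\<close>

text \<open>
  Elements of the Lebesgue and Sobolev spaces are represented by functions; membership in the
  spaces, weak derivatives and norms do not depend on the representative.
\<close>

definition L2 :: "(real \<Rightarrow> real) set" where
  "L2 = {v \<in> borel_measurable lebesgue. integrable lebesgue (\<lambda>x. (v x)\<^sup>2)}"

definition L2_norm :: "(real \<Rightarrow> real) \<Rightarrow> real" where
  "L2_norm v = sqrt (LINT x|lebesgue. (v x)\<^sup>2)"

definition Linf :: "(real \<Rightarrow> real) set" where
  "Linf = {v \<in> borel_measurable lebesgue. \<exists>M. AE x in lebesgue. \<bar>v x\<bar> \<le> M}"

definition test_function :: "(real \<Rightarrow> real) \<Rightarrow> bool" where
  "test_function \<psi> \<longleftrightarrow>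
     (\<forall>n x. (deriv ^^ n) \<psi> differentiable at x) \<and> compact (closure {x. \<psi> x \<noteq> 0})"

definition locally_integrable :: "(real \<Rightarrow> real) \<Rightarrow> bool" where
  "locally_integrable v \<longleftrightarrow> (\<forall>a b. v absolutely_integrable_on {a..b})"

definition has_weak_deriv :: "(real \<Rightarrow> real) \<Rightarrow> (real \<Rightarrow> real) \<Rightarrow> bool" where
  "has_weak_deriv v g \<longleftrightarrow> locally_integrable v \<and> locally_integrable g \<and>
     (\<forall>\<psi>. test_function \<psi> \<longrightarrow>
        (LINT x|lebesgue. v x * deriv \<psi> x) = - (LINT x|lebesgue. g x * \<psi> x))"

text \<open>
  Weak derivatives are unique up to null sets; an arbitrary representative is chosen.
  The value is meaningless if no weak derivative exists.
\<close>

definition weak_deriv :: "(real \<Rightarrow> real) \<Rightarrow> real \<Rightarrow> real" where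
  "weak_deriv v = (SOME g. has_weak_deriv v g)"

definition H1 :: "(real \<Rightarrow> real) set" where
  "H1 = {v \<in> L2. \<exists>g\<in>L2. has_weak_deriv v g}"

definition H2 :: "(real \<Rightarrow> real) set" where
  "H2 = {v \<in> H1. weak_deriv v \<in> H1}"

definition H2_norm :: "(real \<Rightarrow> real) \<Rightarrow> real" where
  "H2_norm v = sqrt ((L2_norm v)\<^sup>2 + (L2_norm (weak_deriv v))\<^sup>2
                       + (L2_norm (weak_deriv (weak_deriv v)))\<^sup>2)"

text \<open>\<open>w \<in> C(I; X)\<close>, where the space \<open>X\<close> of functions carries the norm \<open>N\<close>.\<close>

definition continuous_curve ::
    "real set \<Rightarrow> (real \<Rightarrow> real) set \<Rightarrow> ((real \<Rightarrow> real) \<Rightarrow> real) \<Rightarrow> (real \<Rightarrow> real \<Rightarrow> real) \<Rightarrow> bool" where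
  "continuous_curve I X N w \<longleftrightarrow>
     (\<forall>t\<in>I. w t \<in> X \<and> ((\<lambda>s. N (\<lambda>x. w s x - w t x)) \<longlongrightarrow> 0) (at t within I))"

text \<open>\<open>C\<^sup>1([0,\<infinity>))\<close>: the derivative at \<open>0\<close> is one-sided, so values at negative arguments play no role.\<close>

definition C1_on_nonneg :: "(real \<Rightarrow> real) \<Rightarrow> bool" where
  "C1_on_nonneg f \<longleftrightarrow>
     (\<exists>f'. (\<forall>s\<ge>0. (f has_real_derivative f' s) (at s within {0..})) \<and> continuous_on {0..} f')"


section \<open>The Cauchy problem\<close>

text \<open>Functions of space and time are written \<open>u x t\<close>.\<close>

definition dx :: "(real \<Rightarrow> real \<Rightarrow> real) \<Rightarrow> real \<Rightarrow> real \<Rightarrow> real" where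
  "dx u x t = deriv (\<lambda>y. u y t) x"

definition dt :: "(real \<Rightarrow> real \<Rightarrow> real) \<Rightarrow> real \<Rightarrow> real \<Rightarrow> real" where
  "dt u x t = deriv (\<lambda>s. u x s) t"

definition C21 :: "(real \<Rightarrow> real \<Rightarrow> real) \<Rightarrow> bool" where
  "C21 u \<longleftrightarrow>
     (\<forall>x. \<forall>t>0. (\<lambda>y. u y t) differentiable at x \<and>
                (\<lambda>y. dx u y t) differentiable at x \<and>
                (\<lambda>s. u x s) differentiable at t) \<and>
     (\<forall>w\<in>{u, dx u, dx (dx u), dt u}. continuous_on (UNIV \<times> {0<..}) (\<lambda>(x, t). w x t))"

text \<open>
  Nonnegativity belongs to the notion of solution because \<open>f\<close> is only given on \<open>[0,\<infinity>)\<close>.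
  As \<open>u\<close> is continuous for \<open>t > 0\<close>, its essential boundedness there is plain boundedness.
  The initial condition is an identity in \<open>L\<^sup>2\<close>, hence almost everywhere.
\<close>

definition is_solution ::
    "(real \<Rightarrow> real) \<Rightarrow> (real \<Rightarrow> real) \<Rightarrow> (real \<Rightarrow> real \<Rightarrow> real) \<Rightarrow> bool" where
  "is_solution f \<phi> u \<longleftrightarrow>
     C21 u \<and>
     (\<forall>x. \<forall>t>0. 0 \<le> u x t) \<and>
     (\<exists>M. \<forall>x. \<forall>t>0. \<bar>u x t\<bar> \<le> M) \<and>
     continuous_curve {0..} L2 L2_norm (\<lambda>t x. u x t) \<and>
     continuous_curve {0<..} H2 H2_norm (\<lambda>t x. u x t) \<and>
     (\<forall>x. \<forall>t>0. dt u x t = dx (dx u) x t + f (u x t)) \<and>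
     (AE x in lebesgue. u x 0 = \<phi> x)"


section \<open>The energy\<close>

definition potential :: "(real \<Rightarrow> real) \<Rightarrow> real \<Rightarrow> real" where
  "potential f v = - integral {0..v} f"

text \<open>Meaningful for \<open>v \<in> H1 \<inter> Linf\<close> that are nonnegative almost everywhere.\<close>

definition energy :: "(real \<Rightarrow> real) \<Rightarrow> (real \<Rightarrow> real) \<Rightarrow> real" where
  "energy f v = (LINT x|lebesgue. (weak_deriv v x)\<^sup>2 / 2 + potential f (v x))"

end

theory Submission
  imports Defs "HOL-Computational_Algebra.Polynomial"
begin

text \<open>
  Assume that the energy is negative at time \<open>T\<close> and that the solution does not converge to one. The
  contradiction comes from three facts about solutions that are even and decreasing in \<open>\<bar>x\<bar>\<close>; these two
  properties are inherited from \<open>\<phi>\<close> by comparing \<open>u\<close> with its reflections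
  (\<open>isometry_comparison\<close>, \<open>even_and_decreasing\<close>). Write \<open>G s\<close> for the integral of \<open>f\<close> over \<open>{0..s}\<close>,
  so that the energy is the integral of \<open>u\<^sub>x\<^sup>2 / 2 - G u\<close>.

  Spreading. If at one time \<open>u \<ge> q\<close> on a sufficiently long interval, then an explicit subsolution, a
  plateau of height \<open>q\<close> whose edges move outwards with a small speed, stays below \<open>u\<close>
  (\<open>spreading_from_plateau\<close>). Once \<open>u \<ge> q\<close> on expanding intervals, spatially parabolic barriers force
  \<open>u\<close> to one locally uniformly (\<open>eventually_above\<close>, \<open>eventually_below\<close>). The required length depends on \<open>q\<close>
  only through a slope \<open>\<kappa>\<close> with \<open>\<kappa> (q - s) \<le> G q - G s\<close>; for any height \<open>d\<close> below one, maximising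
  \<open>G s - \<kappa> s\<close> with \<open>\<kappa> = G d / (2 d)\<close> gives a \<open>q \<le> d\<close> whose plateau needs length at most
  \<open>4 d / sqrt (G d)\<close>.

  Decay. Hence a solution that does not spread satisfies \<open>G u \<le> 16 u\<^sup>2 / x\<^sup>2\<close> at all times, as long as
  \<open>u \<le> 1/2\<close> (\<open>spreading_or_decay\<close>). This makes \<open>u\<close> small far out and \<open>G u\<close> bounded by a multiple of
  \<open>1 / (1 + x\<^sup>2)\<close>, both uniformly in time. Therefore the energy is bounded below, and it is almost
  nonnegative whenever \<open>u\<close> is uniformly small.

  Dissipation. The energy decreases at least at half the rate of the integral of \<open>u\<^sub>t\<^sup>2\<close>
  (\<open>energy_dissipation\<close>). The energy stays below a negative number, so \<open>u(0,t)\<close> stays above some \<open>\<epsilon> > 0\<close>. But a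
  profile with a top above \<open>\<epsilon>\<close> and a small tail cannot be almost stationary: where \<open>0 \<le> u \<le> \<epsilon>\<close> the
  equation makes it almost concave, so it would cross zero with a definite slope. Thus the integral of
  \<open>u\<^sub>t\<^sup>2\<close> over a fixed interval is bounded away from zero (\<open>dissipation_while_not_spreading\<close>), and the
  energy tends to minus infinity, against the lower bound (\<open>negative_energy_spreads\<close>).

  At the time \<open>T\<close>, which may be \<open>0\<close>, the argument uses that \<open>u\<close> is continuous in time with values
  in \<open>L\<^sup>2\<close> and that \<open>u(\<cdot>,T)\<close> has a weak derivative in \<open>L\<^sup>2\<close> and agrees almost everywhere with a function
  that is continuous almost everywhere (by monotonicity of \<open>\<phi>\<close> if \<open>T = 0\<close>). The inequality
  \<open>E[u(\<cdot>,t)] < 0\<close> is carried to some \<open>t > T\<close> by the difference quotients of \<open>u\<close> in \<open>x\<close>: their \<open>L\<^sup>2\<close> norm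
  grows at most exponentially, which bounds \<open>u\<^sub>x\<close> after time \<open>T\<close> by the weak derivative at time \<open>T\<close>
  (\<open>gradient_L2_bound\<close>, \<open>energy_initially_negative\<close>).
\<close>

section \<open>Functions of class C21 on the open half-plane\<close>

definition strip_continuous :: "(real \<Rightarrow> real \<Rightarrow> real) \<Rightarrow> bool" where
  "strip_continuous w \<longleftrightarrow> continuous_on (UNIV \<times> {0<..}) (\<lambda>(x, t). w x t)"

lemma strip_continuous_compose:
  fixes g h :: "'a::topological_space \<Rightarrow> real"
  assumes "strip_continuous w" "continuous_on S g" "continuous_on S h" "\<And>z. z \<in> S \<Longrightarrow> 0 < h z"
  shows "continuous_on S (\<lambda>z. w (g z) (h z))"
proof -
  have "continuous_on S (\<lambda>z. (\<lambda>(x, t). w x t) (g z, h z))"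
    using assms by (intro continuous_on_compose2[OF assms(1)[unfolded strip_continuous_def]] continuous_intros) auto
  then show ?thesis by simp
qed

text \<open>
  The derivatives are separate arguments, so that reflections, translations and differences of
  solutions are again instances with explicit derivatives.
\<close>

definition classical :: "(real \<Rightarrow> real \<Rightarrow> real) \<Rightarrow> (real \<Rightarrow> real \<Rightarrow> real) \<Rightarrow> (real \<Rightarrow> real \<Rightarrow> real)
    \<Rightarrow> (real \<Rightarrow> real \<Rightarrow> real) \<Rightarrow> bool" where
  "classical w wx wxx wt \<longleftrightarrow>
     (\<forall>x. \<forall>t>0. ((\<lambda>y. w y t) has_real_derivative wx x t) (at x) \<and>
                ((\<lambda>y. wx y t) has_real_derivative wxx x t) (at x) \<and>
                ((\<lambda>s. w x s) has_real_derivative wt x t) (at t)) \<and>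
     strip_continuous w \<and> strip_continuous wx \<and> strip_continuous wxx \<and> strip_continuous wt"

lemma classicalD:
  assumes "classical w wx wxx wt"
  shows "0 < t \<Longrightarrow> ((\<lambda>y. w y t) has_real_derivative wx x t) (at x within S)"
    and "0 < t \<Longrightarrow> ((\<lambda>y. wx y t) has_real_derivative wxx x t) (at x within S)"
    and "0 < t \<Longrightarrow> ((\<lambda>s. w x s) has_real_derivative wt x t) (at t within S)"
    and "strip_continuous w" "strip_continuous wx" "strip_continuous wxx" "strip_continuous wt"
  using assms unfolding classical_def by (blast intro: has_field_derivative_at_within)+

lemma strip_continuous_affine:
  assumes "strip_continuous w" "T \<ge> 0"
  shows "strip_continuous (\<lambda>x t. c * w (a * x + b) (t + T))"
  unfolding strip_continuous_def case_prod_beta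
  using assms(2) by (intro continuous_intros strip_continuous_compose[OF assms(1)]) auto

lemma classical_affine:
  assumes "classical w wx wxx wt" "T \<ge> 0"
  shows "classical (\<lambda>x t. w (a * x + b) (t + T)) (\<lambda>x t. a * wx (a * x + b) (t + T))
           (\<lambda>x t. a^2 * wxx (a * x + b) (t + T)) (\<lambda>x t. wt (a * x + b) (t + T))"
proof -
  note D = classicalD[OF assms(1)]
  have 1: "((\<lambda>y. w (a * y + b) (t + T)) has_real_derivative a * wx (a * x + b) (t + T)) (at x)"
    and 2: "((\<lambda>y. a * wx (a * y + b) (t + T)) has_real_derivative a^2 * wxx (a * x + b) (t + T)) (at x)"
    and 3: "((\<lambda>s. w (a * x + b) (s + T)) has_real_derivative wt (a * x + b) (t + T)) (at t)"
    if "t > 0" for x t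
  proof -
    have p: "t + T > 0" using that assms by simp
    have A: "((\<lambda>y. a * y + b) has_real_derivative a) (at x)"
      by (auto intro!: derivative_eq_intros)
    have B: "((\<lambda>s. s + T) has_real_derivative 1) (at t)"
      by (auto intro!: derivative_eq_intros)
    show "((\<lambda>y. w (a * y + b) (t + T)) has_real_derivative a * wx (a * x + b) (t + T)) (at x)"
      using DERIV_chain2[OF D(1)[OF p] A] by (simp add: mult.commute)
    show "((\<lambda>y. a * wx (a * y + b) (t + T)) has_real_derivative a^2 * wxx (a * x + b) (t + T)) (at x)"
      using DERIV_cmult[OF DERIV_chain2[OF D(2)[OF p] A], of a] by (simp add: power2_eq_square mult_ac)
    show "((\<lambda>s. w (a * x + b) (s + T)) has_real_derivative wt (a * x + b) (t + T)) (at t)"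
      using DERIV_chain2[OF D(3)[OF p] B] by simp
  qed
  show ?thesis
    unfolding classical_def
    using 1 2 3 strip_continuous_affine[OF D(4) assms(2), of 1 a b] strip_continuous_affine[OF D(5) assms(2), of a a b]
      strip_continuous_affine[OF D(6) assms(2), of "a^2" a b] strip_continuous_affine[OF D(7) assms(2), of 1 a b]
    by simp
qed

lemma strip_continuous_diff:
  assumes "strip_continuous v" "strip_continuous w"
  shows "strip_continuous (\<lambda>x t. v x t - w x t)"
  using assms unfolding strip_continuous_def case_prod_beta by (intro continuous_intros)

lemma classical_diff:
  assumes "classical v vx vxx vt" "classical w wx wxx wt"
  shows "classical (\<lambda>x t. v x t - w x t) (\<lambda>x t. vx x t - wx x t) (\<lambda>x t. vxx x t - wxx x t)
           (\<lambda>x t. vt x t - wt x t)"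
  using assms unfolding classical_def by (auto intro: DERIV_diff strip_continuous_diff)

text \<open>
  Needed for moving frames: the partial derivatives are continuous, so the chain rule holds along any
  differentiable path in the half-plane.
\<close>

lemma classical_along_curve:
  assumes w: "classical w wx wxx wt" and t: "t > 0" and g: "(g has_real_derivative g') (at t)"
  shows "((\<lambda>s. w (g s) s) has_real_derivative (wx (g t) t * g' + wt (g t) t)) (at t)"
proof -
  note D = classicalD[OF w]
  have "((\<lambda>(x, s). w x s) has_derivative (\<lambda>(a, b). wx (g t) t * a + blinfun_apply (blinfun_mult_right (wt (g t) t)) b))
      (at (g t, t) within UNIV \<times> {0<..})"
  proof (rule has_derivative_partialsI[where fy = "\<lambda>x s. blinfun_mult_right (wt x s)"])
    show "((\<lambda>x. w x t) has_derivative (*) (wx (g t) t)) (at (g t))"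
      using D(1)[OF t, of "g t" UNIV] by (simp add: has_field_derivative_def)
    show "((\<lambda>s. w x s) has_derivative blinfun_apply (blinfun_mult_right (wt x s))) (at s within {0<..})"
      if "s \<in> {0<..}" for x s
      using D(3)[of s x] that by (simp add: has_field_derivative_def)
    have "continuous_on (UNIV \<times> {0<..}) (\<lambda>(x, s). blinfun_mult_right (wt x s))"
      unfolding case_prod_beta
      by (intro continuous_intros strip_continuous_compose[OF D(7)]) auto
    then show "continuous (at (g t, t) within UNIV \<times> {0<..}) (\<lambda>(x, s). blinfun_mult_right (wt x s))"
      using t by (simp add: continuous_on_eq_continuous_within)
  qed (use t in auto)
  moreover have "at (g t, t) within UNIV \<times> {0<..} = at (g t, t)"
    using t by (intro at_within_open) (auto intro: open_Times)
  ultimately have W: "((\<lambda>(x, s). w x s) has_derivative (\<lambda>(a, b). wx (g t) t * a + wt (g t) t * b)) (at (g t, t))"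
    by simp
  have "((\<lambda>s. (g s, s)) has_derivative (\<lambda>h. (g' * h, h))) (at t)"
    using g by (intro has_derivative_Pair has_derivative_ident) (simp add: has_field_derivative_def)
  from has_derivative_compose[OF this W]
  have "((\<lambda>s. w (g s) s) has_derivative (\<lambda>h. wx (g t) t * (g' * h) + wt (g t) t * h)) (at t)"
    by simp
  moreover have "(\<lambda>h. wx (g t) t * (g' * h) + wt (g t) t * h) = (*) (wx (g t) t * g' + wt (g t) t)"
    by (simp add: fun_eq_iff algebra_simps)
  ultimately show ?thesis by (simp add: has_field_derivative_def)
qed

section \<open>Maximum principles\<close>

text \<open>
  The second derivative is only used strictly to the right of the maximum. This allows a maximum at a
  boundary point, or at a point where one of two compared functions has no second derivative.
\<close>

lemma right_maximum_no_strict_convexity: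
  fixes k k1 k2 :: "real \<Rightarrow> real"
  assumes "r > 0" "\<And>x. x0 \<le> x \<Longrightarrow> x < x0 + r \<Longrightarrow> k x \<le> k x0"
    and "k1 x0 = 0" "continuous_on {x0..<x0 + r} k" "continuous_on {x0..<x0 + r} k1"
    and "\<And>x. x0 < x \<Longrightarrow> x < x0 + r \<Longrightarrow> (k has_real_derivative k1 x) (at x)"
    and "\<And>x. x0 < x \<Longrightarrow> x < x0 + r \<Longrightarrow> (k1 has_real_derivative k2 x) (at x)"
    and "\<And>x. x0 < x \<Longrightarrow> x < x0 + r \<Longrightarrow> k2 x > 0"
  shows False
proof -
  have pos: "k1 x > 0" if "x0 < x" "x < x0 + r" for x
  proof -
    have "k1 x0 < k1 x"
    proof (rule DERIV_pos_imp_increasing_open[of x0 x k1, OF that(1)])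
      show "\<exists>y'. DERIV k1 y :> y' \<and> y' > 0" if "x0 < y" "y < x" for y
        using assms(7,8)[of y] that \<open>x < x0 + r\<close> by auto
      show "continuous_on {x0..x} k1"
        by (rule continuous_on_subset[OF assms(5)]) (use that in auto)
    qed
    then show ?thesis using assms by simp
  qed
  have "k x0 < k (x0 + r / 2)"
  proof (rule DERIV_pos_imp_increasing_open[of x0 "x0 + r / 2" k])
    show "\<exists>y. DERIV k x :> y \<and> y > 0" if "x0 < x" "x < x0 + r / 2" for x
      using assms(1) assms(6)[of x] pos[of x] that by auto
    show "continuous_on {x0..x0 + r / 2} k"
      by (rule continuous_on_subset[OF assms(4)]) (use assms(1) in auto)
  qed (use assms(1) in simp)
  then show False using assms(2)[of "x0 + r / 2"] \<open>r > 0\<close> by simp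
qed

lemma interior_maximum_second_derivative:
  fixes k k1 :: "real \<Rightarrow> real"
  assumes "a < x0" "x0 < b" "\<And>x. a \<le> x \<Longrightarrow> x \<le> b \<Longrightarrow> k x \<le> k x0"
    and "\<And>x. (k has_real_derivative k1 x) (at x)"
    and "\<And>x. (k1 has_real_derivative k2 x) (at x)"
    and "continuous_on UNIV k2"
  shows "k1 x0 = 0" "k2 x0 \<le> 0"
proof -
  show 0: "k1 x0 = 0"
    by (rule DERIV_local_max[of k "k1 x0" x0 "min (x0 - a) (b - x0)"]) (use assms in auto)
  show "k2 x0 \<le> 0"
  proof (rule ccontr)
    assume "\<not> k2 x0 \<le> 0"
    then have "\<forall>\<^sub>F x in nhds x0. k2 x > 0"
      using assms(6) by (intro order_tendstoD(1)[of _ "k2 x0"])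
        (auto simp: continuous_on_eq_continuous_at isCont_def tendsto_at_iff_tendsto_nhds)
    then obtain d where d: "d > 0" "\<And>x. dist x x0 < d \<Longrightarrow> k2 x > 0"
      unfolding eventually_nhds_metric by blast
    define r where "r = min d (b - x0)"
    show False
    proof (rule right_maximum_no_strict_convexity[of r x0 k k1 k2])
      show "continuous_on {x0..<x0 + r} k" "continuous_on {x0..<x0 + r} k1"
        using assms(4,5) by (auto intro!: continuous_at_imp_continuous_on DERIV_isCont)
    qed (use assms 0 d in \<open>auto simp: r_def dist_real_def\<close>)
  qed
qed

text \<open>
  Compactness provides the maximum; as it is positive, it is not attained at the initial time, so it can
  be approached from earlier times.
\<close>

lemma parabolic_maximum_point:
  fixes D :: "real \<Rightarrow> real \<Rightarrow> real"
  assumes c: "continuous_on ({a..b} \<times> {t1..t2}) (\<lambda>(x, t). D x t)"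
    and p: "x0 \<in> {a..b}" "t0 \<in> {t1..t2}" "D x0 t0 > 0"
    and i: "\<And>x. x \<in> {a..b} \<Longrightarrow> D x t1 \<le> 0"
  obtains x t where "x \<in> {a..b}" "t1 < t" "t \<le> t2" "D x t > 0"
    "\<And>y s. y \<in> {a..b} \<Longrightarrow> s \<in> {t1..t2} \<Longrightarrow> D y s \<le> D x t"
    "\<And>d. ((\<lambda>s. D x s) has_real_derivative d) (at t) \<Longrightarrow> d \<ge> 0"
proof -
  obtain z where z: "z \<in> {a..b} \<times> {t1..t2}"
    "\<forall>y\<in>{a..b} \<times> {t1..t2}. (\<lambda>(x, t). D x t) y \<le> (\<lambda>(x, t). D x t) z"
    using continuous_attains_sup[OF _ _ c] p by (auto simp: compact_Times)
  obtain x t where xt: "z = (x, t)" by (cases z)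
  have mx: "D y s \<le> D x t" if "y \<in> {a..b}" "s \<in> {t1..t2}" for y s
    using z(2) that xt by auto
  have pos: "D x t > 0" using mx[OF p(1,2)] p(3) by simp
  have "t1 \<noteq> t" using i[of x] pos z(1) xt by auto
  then have t: "t1 < t" "t \<le> t2" "x \<in> {a..b}" using z(1) xt by auto
  have "d \<ge> 0" if d: "((\<lambda>s. D x s) has_real_derivative d) (at t)" for d
  proof (rule ccontr)
    assume "\<not> d \<ge> 0"
    then obtain e where e: "e > 0" "\<forall>h>0. h < e \<longrightarrow> D x t < D x (t - h)"
      using DERIV_neg_dec_left[OF d] by auto
    define h where "h = min (e/2) (t - t1)"
    have "h > 0" "h < e" "t - h \<in> {t1..t2}" using e t by (auto simp: h_def min_def)
    then show False using e(2) mx[OF t(3)] by force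
  qed
  then show ?thesis using that[OF t(3,1,2) pos mx] by blast
qed

section \<open>Weighted integral estimates and comparison\<close>

lemma exp_Gronwall:
  fixes y y' :: "real \<Rightarrow> real"
  assumes "s \<le> t" "K \<ge> 0" "C \<ge> 0"
    and D: "\<And>\<tau>. s \<le> \<tau> \<Longrightarrow> \<tau> \<le> t \<Longrightarrow> (y has_real_derivative y' \<tau>) (at \<tau>)"
    and le: "\<And>\<tau>. s \<le> \<tau> \<Longrightarrow> \<tau> \<le> t \<Longrightarrow> y' \<tau> \<le> K * y \<tau> + C"
  shows "y t \<le> exp (K * (t - s)) * (y s + C * (t - s))"
proof -
  define z where "z \<tau> = exp (- K * (\<tau> - s)) * y \<tau> - C * (\<tau> - s)" for \<tau>
  have dz: "(z has_real_derivative exp (- K * (\<tau> - s)) * (y' \<tau> - K * y \<tau>) - C) (at \<tau>)"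
    if "s \<le> \<tau>" "\<tau> \<le> t" for \<tau>
    unfolding z_def
    by (auto intro!: derivative_eq_intros D that simp: algebra_simps)
  have "z t \<le> z s"
  proof (rule DERIV_nonpos_imp_nonincreasing[OF assms(1)])
    fix \<tau> assume t: "s \<le> \<tau>" "\<tau> \<le> t"
    have "y' \<tau> - K * y \<tau> \<le> C" using le[OF t] by simp
    then have "exp (- K * (\<tau> - s)) * (y' \<tau> - K * y \<tau>) \<le> exp (- K * (\<tau> - s)) * C"
      by (intro mult_left_mono) auto
    also have "\<dots> \<le> 1 * C" using t assms by (intro mult_right_mono) auto
    finally show "\<exists>y. DERIV z \<tau> :> y \<and> y \<le> 0" using dz[OF t] by force
  qed
  then have "exp (- K * (t - s)) * y t \<le> y s + C * (t - s)"
    by (simp add: z_def)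
  then have "exp (K * (t - s)) * (exp (- K * (t - s)) * y t) \<le> exp (K * (t - s)) * (y s + C * (t - s))"
    by (intro mult_left_mono) auto
  then show ?thesis by (simp add: mult.assoc[symmetric] exp_add[symmetric])
qed

text \<open>
  Multiply the equation by \<open>\<rho> P'(w)\<close> and integrate by parts twice. Convexity of \<open>P\<close> gives the gradient
  term a good sign, and derivatives fall only on the weight \<open>\<rho>\<close>. The conditions at \<open>\<alpha>\<close> hold if the
  weight vanishes there to second order, and also if \<open>\<rho>'\<close> and \<open>P'(w)\<close> vanish there.
\<close>

lemma weighted_integral_growth:
  fixes w wx wxx wt :: "real \<Rightarrow> real \<Rightarrow> real" and P P1 P2 \<rho> \<rho>1 \<rho>2 :: "real \<Rightarrow> real"
  assumes w: "classical w wx wxx wt"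
    and src: "\<And>x t. t > 0 \<Longrightarrow> \<bar>wt x t - wxx x t\<bar> \<le> L * \<bar>w x t\<bar>"
    and dP: "\<And>z. (P has_real_derivative P1 z) (at z)" "\<And>z. (P1 has_real_derivative P2 z) (at z)"
    and cP2: "continuous_on UNIV P2"
    and P: "\<And>z. P z \<ge> 0" "\<And>z. P2 z \<ge> 0" "\<And>z. \<bar>P1 z\<bar> * \<bar>z\<bar> \<le> k * P z"
    and Q: "\<And>x t. t > 0 \<Longrightarrow> P (w x t) \<le> Q"
    and d\<rho>: "\<And>x. (\<rho> has_real_derivative \<rho>1 x) (at x)" "\<And>x. (\<rho>1 has_real_derivative \<rho>2 x) (at x)"
    and c\<rho>2: "continuous_on UNIV \<rho>2"
    and \<rho>: "\<And>x. x \<in> {\<alpha>..\<beta>} \<Longrightarrow> \<rho> x \<ge> 0" "\<And>x. x \<in> {\<alpha>..\<beta>} \<Longrightarrow> \<bar>\<rho>2 x\<bar> \<le> N"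
    and bdry: "\<And>t. t > 0 \<Longrightarrow> \<rho> \<alpha> * P1 (w \<alpha> t) = 0" "\<And>t. t > 0 \<Longrightarrow> \<rho>1 \<alpha> * P (w \<alpha> t) = 0" "\<rho> \<beta> = 0" "\<rho>1 \<beta> = 0"
    and "L \<ge> 0" "k \<ge> 0" "\<alpha> \<le> \<beta>" "0 < s" "s \<le> t"
  shows "integral {\<alpha>..\<beta>} (\<lambda>x. \<rho> x * P (w x t)) \<le>
     exp (k * L * (t - s)) * (integral {\<alpha>..\<beta>} (\<lambda>x. \<rho> x * P (w x s)) + N * Q * (\<beta> - \<alpha>) * (t - s))"
proof -
  note D = classicalD[OF w]
  have cP: "continuous_on S P" and cP1: "continuous_on S P1" for S
    using dP by (auto intro!: continuous_at_imp_continuous_on DERIV_isCont)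
  have c\<rho>: "continuous_on S \<rho>" and c\<rho>1: "continuous_on S \<rho>1" for S
    using d\<rho> by (auto intro!: continuous_at_imp_continuous_on DERIV_isCont)
  have cP2': "continuous_on S P2" and c\<rho>2': "continuous_on S \<rho>2" for S
    using cP2 c\<rho>2 continuous_on_subset by blast+
  note cc = continuous_on_compose2[OF cP[of UNIV]] continuous_on_compose2[OF cP1[of UNIV]] continuous_on_compose2[OF cP2]
    continuous_on_compose2[OF c\<rho>[of UNIV]] continuous_on_compose2[OF c\<rho>1[of UNIV]] continuous_on_compose2[OF c\<rho>2]
    strip_continuous_compose[OF D(4)] strip_continuous_compose[OF D(5)] strip_continuous_compose[OF D(6)] strip_continuous_compose[OF D(7)]
  have int: "h integrable_on {\<alpha>..\<beta>}" if "continuous_on {\<alpha>..\<beta>} h" for h :: "real \<Rightarrow> real"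
    using that integrable_continuous_interval by blast
  define y where "y \<tau> = integral {\<alpha>..\<beta>} (\<lambda>x. \<rho> x * P (w x \<tau>))" for \<tau>
  define y' where "y' \<tau> = integral {\<alpha>..\<beta>} (\<lambda>x. \<rho> x * (P1 (w x \<tau>) * wt x \<tau>))" for \<tau>
  have dy: "(y has_real_derivative y' \<tau>) (at \<tau>)" if "\<tau> > 0" for \<tau>
  proof -
    have "((\<lambda>\<tau>. integral (cbox \<alpha> \<beta>) (\<lambda>x. \<rho> x * P (w x \<tau>))) has_real_derivative
        integral (cbox \<alpha> \<beta>) (\<lambda>x. \<rho> x * (P1 (w x \<tau>) * wt x \<tau>))) (at \<tau> within {0<..})"
    proof (rule leibniz_rule_field_derivative)
      fix x t :: real assume "x \<in> {0<..}"
      then show "((\<lambda>x. \<rho> t * P (w t x)) has_real_derivative \<rho> t * (P1 (w t x) * wt t x)) (at x within {0<..})"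
        using DERIV_cmult[OF DERIV_chain2[OF dP(1) D(3)]] by auto
    next
      fix x :: real assume "x \<in> {0<..}"
      then show "(\<lambda>t. \<rho> t * P (w t x)) integrable_on cbox \<alpha> \<beta>"
        by (auto intro!: int continuous_intros cc)
    next
      show "continuous_on ({0<..} \<times> cbox \<alpha> \<beta>) (\<lambda>(x, t). \<rho> t * (P1 (w t x) * wt t x))"
        by (auto simp: case_prod_beta intro!: continuous_intros cc)
    qed (use that in auto)
    then show ?thesis using that at_within_open[of \<tau> "{0<..}"] by (simp add: y_def[abs_def] y'_def)
  qed
  have le: "y' \<tau> \<le> (k * L) * y \<tau> + N * Q * (\<beta> - \<alpha>)" if t: "\<tau> > 0" for \<tau>
  proof -
    have dpsi: "((\<lambda>x. \<rho> x * P1 (w x \<tau>) * wx x \<tau> - \<rho>1 x * P (w x \<tau>)) has_real_derivative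
       (\<rho> x * P2 (w x \<tau>) * (wx x \<tau>)\<^sup>2 + \<rho> x * P1 (w x \<tau>) * wxx x \<tau> - \<rho>2 x * P (w x \<tau>))) (at x within {\<alpha>..\<beta>})" for x
      by (rule derivative_eq_intros refl d\<rho>[THEN has_field_derivative_at_within] D(1,2)[OF t] DERIV_chain2[OF dP(1)] DERIV_chain2[OF dP(2)])+
        (simp add: algebra_simps power2_eq_square)
    \<comment> \<open>The flux \<open>\<rho> P'(w) w\<^sub>x - \<rho>' P(w)\<close> vanishes at both ends, so its derivative integrates to zero.\<close>
    have "((\<lambda>x. \<rho> x * P2 (w x \<tau>) * (wx x \<tau>)\<^sup>2 + \<rho> x * P1 (w x \<tau>) * wxx x \<tau> - \<rho>2 x * P (w x \<tau>)) has_integral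
       ((\<rho> \<beta> * P1 (w \<beta> \<tau>) * wx \<beta> \<tau> - \<rho>1 \<beta> * P (w \<beta> \<tau>)) - (\<rho> \<alpha> * P1 (w \<alpha> \<tau>) * wx \<alpha> \<tau> - \<rho>1 \<alpha> * P (w \<alpha> \<tau>)))) {\<alpha>..\<beta>}"
      using dpsi by (intro fundamental_theorem_of_calculus)
        (auto simp: has_real_derivative_iff_has_vector_derivative[symmetric] \<open>\<alpha> \<le> \<beta>\<close>)
    then have hz: "((\<lambda>x. \<rho> x * P2 (w x \<tau>) * (wx x \<tau>)\<^sup>2 + \<rho> x * P1 (w x \<tau>) * wxx x \<tau> - \<rho>2 x * P (w x \<tau>)) has_integral 0) {\<alpha>..\<beta>}"
      using bdry t by simp
    have "y' \<tau> = integral {\<alpha>..\<beta>} (\<lambda>x. \<rho> x * (P1 (w x \<tau>) * wt x \<tau>)) -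
       integral {\<alpha>..\<beta>} (\<lambda>x. \<rho> x * P2 (w x \<tau>) * (wx x \<tau>)\<^sup>2 + \<rho> x * P1 (w x \<tau>) * wxx x \<tau> - \<rho>2 x * P (w x \<tau>))"
      using integral_unique[OF hz] by (simp add: y'_def)
    also have "\<dots> = integral {\<alpha>..\<beta>} (\<lambda>x. \<rho> x * (P1 (w x \<tau>) * wt x \<tau>) -
       (\<rho> x * P2 (w x \<tau>) * (wx x \<tau>)\<^sup>2 + \<rho> x * P1 (w x \<tau>) * wxx x \<tau> - \<rho>2 x * P (w x \<tau>)))"
      by (rule integral_diff[symmetric]) (auto intro!: int continuous_intros cc simp: t)
    also have "\<dots> \<le> integral {\<alpha>..\<beta>} (\<lambda>x. (k * L) * (\<rho> x * P (w x \<tau>)) + N * Q)"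
    proof (rule integral_le)
      fix x assume x: "x \<in> {\<alpha>..\<beta>}"
      have "P1 (w x \<tau>) * (wt x \<tau> - wxx x \<tau>) \<le> \<bar>P1 (w x \<tau>)\<bar> * (L * \<bar>w x \<tau>\<bar>)"
      proof -
        have "P1 (w x \<tau>) * (wt x \<tau> - wxx x \<tau>) \<le> \<bar>P1 (w x \<tau>)\<bar> * \<bar>wt x \<tau> - wxx x \<tau>\<bar>"
          by (metis abs_ge_self abs_mult)
        also have "\<dots> \<le> \<bar>P1 (w x \<tau>)\<bar> * (L * \<bar>w x \<tau>\<bar>)"
          by (intro mult_left_mono src t) auto
        finally show ?thesis .
      qed
      also have "\<dots> = L * (\<bar>P1 (w x \<tau>)\<bar> * \<bar>w x \<tau>\<bar>)" by simp
      also have "\<dots> \<le> L * (k * P (w x \<tau>))" using P(3) \<open>L \<ge> 0\<close> by (intro mult_left_mono)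
      finally have 1: "\<rho> x * (P1 (w x \<tau>) * (wt x \<tau> - wxx x \<tau>)) \<le> \<rho> x * (L * (k * P (w x \<tau>)))"
        using \<rho>(1)[OF x] by (intro mult_left_mono)
      have 2: "\<rho>2 x * P (w x \<tau>) \<le> N * Q"
      proof -
        have "\<rho>2 x * P (w x \<tau>) \<le> N * P (w x \<tau>)" using \<rho>(2)[OF x] P(1) by (intro mult_right_mono) auto
        also have "\<dots> \<le> N * Q" using \<rho>(2)[OF x] Q[OF t] by (intro mult_left_mono) auto
        finally show ?thesis .
      qed
      have 3: "\<rho> x * P2 (w x \<tau>) * (wx x \<tau>)\<^sup>2 \<ge> 0" using \<rho>(1)[OF x] P(2) by simp
      show "\<rho> x * (P1 (w x \<tau>) * wt x \<tau>) -
         (\<rho> x * P2 (w x \<tau>) * (wx x \<tau>)\<^sup>2 + \<rho> x * P1 (w x \<tau>) * wxx x \<tau> - \<rho>2 x * P (w x \<tau>))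
         \<le> (k * L) * (\<rho> x * P (w x \<tau>)) + N * Q"
        using 1 2 3 by (simp add: algebra_simps)
    qed (auto intro!: int continuous_intros cc simp: t)
    also have "\<dots> = (k * L) * y \<tau> + N * Q * (\<beta> - \<alpha>)"
    proof -
      have "integral {\<alpha>..\<beta>} (\<lambda>x. (k * L) * (\<rho> x * P (w x \<tau>)) + N * Q)
          = integral {\<alpha>..\<beta>} (\<lambda>x. (k * L) * (\<rho> x * P (w x \<tau>))) + integral {\<alpha>..\<beta>} (\<lambda>x. N * Q)"
        by (rule integral_add) (auto intro!: int continuous_intros cc simp: t)
      also have "integral {\<alpha>..\<beta>} (\<lambda>x. (k * L) * (\<rho> x * P (w x \<tau>))) = (k * L) * y \<tau>"
        unfolding y_def by (rule integral_mult_right)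
      also have "integral {\<alpha>..\<beta>} (\<lambda>x. N * Q) = N * Q * (\<beta> - \<alpha>)"
        using \<open>\<alpha> \<le> \<beta>\<close> by simp
      finally show ?thesis .
    qed
    finally show ?thesis .
  qed
  have "0 \<le> N * Q * (\<beta> - \<alpha>)"
  proof -
    have "N \<ge> 0" using \<rho>(2)[of \<alpha>] \<open>\<alpha> \<le> \<beta>\<close> by fastforce
    moreover have "Q \<ge> 0" using Q[of s] P(1) \<open>0 < s\<close> order_trans by blast
    ultimately show ?thesis using \<open>\<alpha> \<le> \<beta>\<close> by simp
  qed
  then show ?thesis
    using exp_Gronwall[of s t "k * L" "N * Q * (\<beta> - \<alpha>)" y y'] dy le assms
    by (simp add: y_def)
qed

lemma positive_part_power_derivative:
  "((\<lambda>z::real. (max 0 z) ^ Suc (Suc n)) has_real_derivative real (Suc (Suc n)) * (max 0 z) ^ Suc n) (at z)"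
proof -
  consider "z > 0" | "z < 0" | "z = 0" by linarith
  then show ?thesis
  proof cases
    case 1
    have "((\<lambda>z::real. z ^ Suc (Suc n)) has_real_derivative real (Suc (Suc n)) * (max 0 z) ^ Suc n) (at z)"
      using 1 DERIV_pow[of "Suc (Suc n)" z UNIV] by (simp add: max_def)
    moreover have "\<forall>\<^sub>F x in nhds z. x > 0" using 1 eventually_nhds_in_open[of "{0<..}" z] by simp
    ultimately show ?thesis
      by (subst DERIV_cong_ev[OF refl _ refl]) (auto elim!: eventually_mono simp: max_def)
  next
    case 2
    have "((\<lambda>z::real. 0) has_real_derivative real (Suc (Suc n)) * (max 0 z) ^ Suc n) (at z)"
      using 2 by (simp add: max_def)
    moreover have "\<forall>\<^sub>F x in nhds z. x < 0" using 2 eventually_nhds_in_open[of "{..<0}" z] by simp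
    ultimately show ?thesis
      by (subst DERIV_cong_ev[OF refl _ refl]) (auto elim!: eventually_mono simp: max_def)
  next
    case 3
    have "((\<lambda>h::real. (max 0 h) ^ Suc (Suc n) / h) \<longlongrightarrow> 0) (at 0)"
    proof (rule Lim_null_comparison)
      show "\<forall>\<^sub>F h in at 0. norm ((max 0 h) ^ Suc (Suc n) / h) \<le> \<bar>h\<bar> ^ Suc n"
      proof (rule always_eventually, rule allI)
        fix h :: real
        have "norm ((max 0 h) ^ Suc (Suc n) / h) = (max 0 h) ^ Suc (Suc n) / \<bar>h\<bar>" by (simp add: abs_mult)
        also have "\<dots> \<le> \<bar>h\<bar> ^ Suc (Suc n) / \<bar>h\<bar>" by (intro divide_right_mono power_mono) auto
        also have "\<dots> = \<bar>h\<bar> ^ Suc n" by simp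
        finally show "norm ((max 0 h) ^ Suc (Suc n) / h) \<le> \<bar>h\<bar> ^ Suc n" .
      qed
      show "((\<lambda>h::real. \<bar>h\<bar> ^ Suc n) \<longlongrightarrow> 0) (at 0)"
        by (auto intro!: tendsto_eq_intros)
    qed
    then show ?thesis using 3 by (simp add: DERIV_def)
  qed
qed

text \<open>
  A polynomial weight: it vanishes to second order at distance \<open>R\<close> from \<open>a\<close> and tends to one as \<open>R\<close>
  grows, while its second derivative is at most \<open>8 / R\<^sup>2\<close> in between.
\<close>

definition cutoff :: "real \<Rightarrow> real \<Rightarrow> real \<Rightarrow> real" where
  "cutoff a R x = (1 - ((x - a) / R)\<^sup>2)\<^sup>2"

definition cutoff1 :: "real \<Rightarrow> real \<Rightarrow> real \<Rightarrow> real" where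
  "cutoff1 a R x = - 4 * (x - a) / R\<^sup>2 * (1 - ((x - a) / R)\<^sup>2)"

definition cutoff2 :: "real \<Rightarrow> real \<Rightarrow> real \<Rightarrow> real" where
  "cutoff2 a R x = - 4 / R\<^sup>2 + 12 * ((x - a) / R)\<^sup>2 / R\<^sup>2"

lemma cutoff_derivatives:
  "(cutoff a R has_real_derivative cutoff1 a R x) (at x within S)"
  "(cutoff1 a R has_real_derivative cutoff2 a R x) (at x within S)" if "R > 0"
  unfolding cutoff_def[abs_def] cutoff1_def[abs_def] cutoff2_def
   using that by (auto intro!: derivative_eq_intros simp: power2_eq_square field_simps)

lemma cutoff_continuous [continuous_intros]:
  "continuous_on S g \<Longrightarrow> R > 0 \<Longrightarrow> continuous_on S (\<lambda>x. cutoff a R (g x))"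
  "continuous_on S g \<Longrightarrow> R > 0 \<Longrightarrow> continuous_on S (\<lambda>x. cutoff1 a R (g x))"
  "continuous_on S g \<Longrightarrow> R > 0 \<Longrightarrow> continuous_on S (\<lambda>x. cutoff2 a R (g x))"
  unfolding cutoff_def cutoff1_def cutoff2_def by (intro continuous_intros; simp)+

lemma cutoff_bounds:
  assumes "R > 0" "\<bar>x - a\<bar> \<le> R"
  shows "0 \<le> cutoff a R x" "cutoff a R x \<le> 1" "\<bar>cutoff2 a R x\<bar> \<le> 8 / R\<^sup>2"
proof -
  have q: "((x - a) / R)\<^sup>2 \<le> 1" "0 \<le> ((x - a) / R)\<^sup>2"
    using assms by (auto simp: power_divide divide_le_eq abs_le_square_iff[symmetric])
  show "0 \<le> cutoff a R x" by (simp add: cutoff_def)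
  show "cutoff a R x \<le> 1" unfolding cutoff_def using q by (intro power_le_one) auto
  have "cutoff2 a R x = (- 4 + 12 * ((x - a) / R)\<^sup>2) / R\<^sup>2"
    by (simp add: cutoff2_def diff_divide_distrib)
  also have "\<bar>\<dots>\<bar> = \<bar>- 4 + 12 * ((x - a) / R)\<^sup>2\<bar> / R\<^sup>2" by simp
  also have "\<dots> \<le> 8 / R\<^sup>2"
  proof (rule divide_right_mono)
    show "\<bar>- 4 + 12 * ((x - a) / R)\<^sup>2\<bar> \<le> 8" unfolding abs_le_iff using q by linarith
  qed simp
  finally show "\<bar>cutoff2 a R x\<bar> \<le> 8 / R\<^sup>2" .
qed

lemma cutoff_ge:
  assumes "R > 0" "\<bar>x - a\<bar> \<le> A" "A \<le> R"
  shows "(1 - (A / R)\<^sup>2)\<^sup>2 \<le> cutoff a R x"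
proof -
  have "\<bar>(x - a) / R\<bar> \<le> \<bar>A / R\<bar>" "\<bar>A / R\<bar> \<le> 1"
    using assms by (auto simp: divide_simps)
  then have "((x - a) / R)\<^sup>2 \<le> (A / R)\<^sup>2" "(A / R)\<^sup>2 \<le> 1"
    by (auto simp: abs_le_square_iff[symmetric] abs_square_le_1)
  then show ?thesis unfolding cutoff_def by (intro power_mono) auto
qed

text \<open>
  The cutoff error is of order \<open>1 / R\<^sup>2\<close> on an interval of length of order \<open>R\<close>, so boundedness of \<open>P(w)\<close>
  suffices to remove the cutoff. With \<open>\<sigma> = 1\<close> the estimate is on the whole line, with \<open>\<sigma> = 0\<close> on the
  half-line to the right of \<open>a\<close>, with \<open>P'(w) = 0\<close> at \<open>a\<close>. The initial value enters only through
  limits of integrals, as the solution need not be continuous at time zero.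
\<close>

lemma cutoff_growth:
  fixes w wx wxx wt :: "real \<Rightarrow> real \<Rightarrow> real" and P P1 P2 :: "real \<Rightarrow> real"
  assumes w: "classical w wx wxx wt"
    and src: "\<And>x t. t > 0 \<Longrightarrow> \<bar>wt x t - wxx x t\<bar> \<le> L * \<bar>w x t\<bar>"
    and dP: "\<And>z. (P has_real_derivative P1 z) (at z)" "\<And>z. (P1 has_real_derivative P2 z) (at z)"
    and cP2: "continuous_on UNIV P2"
    and P: "\<And>z. P z \<ge> 0" "\<And>z. P2 z \<ge> 0" "\<And>z. \<bar>P1 z\<bar> * \<bar>z\<bar> \<le> k * P z"
    and Q: "\<And>x t. t > 0 \<Longrightarrow> P (w x t) \<le> Q"
    and \<sigma>: "\<sigma> = 1 \<or> \<sigma> = 0 \<and> (\<forall>t>0. P1 (w a t) = 0)"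
    and init: "\<And>R e. R > 0 \<Longrightarrow> e > 0 \<Longrightarrow>
        \<forall>\<^sub>F s in at_right 0. integral {a - \<sigma> * R..a + R} (\<lambda>x. P (w x s)) \<le> C1 + e"
    and "L \<ge> 0" "k \<ge> 0" "0 < t" and \<alpha>: "\<sigma> = 0 \<Longrightarrow> a \<le> \<alpha>"
  shows "integral {\<alpha>..\<beta>} (\<lambda>x. P (w x t)) \<le> exp (k * L * t) * C1"
proof -
  note D = classicalD[OF w]
  have cP: "continuous_on UNIV P"
    using dP by (auto intro!: continuous_at_imp_continuous_on DERIV_isCont)
  have cPw: "continuous_on S (\<lambda>x. P (w x t))" if "t > 0" for S t
    by (intro continuous_on_compose2[OF cP] strip_continuous_compose[OF D(4)] continuous_intros) (use that in auto)
  have Q0: "Q \<ge> 0" using Q[OF \<open>0 < t\<close>] P(1) order_trans by blast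
  have main: "integral {a - \<sigma> * R..a + R} (\<lambda>x. cutoff a R x * P (w x t))
      \<le> exp (k * L * t) * (C1 + 16 * Q * t / R)" if R: "R > 0" for R
  proof -
    let ?I = "{a - \<sigma> * R..a + R}"
    have I: "\<bar>x - a\<bar> \<le> R" if "x \<in> ?I" for x using that \<sigma> R by auto
    have 1: "integral ?I (\<lambda>x. cutoff a R x * P (w x t)) \<le> exp (k * L * t) *
        (C1 + e + 16 * Q * t / R)" if e: "e > 0" for e
    proof -
      have "\<forall>\<^sub>F s in at_right 0. s < t" using eventually_at_right_real[OF \<open>0 < t\<close>] by (rule eventually_mono) auto
      moreover have "\<forall>\<^sub>F s in at_right 0. s > (0::real)" by (simp add: eventually_at_right_less)
      ultimately obtain s where s: "0 < s" "s < t" "integral ?I (\<lambda>x. P (w x s)) \<le> C1 + e"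
        using eventually_happens'[OF _ eventually_conj[OF _ eventually_conj[OF _ init[OF R e]]]] by (metis trivial_limit_at_right_real)
      have "integral ?I (\<lambda>x. cutoff a R x * P (w x t)) \<le>
         exp (k * L * (t - s)) * (integral ?I (\<lambda>x. cutoff a R x * P (w x s)) + 8 / R\<^sup>2 * Q * ((a + R) - (a - \<sigma> * R)) * (t - s))"
      proof (rule weighted_integral_growth[OF w src dP cP2 P Q])
        show "continuous_on UNIV (cutoff2 a R)" by (intro continuous_intros R)
        show "cutoff a R (a - \<sigma> * R) * P1 (w (a - \<sigma> * R) t) = 0" if "0 < t" for t
          using \<sigma> R that by (auto simp: cutoff_def)
        show "cutoff1 a R (a - \<sigma> * R) * P (w (a - \<sigma> * R) t) = 0" for t
          using \<sigma> R by (auto simp: cutoff1_def)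
        show "cutoff a R (a + R) = 0" "cutoff1 a R (a + R) = 0" using R by (auto simp: cutoff_def cutoff1_def)
        show "a - \<sigma> * R \<le> a + R" using \<sigma> R by auto
      qed (use R I cutoff_derivatives cutoff_bounds s \<open>L \<ge> 0\<close> \<open>k \<ge> 0\<close> in auto)
      also have "\<dots> \<le> exp (k * L * t) * (C1 + e + 16 * Q * t / R)"
      proof (rule mult_mono)
        show "exp (k * L * (t - s)) \<le> exp (k * L * t)"
          using s \<open>L \<ge> 0\<close> \<open>k \<ge> 0\<close> by (simp add: mult_left_mono)
        have "integral ?I (\<lambda>x. cutoff a R x * P (w x s)) \<le> integral ?I (\<lambda>x. P (w x s))"
        proof (rule integral_le)
          show "(\<lambda>x. cutoff a R x * P (w x s)) integrable_on ?I" "(\<lambda>x. P (w x s)) integrable_on ?I"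
            by (intro integrable_continuous_interval continuous_intros cPw R s)+
          show "cutoff a R x * P (w x s) \<le> P (w x s)" if "x \<in> ?I" for x
            using mult_right_mono[OF cutoff_bounds(2)[OF R I[OF that]] P(1)] by simp
        qed
        moreover have err: "0 \<le> 8 / R\<^sup>2 * Q * ((a + R) - (a - \<sigma> * R)) * (t - s)"
            "8 / R\<^sup>2 * Q * ((a + R) - (a - \<sigma> * R)) * (t - s) \<le> 16 * Q * t / R"
        proof -
          have eq: "8 / R\<^sup>2 * Q * ((a + R) - (a - \<sigma> * R)) * (t - s) = 8 * Q / R * ((1 + \<sigma>) * (t - s))"
            using R by (simp add: power2_eq_square divide_simps) (simp add: algebra_simps)
          have "0 \<le> (1 + \<sigma>) * (t - s)" "(1 + \<sigma>) * (t - s) \<le> 2 * t" using \<sigma> s by auto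
          moreover have "0 \<le> 8 * Q / R" using Q0 R by simp
          ultimately have "0 \<le> 8 * Q / R * ((1 + \<sigma>) * (t - s))" "8 * Q / R * ((1 + \<sigma>) * (t - s)) \<le> 8 * Q / R * (2 * t)"
            by (metis mult_nonneg_nonneg, metis mult_left_mono)
          then show "0 \<le> 8 / R\<^sup>2 * Q * ((a + R) - (a - \<sigma> * R)) * (t - s)"
            "8 / R\<^sup>2 * Q * ((a + R) - (a - \<sigma> * R)) * (t - s) \<le> 16 * Q * t / R"
            unfolding eq by simp_all
        qed
        ultimately show "integral ?I (\<lambda>x. cutoff a R x * P (w x s)) +
           8 / R\<^sup>2 * Q * ((a + R) - (a - \<sigma> * R)) * (t - s) \<le> C1 + e + 16 * Q * t / R"
          using s by linarith
        have "0 \<le> integral ?I (\<lambda>x. cutoff a R x * P (w x s))"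
        proof (rule integral_nonneg)
          show "(\<lambda>x. cutoff a R x * P (w x s)) integrable_on ?I"
            by (intro integrable_continuous_interval continuous_intros cPw R s)
          show "0 \<le> cutoff a R x * P (w x s)" for x by (simp add: cutoff_def P)
        qed
        with err show "0 \<le> integral ?I (\<lambda>x. cutoff a R x * P (w x s)) + 8 / R\<^sup>2 * Q * ((a + R) - (a - \<sigma> * R)) * (t - s)"
          by linarith
      qed simp
      finally show ?thesis .
    qed
    have "integral ?I (\<lambda>x. cutoff a R x * P (w x t)) \<le> exp (k * L * t) * (C1 + 16 * Q * t / R) + e" if e: "e > 0" for e
    proof -
      have "exp (k * L * t) * (C1 + e / exp (k * L * t) + 16 * Q * t / R)
          = exp (k * L * t) * (C1 + 16 * Q * t / R) + e"
        by (simp add: distrib_left)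
      then show ?thesis using 1[of "e / exp (k * L * t)"] e by simp
    qed
    then show ?thesis by (rule field_le_epsilon)
  qed
  define A where "A = max \<bar>\<alpha> - a\<bar> \<bar>\<beta> - a\<bar>"
  have L1: "((\<lambda>R. (1 - (A / R)\<^sup>2)\<^sup>2 * integral {\<alpha>..\<beta>} (\<lambda>x. P (w x t))) \<longlongrightarrow> (1 - 0\<^sup>2)\<^sup>2 * integral {\<alpha>..\<beta>} (\<lambda>x. P (w x t))) at_top"
    by (intro tendsto_intros tendsto_divide_0[OF tendsto_const filterlim_at_top_imp_at_infinity[OF filterlim_ident]])
  have L2: "((\<lambda>R. exp (k * L * t) * (C1 + 16 * Q * t / R)) \<longlongrightarrow> exp (k * L * t) * (C1 + 0)) at_top"
    by (intro tendsto_intros tendsto_divide_0[OF tendsto_const filterlim_at_top_imp_at_infinity[OF filterlim_ident]])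
  have E: "\<forall>\<^sub>F R in at_top. (1 - (A / R)\<^sup>2)\<^sup>2 * integral {\<alpha>..\<beta>} (\<lambda>x. P (w x t)) \<le> exp (k * L * t) * (C1 + 16 * Q * t / R)"
  proof -
    have "(1 - (A / R)\<^sup>2)\<^sup>2 * integral {\<alpha>..\<beta>} (\<lambda>x. P (w x t)) \<le> exp (k * L * t) * (C1 + 16 * Q * t / R)"
      if R: "R > A + 1" for R
    proof -
      have A: "A \<ge> 0" by (auto simp: A_def)
      have R0: "R > 0" using R A by simp
      have x: "\<bar>x - a\<bar> \<le> A" if "x \<in> {\<alpha>..\<beta>}" for x using that by (auto simp: A_def)
      have sub: "{\<alpha>..\<beta>} \<subseteq> {a - \<sigma> * R..a + R}"
      proof
        fix x assume x': "x \<in> {\<alpha>..\<beta>}"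
        have "\<sigma> = 1 \<or> \<sigma> = 0 \<and> a \<le> x" using \<sigma> \<alpha> x' by auto
        then show "x \<in> {a - \<sigma> * R..a + R}" using x[OF x'] R by auto
      qed
      have "(1 - (A / R)\<^sup>2)\<^sup>2 * integral {\<alpha>..\<beta>} (\<lambda>x. P (w x t)) = integral {\<alpha>..\<beta>} (\<lambda>x. (1 - (A / R)\<^sup>2)\<^sup>2 * P (w x t))"
        by simp
      also have "\<dots> \<le> integral {\<alpha>..\<beta>} (\<lambda>x. cutoff a R x * P (w x t))"
        by (intro integral_le integrable_continuous_interval continuous_intros cPw \<open>0 < t\<close> R0 mult_right_mono P cutoff_ge)
          (use x R R0 in auto)
      also have "\<dots> \<le> integral {a - \<sigma> * R..a + R} (\<lambda>x. cutoff a R x * P (w x t))"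
        by (intro integral_subset_le sub integrable_continuous_interval continuous_intros cPw \<open>0 < t\<close> R0)
          (auto intro!: mult_nonneg_nonneg P simp: cutoff_def)
      also note main[OF R0]
      finally show ?thesis .
    qed
    then show ?thesis by (intro eventually_at_top_linorderI[of "A + 2"]) auto
  qed
  show ?thesis using tendsto_le[OF trivial_limit_at_top_linorder L2 L1 E] by simp
qed

text \<open>
  The cube of the negative part is convex, twice continuously differentiable and homogeneous, so it is
  an admissible \<open>P\<close>. As \<open>w\<close> is bounded, it is dominated by the square, whose integral is
  controlled by convergence in \<open>L\<^sup>2\<close>.
\<close>

lemma comparison_on_half_line:
  assumes w: "classical w wx wxx wt"
    and src: "\<And>x t. t > 0 \<Longrightarrow> \<bar>wt x t - wxx x t\<bar> \<le> L * \<bar>w x t\<bar>"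
    and B: "\<And>x t. t > 0 \<Longrightarrow> \<bar>w x t\<bar> \<le> B"
    and wa: "\<And>t. t > 0 \<Longrightarrow> w a t = 0"
    and init: "\<And>R. R > 0 \<Longrightarrow> ((\<lambda>s. integral {a..a + R} (\<lambda>x. (max 0 (- w x s))\<^sup>2)) \<longlongrightarrow> 0) (at_right 0)"
    and "L \<ge> 0" "t > 0" "a \<le> x"
  shows "w x t \<ge> 0"
proof -
  note D = classicalD[OF w]
  define P where "P z = (max 0 (- z)) ^ 3" for z :: real
  define P1 where "P1 z = - (3 * (max 0 (- z)) ^ 2)" for z :: real
  define P2 where "P2 z = 6 * max 0 (- z)" for z :: real
  have dP: "(P has_real_derivative P1 z) (at z)" for z
  proof -
    have "((\<lambda>x. - x) has_real_derivative -1) (at z)" by (auto intro!: derivative_eq_intros)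
    from DERIV_chain2[OF positive_part_power_derivative[of 1 "- z"] this]
    show ?thesis by (simp add: P_def[abs_def] P1_def eval_nat_numeral)
  qed
  have dP1: "(P1 has_real_derivative P2 z) (at z)" for z
  proof -
    have "((\<lambda>x. - x) has_real_derivative -1) (at z)" by (auto intro!: derivative_eq_intros)
    from DERIV_cmult[OF DERIV_chain2[OF positive_part_power_derivative[of 0 "- z"] this], of "-3"]
    show ?thesis by (simp add: P1_def[abs_def] P2_def eval_nat_numeral)
  qed
  have B0: "B \<ge> 0" using B[OF \<open>t > 0\<close>, of x] by linarith
  have cPw: "continuous_on S (\<lambda>x. P (w x t))" if "t > 0" for S t
    unfolding P_def by (intro continuous_intros strip_continuous_compose[OF D(4)]) (use that in auto)
  have "integral {a..x + 1} (\<lambda>x. P (w x t)) \<le> exp (3 * L * t) * 0"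
  proof (rule cutoff_growth[OF w src dP dP1, where \<sigma> = 0 and Q = "B ^ 3" and a = a])
    show "continuous_on UNIV P2" unfolding P2_def[abs_def] by (intro continuous_intros)
    show "P z \<ge> 0" "P2 z \<ge> 0" "\<bar>P1 z\<bar> * \<bar>z\<bar> \<le> 3 * P z" for z
      by (auto simp: P_def P2_def P1_def max_def abs_mult eval_nat_numeral)
    show "P (w x t) \<le> B ^ 3" if "0 < t" for x t
      unfolding P_def using B[OF that, of x] B0 by (intro power_mono) auto
    show "0 = (1::real) \<or> (0::real) = 0 \<and> (\<forall>t>0. P1 (w a t) = 0)" using wa by (auto simp: P1_def)
    fix R e :: real assume R: "R > 0" "e > 0"
    have "((\<lambda>s. B * integral {a..a + R} (\<lambda>x. (max 0 (- w x s))\<^sup>2)) \<longlongrightarrow> B * 0) (at_right 0)"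
      by (intro tendsto_intros init R)
    then have "\<forall>\<^sub>F s in at_right 0. B * integral {a..a + R} (\<lambda>x. (max 0 (- w x s))\<^sup>2) < e"
      using R by (auto dest: order_tendstoD(2)[where a = e])
    moreover have "\<forall>\<^sub>F s in at_right 0. s > (0::real)" by (simp add: eventually_at_right_less)
    ultimately show "\<forall>\<^sub>F s in at_right 0. integral {a - 0 * R..a + R} (\<lambda>x. P (w x s)) \<le> 0 + e"
    proof eventually_elim
      case (elim s)
      have "integral {a..a + R} (\<lambda>x. P (w x s)) \<le> integral {a..a + R} (\<lambda>x. B * (max 0 (- w x s))\<^sup>2)"
      proof (rule integral_le)
        show "(\<lambda>x. P (w x s)) integrable_on {a..a + R}"
          by (intro integrable_continuous_interval cPw elim)
        show "(\<lambda>x. B * (max 0 (- w x s))\<^sup>2) integrable_on {a..a + R}"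
          using elim by (intro integrable_continuous_interval continuous_intros strip_continuous_compose[OF D(4)]) auto
        show "P (w x s) \<le> B * (max 0 (- w x s))\<^sup>2" for x
        proof -
          have "max 0 (- w x s) \<le> B" using B[OF elim(2), of x] B0 by auto
          then have "max 0 (- w x s) * (max 0 (- w x s))\<^sup>2 \<le> B * (max 0 (- w x s))\<^sup>2" by (intro mult_right_mono) auto
          then show ?thesis by (simp add: P_def eval_nat_numeral)
        qed
      qed
      also have "\<dots> = B * integral {a..a + R} (\<lambda>x. (max 0 (- w x s))\<^sup>2)" by simp
      finally show ?case using elim by simp
    qed
  qed (use assms in auto)
  moreover have "integral {a..x + 1} (\<lambda>x. P (w x t)) \<ge> 0"
    by (intro integral_nonneg integrable_continuous_interval cPw \<open>t > 0\<close>) (auto simp: P_def)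
  ultimately have "integral {a..x + 1} (\<lambda>x. P (w x t)) = 0" by linarith
  then have "P (w x t) = 0"
    using integral_eq_0_iff[of a "x + 1" "\<lambda>x. P (w x t)"] cPw[OF \<open>t > 0\<close>] \<open>a \<le> x\<close> by (auto simp: P_def)
  then show ?thesis by (auto simp: P_def max_def split: if_splits)
qed

section \<open>Weak derivatives as increments\<close>

text \<open>
  Multiples of \<open>exp (- 1 / x)\<close> by polynomials in \<open>1 / x\<close>, extended by zero: a class of functions closed
  under differentiation, which provides smooth functions that vanish on a half-line.
\<close>

definition flat :: "real poly \<Rightarrow> real \<Rightarrow> real" where
  "flat p x = (if x \<le> 0 then 0 else poly p (1 / x) * exp (- (1 / x)))"

lemma flat_tendsto_0: "(flat p \<longlongrightarrow> 0) (at 0)"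
proof -
  have poly_exp: "((\<lambda>y. y ^ k * poly p y / exp y) \<longlongrightarrow> 0) at_top" for k
  proof (induction p arbitrary: k)
    case 0
    then show ?case by simp
  next
    case (pCons c p)
    have "((\<lambda>y. c * (y ^ k / exp y) + y ^ Suc k * poly p y / exp y) \<longlongrightarrow> c * 0 + 0) at_top"
      by (intro tendsto_intros tendsto_power_div_exp_0 pCons.IH)
    then show ?case by (simp add: algebra_simps add_divide_distrib)
  qed
  have "((\<lambda>x. poly p (inverse x) / exp (inverse x)) \<longlongrightarrow> 0) (at_right 0)"
    using filterlim_compose[OF poly_exp[of 0] filterlim_inverse_at_top_right] by simp
  then have "(flat p \<longlongrightarrow> 0) (at_right 0)"
    by (rule Lim_transform_eventually)
      (auto simp: flat_def eventually_at_filter inverse_eq_divide exp_minus)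
  moreover have "(flat p \<longlongrightarrow> 0) (at_left 0)"
    by (rule Lim_transform_eventually[OF tendsto_const]) (auto simp: flat_def eventually_at_filter)
  ultimately show ?thesis by (simp add: filterlim_split_at)
qed

lemma flat_derivative:
  "(flat p has_real_derivative flat (pCons 0 (pCons 0 (p - pderiv p))) x) (at x)"
proof -
  consider "x > 0" | "x < 0" | "x = 0" by linarith
  then show ?thesis
  proof cases
    case 1
    have "((\<lambda>x. poly p (1 / x) * exp (- (1 / x))) has_real_derivative
      flat (pCons 0 (pCons 0 (p - pderiv p))) x) (at x)"
      using 1 by (auto intro!: derivative_eq_intros DERIV_chain2[OF poly_DERIV]
          simp: flat_def field_simps power2_eq_square)
    moreover have "\<forall>\<^sub>F y in nhds x. y > 0" using 1 eventually_nhds_in_open[of "{0<..}" x] by simp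
    ultimately show ?thesis
      by (subst DERIV_cong_ev[OF refl _ refl]) (auto elim!: eventually_mono simp: flat_def)
  next
    case 2
    have "((\<lambda>x. 0) has_real_derivative flat (pCons 0 (pCons 0 (p - pderiv p))) x) (at x)"
      using 2 by (simp add: flat_def)
    moreover have "\<forall>\<^sub>F y in nhds x. y < 0" using 2 eventually_nhds_in_open[of "{..<0}" x] by simp
    ultimately show ?thesis
      by (subst DERIV_cong_ev[OF refl _ refl]) (auto elim!: eventually_mono simp: flat_def)
  next
    case 3
    have "(\<lambda>h. (flat p (0 + h) - flat p 0) / h) = flat (pCons 0 p)"
      by (auto simp: flat_def)
    then show ?thesis using flat_tendsto_0[of "pCons 0 p"] 3 by (simp add: DERIV_def flat_def)
  qed
qed

text \<open>
  A class of smooth compactly supported functions that is visibly closed under differentiation.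
\<close>

inductive flat_product :: "(real \<Rightarrow> real) \<Rightarrow> bool" where
  prod: "flat_product (\<lambda>x. c * (flat p (x - a) * flat q (b - x)))"
| add: "flat_product f \<Longrightarrow> flat_product g \<Longrightarrow> flat_product (\<lambda>x. f x + g x)"

lemma flat_product_derivative:
  assumes "flat_product f"
  shows "\<exists>f'. flat_product f' \<and> (\<forall>x. (f has_real_derivative f' x) (at x))"
  using assms
proof induction
  case (prod c p a q b)
  define dp where "dp = pCons 0 (pCons 0 (p - pderiv p))"
  define dq where "dq = pCons 0 (pCons 0 (q - pderiv q))"
  have "((\<lambda>x. c * (flat p (x - a) * flat q (b - x))) has_real_derivative
     c * (flat dp (x - a) * flat q (b - x)) + (- c) * (flat p (x - a) * flat dq (b - x))) (at x)" for x
  proof -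
    have "((\<lambda>x. x - a) has_real_derivative 1) (at x)" by (auto intro!: derivative_eq_intros)
    from DERIV_chain2[OF flat_derivative this]
    have 1: "((\<lambda>x. flat p (x - a)) has_real_derivative flat dp (x - a)) (at x)"
      by (simp add: dp_def)
    have "((\<lambda>x. b - x) has_real_derivative - 1) (at x)" by (auto intro!: derivative_eq_intros)
    from DERIV_chain2[OF flat_derivative this]
    have 2: "((\<lambda>x. flat q (b - x)) has_real_derivative - flat dq (b - x)) (at x)"
      by (simp add: dq_def)
    from DERIV_cmult[OF DERIV_mult[OF 1 2], of c] show ?thesis
      by (simp add: algebra_simps)
  qed
  moreover have "flat_product (\<lambda>x. c * (flat dp (x - a) * flat q (b - x)) + (- c) * (flat p (x - a) * flat dq (b - x)))"
    by (intro flat_product.intros)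
  ultimately show ?case by blast
next
  case (add f g)
  then show ?case by (blast intro: flat_product.add DERIV_add)
qed

lemma flat_product_deriv_funpow:
  assumes "flat_product f"
  shows "flat_product ((deriv ^^ n) f)"
proof (induction n)
  case (Suc n)
  then obtain f' where f': "flat_product f'" "\<And>x. ((deriv ^^ n) f has_real_derivative f' x) (at x)"
    using flat_product_derivative by blast
  then have "deriv ((deriv ^^ n) f) = f'" by (auto intro: DERIV_imp_deriv)
  then show ?case using f' by simp
qed (use assms in simp)

lemma flat_product_continuous: "flat_product f \<Longrightarrow> continuous_on S f"
  using flat_product_derivative by (blast intro: continuous_at_imp_continuous_on DERIV_isCont)

text \<open>
  The integral over an empty interval is zero, so the formula also holds to the left of \<open>m\<close>.
\<close>

lemma primitive_of_right_supported_derivative: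
  fixes g :: "real \<Rightarrow> real"
  assumes "continuous_on UNIV g" "\<And>x. x \<le> m \<Longrightarrow> g x = 0"
  shows "((\<lambda>x. integral {m..x} g) has_real_derivative g x) (at x)"
proof -
  define m' where "m' = min m x - 1"
  have eq: "integral {m..y} g = integral {m'..y} g" if "y > m'" for y
  proof (cases "y \<ge> m")
    case True
    have "integral {m'..m} g + integral {m..y} g = integral {m'..y} g"
      by (rule Henstock_Kurzweil_Integration.integral_combine)
        (use True in \<open>auto simp: m'_def intro!: integrable_continuous_interval continuous_on_subset[OF assms(1)]\<close>)
    moreover have "integral {m'..m} g = integral {m'..m} (\<lambda>x. 0)"
      by (rule Henstock_Kurzweil_Integration.integral_cong) (use assms in auto)
    ultimately show ?thesis by simp
  next
    case False
    then have "integral {m'..y} g = integral {m'..y} (\<lambda>x. 0)"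
      by (intro Henstock_Kurzweil_Integration.integral_cong) (use assms in auto)
    then show ?thesis using False by simp
  qed
  have "((\<lambda>x. integral {m'..x} g) has_real_derivative g x) (at x within {m'..x + 1})"
    by (rule integral_has_real_derivative)
      (auto simp: m'_def intro: continuous_on_subset[OF assms(1)])
  moreover have "at x within {m'..x + 1} = at x"
    by (rule at_within_interior) (auto simp: m'_def interior_atLeastAtMost_real)
  moreover have "\<forall>\<^sub>F y in nhds x. y > m'" 
    using eventually_nhds_in_open[of "{m'<..}" x] by (auto simp: m'_def)
  ultimately show ?thesis
    by (subst DERIV_cong_ev[OF refl _ refl]) (auto elim!: eventually_mono simp: eq)
qed

definition mollifier :: "real \<Rightarrow> real \<Rightarrow> real \<Rightarrow> real" where
  "mollifier a \<eta> x = (1 / integral {a..a + \<eta>} (\<lambda>x. flat 1 (x - a) * flat 1 (a + \<eta> - x)))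
     * (flat 1 (x - a) * flat 1 (a + \<eta> - x))"

lemma mollifier_flat_product: "flat_product (mollifier a \<eta>)"
  unfolding mollifier_def[abs_def] by (rule flat_product.prod)

lemma flat1_nonneg: "flat 1 x \<ge> 0" by (simp add: flat_def)

lemma mollifier:
  assumes "\<eta> > 0"
  shows "mollifier a \<eta> x \<ge> 0" "x \<notin> {a<..<a + \<eta>} \<Longrightarrow> mollifier a \<eta> x = 0"
    "integral {a..a + \<eta>} (mollifier a \<eta>) = 1" "x \<notin> {a..a + \<eta>} \<Longrightarrow> mollifier a \<eta> x = 0"
proof -
  let ?g = "\<lambda>x. flat 1 (x - a) * flat 1 (a + \<eta> - x)"
  have c: "continuous_on {a..a + \<eta>} ?g"
    using flat_product_continuous[OF flat_product.prod[of 1 1 a 1 "a + \<eta>"]] by simp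
  have nn: "integral {a..a + \<eta>} ?g \<ge> 0"
    by (intro integral_nonneg integrable_continuous_interval c) (simp add: flat1_nonneg)
  have "integral {a..a + \<eta>} ?g \<noteq> 0"
  proof
    assume "integral {a..a + \<eta>} ?g = 0"
    then have "\<forall>x\<in>{a..a + \<eta>}. ?g x = 0"
      using integral_eq_0_iff[OF c] assms by (auto simp: flat1_nonneg)
    moreover have "a + \<eta> / 2 \<in> {a..a + \<eta>}" using assms by simp
    ultimately have "?g (a + \<eta> / 2) = 0" by blast
    then show False using assms by (simp add: flat_def)
  qed
  then show "integral {a..a + \<eta>} (mollifier a \<eta>) = 1" unfolding mollifier_def[abs_def] by simp
  show "mollifier a \<eta> x \<ge> 0" using nn by (simp add: mollifier_def flat1_nonneg)
  show "x \<notin> {a<..<a + \<eta>} \<Longrightarrow> mollifier a \<eta> x = 0" by (auto simp: mollifier_def flat_def)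
  show "x \<notin> {a..a + \<eta>} \<Longrightarrow> mollifier a \<eta> x = 0" by (auto simp: mollifier_def flat_def)
qed

lemma mollifier_lebesgue:
  assumes "\<eta> > 0"
  shows "integrable lebesgue (mollifier a \<eta>)" "(LINT x|lebesgue. mollifier a \<eta> x) = 1"
proof -
  have "set_integrable lebesgue {a..a + \<eta>} (mollifier a \<eta>)"
    by (intro absolutely_integrable_continuous_real flat_product_continuous mollifier_flat_product)
  moreover have "(\<lambda>x. indicator {a..a + \<eta>} x *\<^sub>R mollifier a \<eta> x) = mollifier a \<eta>"
  proof
    show "indicator {a..a + \<eta>} x *\<^sub>R mollifier a \<eta> x = mollifier a \<eta> x" for x
      using mollifier(4)[OF assms, of x a] by (cases "x \<in> {a..a + \<eta>}") (simp_all add: indicator_def)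
  qed
  ultimately show i: "integrable lebesgue (mollifier a \<eta>)" by (simp add: set_integrable_def)
  have "(LINT x|lebesgue. mollifier a \<eta> x) = integral UNIV (mollifier a \<eta>)"
    using integral_lebesgue[OF i] by simp
  also have "\<dots> = integral UNIV (\<lambda>x. if x \<in> {a..a + \<eta>} then mollifier a \<eta> x else 0)"
  proof (rule arg_cong[where f = "integral UNIV"], rule ext)
    show "mollifier a \<eta> x = (if x \<in> {a..a + \<eta>} then mollifier a \<eta> x else 0)" for x
      using mollifier(4)[OF assms, of x a] by presburger
  qed
  also have "\<dots> = integral {a..a + \<eta>} (mollifier a \<eta>)" by (rule integral_restrict_UNIV)
  finally show "(LINT x|lebesgue. mollifier a \<eta> x) = 1" using mollifier(3)[OF assms] by simp
qed

lemma locally_integrable_times_continuous: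
  fixes v k :: "real \<Rightarrow> real"
  assumes "locally_integrable v" "continuous_on UNIV k" "\<And>x. x \<notin> {a..b} \<Longrightarrow> k x = 0"
  shows "integrable lebesgue (\<lambda>x. v x * k x)"
proof -
  have "\<exists>C. \<forall>x\<in>{a..b}. \<bar>k x\<bar> \<le> C"
    using compact_imp_bounded[OF compact_continuous_image[OF continuous_on_subset[OF assms(2) subset_UNIV] compact_Icc[of a b]]]
    unfolding bounded_iff by auto
  then obtain C where C: "\<And>x. x \<in> {a..b} \<Longrightarrow> \<bar>k x\<bar> \<le> C" by blast
  have i: "integrable lebesgue (\<lambda>x. indicator {a..b} x *\<^sub>R v x)"
    using assms(1) by (simp add: locally_integrable_def set_integrable_def)
  have k: "k \<in> borel_measurable lebesgue"
    using borel_measurable_continuous_onI[OF assms(2)] by (intro measurable_completion) simp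
  have eq: "(\<lambda>x. v x * k x) = (\<lambda>x. (indicator {a..b} x *\<^sub>R v x) * k x)"
    using assms(3) by (auto simp: indicator_def fun_eq_iff)
  have "integrable lebesgue (\<lambda>x. (indicator {a..b} x *\<^sub>R v x) * k x)"
  proof (rule Bochner_Integration.integrable_bound)
    show "integrable lebesgue (\<lambda>x. C * (indicator {a..b} x *\<^sub>R v x))" using i by simp
    show "(\<lambda>x. (indicator {a..b} x *\<^sub>R v x) * k x) \<in> borel_measurable lebesgue"
      using borel_measurable_integrable[OF i] k by measurable
    have "\<bar>v x\<bar> * \<bar>k x\<bar> \<le> \<bar>C\<bar> * \<bar>v x\<bar>" if "x \<in> {a..b}" for x
      using mult_left_mono[of "\<bar>k x\<bar>" "\<bar>C\<bar>" "\<bar>v x\<bar>"] C[OF that] by (simp add: mult.commute)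
    then show "AE x in lebesgue. norm ((indicator {a..b} x *\<^sub>R v x) * k x) \<le> norm (C * (indicator {a..b} x *\<^sub>R v x))"
      by (auto simp: indicator_def abs_mult)
  qed
  then show ?thesis by (simp add: eq)
qed

text \<open>
  The mollifier \<open>mollifier a \<eta>\<close> is a probability density on \<open>{a..a + \<eta>}\<close>. The function is only known
  almost everywhere, so the limit is taken from a representative that is continuous at \<open>a\<close>.
\<close>

lemma mollifier_average_tendsto:
  fixes v w :: "real \<Rightarrow> real"
  assumes v: "locally_integrable v" and vw: "AE x in lebesgue. v x = w x" and w: "isCont w a"
    and \<eta>: "\<And>n. \<eta> n > 0" "\<eta> \<longlonglongrightarrow> 0"
  shows "(\<lambda>n. LINT x|lebesgue. v x * mollifier a (\<eta> n) x) \<longlonglongrightarrow> w a"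
proof (rule LIMSEQ_I)
  fix e :: real assume e: "e > 0"
  obtain d where d: "d > 0" "\<And>x. \<bar>x - a\<bar> < d \<Longrightarrow> \<bar>w x - w a\<bar> < e / 2"
    using w[unfolded continuous_at_eps_delta, rule_format, of "e / 2"] e by (auto simp: dist_real_def)
  obtain N where N: "\<And>n. n \<ge> N \<Longrightarrow> \<eta> n < d"
    using order_tendstoD(2)[OF \<eta>(2) d(1)] by (auto simp: eventually_sequentially)
  show "\<exists>no. \<forall>n\<ge>no. norm ((LINT x|lebesgue. v x * mollifier a (\<eta> n) x) - w a) < e"
  proof (intro exI[of _ N] allI impI)
    fix n assume n: "n \<ge> N"
    note k = mollifier[OF \<eta>(1)[of n], where a = a] and kl = mollifier_lebesgue[OF \<eta>(1)[of n], of a]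
    have i: "integrable lebesgue (\<lambda>x. v x * mollifier a (\<eta> n) x)"
      by (rule locally_integrable_times_continuous[OF v flat_product_continuous[OF mollifier_flat_product], of a "a + \<eta> n"])
        (rule k(4))
    have "(LINT x|lebesgue. v x * mollifier a (\<eta> n) x) - w a
        = (LINT x|lebesgue. v x * mollifier a (\<eta> n) x) - (LINT x|lebesgue. w a * mollifier a (\<eta> n) x)"
      using kl by simp
    also have "\<dots> = (LINT x|lebesgue. v x * mollifier a (\<eta> n) x - w a * mollifier a (\<eta> n) x)"
      using i kl by (intro Bochner_Integration.integral_diff[symmetric]) auto
    finally have "norm ((LINT x|lebesgue. v x * mollifier a (\<eta> n) x) - w a)
        \<le> (LINT x|lebesgue. norm (v x * mollifier a (\<eta> n) x - w a * mollifier a (\<eta> n) x))"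
      by simp
    also have "\<dots> \<le> (LINT x|lebesgue. e / 2 * mollifier a (\<eta> n) x)"
    proof (rule integral_mono_AE)
      show "integrable lebesgue (\<lambda>x. norm (v x * mollifier a (\<eta> n) x - w a * mollifier a (\<eta> n) x))"
        using i kl by (intro integrable_norm Bochner_Integration.integrable_diff) auto
      show "integrable lebesgue (\<lambda>x. e / 2 * mollifier a (\<eta> n) x)" using kl by simp
      show "AE x in lebesgue. norm (v x * mollifier a (\<eta> n) x - w a * mollifier a (\<eta> n) x) \<le> e / 2 * mollifier a (\<eta> n) x"
        using vw
      proof eventually_elim
        case (elim x)
        show ?case
        proof (cases "x \<in> {a<..<a + \<eta> n}")
          case True
          then have "\<bar>w x - w a\<bar> \<le> e / 2" using d(2)[of x] N[OF n] by fastforce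
          then have "\<bar>w x - w a\<bar> * mollifier a (\<eta> n) x \<le> e / 2 * mollifier a (\<eta> n) x"
            using k(1) by (intro mult_right_mono) auto
          then show ?thesis using k(1) elim by (simp add: left_diff_distrib[symmetric] abs_mult)
        qed (use k(2) in simp)
      qed
    qed
    also have "\<dots> = e / 2" using kl by simp
    finally show "norm ((LINT x|lebesgue. v x * mollifier a (\<eta> n) x) - w a) < e" using e by linarith
  qed
qed

text \<open>
  Test functions that approximate the indicator of \<open>{a<..b}\<close> and have mollifiers as derivatives at the
  two ends.
\<close>

lemma smoothed_indicator:
  assumes "a < b" "\<eta> > 0"
  defines "\<psi> \<equiv> \<lambda>x. integral {a..x} (mollifier a \<eta>) - integral {b..x} (mollifier b \<eta>)"
  shows "test_function \<psi>" "deriv \<psi> = (\<lambda>x. mollifier a \<eta> x - mollifier b \<eta> x)"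
    "\<bar>\<psi> x\<bar> \<le> 1" "x \<notin> {a<..<b + \<eta>} \<Longrightarrow> \<psi> x = 0" "a + \<eta> \<le> x \<Longrightarrow> x \<le> b \<Longrightarrow> \<psi> x = 1"
    "continuous_on UNIV \<psi>"
proof -
  note k = mollifier[OF assms(2)]
  have kc: "continuous_on S (mollifier c \<eta>)" for S c
    by (intro flat_product_continuous mollifier_flat_product)
  have S: "0 \<le> integral {c..x} (mollifier c \<eta>)" "integral {c..x} (mollifier c \<eta>) \<le> 1"
    "x \<le> c \<Longrightarrow> integral {c..x} (mollifier c \<eta>) = 0" "x \<ge> c + \<eta> \<Longrightarrow> integral {c..x} (mollifier c \<eta>) = 1" for c x
  proof -
    show "0 \<le> integral {c..x} (mollifier c \<eta>)"
      by (intro integral_nonneg integrable_continuous_interval kc k)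
    show "x \<le> c \<Longrightarrow> integral {c..x} (mollifier c \<eta>) = 0"
      by (cases "x = c") auto
    show 1: "x \<ge> c + \<eta> \<Longrightarrow> integral {c..x} (mollifier c \<eta>) = 1" for x
    proof -
      assume x: "x \<ge> c + \<eta>"
      have "integral {c..c + \<eta>} (mollifier c \<eta>) + integral {c + \<eta>..x} (mollifier c \<eta>) = integral {c..x} (mollifier c \<eta>)"
        by (rule Henstock_Kurzweil_Integration.integral_combine)
          (use x assms(2) in \<open>auto intro!: integrable_continuous_interval kc\<close>)
      moreover have "integral {c + \<eta>..x} (mollifier c \<eta>) = integral {c + \<eta>..x} (\<lambda>x. 0)"
        by (rule Henstock_Kurzweil_Integration.integral_cong) (use k(2) in auto)
      ultimately show ?thesis using k(3) by simp
    qed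
    have "integral {c..x} (mollifier c \<eta>) \<le> integral {c..max x (c + \<eta>)} (mollifier c \<eta>)"
      by (intro integral_subset_le integrable_continuous_interval kc) (auto simp: k)
    then show "integral {c..x} (mollifier c \<eta>) \<le> 1" using 1[of "max x (c + \<eta>)"] by simp
  qed
  have d: "(\<psi> has_real_derivative (mollifier a \<eta> x - mollifier b \<eta> x)) (at x)" for x
    unfolding \<psi>_def
    by (intro DERIV_diff primitive_of_right_supported_derivative kc k) auto
  then show dp: "deriv \<psi> = (\<lambda>x. mollifier a \<eta> x - mollifier b \<eta> x)"
    by (auto intro: DERIV_imp_deriv)
  show "continuous_on UNIV \<psi>" using d by (auto intro!: continuous_at_imp_continuous_on DERIV_isCont)
  show "\<bar>\<psi> x\<bar> \<le> 1" for x using S(1,2)[of a x] S(1,2)[of b x] by (simp add: \<psi>_def)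
  show z: "x \<notin> {a<..<b + \<eta>} \<Longrightarrow> \<psi> x = 0" for x
    using S(3,4)[of x a] S(3,4)[of x b] S(3,4)[of a x] S(3,4)[of b x] assms(1) by (auto simp: \<psi>_def not_less)
  show "a + \<eta> \<le> x \<Longrightarrow> x \<le> b \<Longrightarrow> \<psi> x = 1" for x
    using S(3)[of x b] S(4)[of a x] by (auto simp: \<psi>_def)
  have "flat_product (\<lambda>x. mollifier a \<eta> x + (- 1 / integral {b..b + \<eta>} (\<lambda>x. flat 1 (x - b) * flat 1 (b + \<eta> - x)))
     * (flat 1 (x - b) * flat 1 (b + \<eta> - x)))"
    by (intro flat_product.add mollifier_flat_product flat_product.prod)
  moreover have "(\<lambda>x. mollifier a \<eta> x + (- 1 / integral {b..b + \<eta>} (\<lambda>x. flat 1 (x - b) * flat 1 (b + \<eta> - x)))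
     * (flat 1 (x - b) * flat 1 (b + \<eta> - x))) = (\<lambda>x. mollifier a \<eta> x - mollifier b \<eta> x)"
    by (simp add: mollifier_def[of b])
  ultimately have fp: "flat_product (deriv \<psi>)" by (simp add: dp)
  have "(deriv ^^ n) \<psi> differentiable at x" for n x
  proof (cases n)
    case 0
    then show ?thesis using d real_differentiable_def by auto
  next
    case (Suc m)
    have "(deriv ^^ n) \<psi> = (deriv ^^ m) (deriv \<psi>)" by (simp add: Suc funpow_swap1)
    then show ?thesis
      using flat_product_derivative[OF flat_product_deriv_funpow[OF fp, of m]] real_differentiable_def by auto
  qed
  moreover have "compact (closure {x. \<psi> x \<noteq> 0})"
  proof -
    have "bounded {x. \<psi> x \<noteq> 0}"
    proof (rule bounded_subset[OF bounded_closed_interval[of a "b + \<eta>"]], rule subsetI)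
      fix x assume "x \<in> {x. \<psi> x \<noteq> 0}"
      then have "x \<in> {a<..<b + \<eta>}" using z[of x] by blast
      then show "x \<in> {a..b + \<eta>}" by simp
    qed
    then show ?thesis by simp
  qed
  ultimately show "test_function \<psi>" by (simp add: test_function_def)
qed

text \<open>
  Test the weak derivative against smoothed indicators of \<open>{a<..b}\<close>: one side tends to \<open>w a - w b\<close>, the
  other to the integral of \<open>- g\<close>.
\<close>

lemma weak_derivative_increment:
  assumes vg: "has_weak_deriv v g" and vw: "AE x in lebesgue. v x = w x"
    and w: "isCont w a" "isCont w b" and ab: "a < b"
  shows "(LINT x|lebesgue. indicator {a..b} x * g x) = w b - w a"
proof -
  have v: "locally_integrable v" and g: "locally_integrable g"
    and W: "\<And>\<psi>. test_function \<psi> \<Longrightarrow> (LINT x|lebesgue. v x * deriv \<psi> x) = - (LINT x|lebesgue. g x * \<psi> x)"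
    using vg by (auto simp: has_weak_deriv_def)
  define \<eta> where "\<eta> n = 1 / real (Suc n)" for n
  have \<eta>: "\<eta> n > 0" "\<eta> n \<le> 1" "\<eta> \<longlonglongrightarrow> 0" for n
    using LIMSEQ_inverse_real_of_nat by (auto simp: \<eta>_def[abs_def] inverse_eq_divide divide_simps)
  define \<psi> where "\<psi> n x = integral {a..x} (mollifier a (\<eta> n)) - integral {b..x} (mollifier b (\<eta> n))" for n x
  note P = smoothed_indicator[OF ab \<eta>(1), folded \<psi>_def]
  have ki: "integrable lebesgue (\<lambda>x. v x * mollifier c (\<eta> n) x)" for c n
    by (rule locally_integrable_times_continuous[OF v flat_product_continuous[OF mollifier_flat_product], of c "c + \<eta> n"])
      (use mollifier(2)[OF \<eta>(1)] in auto)
  have "(\<lambda>n. LINT x|lebesgue. v x * deriv (\<psi> n) x) \<longlonglongrightarrow> w a - w b"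
    unfolding P(2) right_diff_distrib
    by (subst Bochner_Integration.integral_diff[OF ki ki])
      (intro tendsto_diff mollifier_average_tendsto[OF v vw] w \<eta>)
  then have "(\<lambda>n. - (LINT x|lebesgue. v x * deriv (\<psi> n) x)) \<longlonglongrightarrow> - (w a - w b)"
    by (rule tendsto_minus)
  then have L1: "(\<lambda>n. LINT x|lebesgue. g x * \<psi> n x) \<longlonglongrightarrow> w b - w a"
    using W[OF P(1)] by simp
  have L2: "(\<lambda>n. LINT x|lebesgue. g x * \<psi> n x) \<longlonglongrightarrow> (LINT x|lebesgue. indicator {a<..b} x * g x)"
  proof (rule integral_dominated_convergence)
    have gi: "integrable lebesgue (\<lambda>x. indicator {a..b + 1} x *\<^sub>R g x)" 
      using g by (simp add: locally_integrable_def set_integrable_def)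
    then show "integrable lebesgue (\<lambda>x. norm (indicator {a..b + 1} x *\<^sub>R g x))" by (rule integrable_norm)
    show "(\<lambda>x. g x * \<psi> n x) \<in> borel_measurable lebesgue" for n
      by (rule borel_measurable_integrable[OF locally_integrable_times_continuous[OF g P(6), of a "b + \<eta> n"]])
        (use P(4) in auto)
    have "(\<lambda>x. indicator {a<..b} x * (indicator {a..b + 1} x *\<^sub>R g x)) \<in> borel_measurable lebesgue"
      by (intro borel_measurable_times borel_measurable_indicator borel_measurable_integrable[OF gi]) simp
    moreover have "(\<lambda>x. indicator {a<..b} x * (indicator {a..b + 1} x *\<^sub>R g x)) = (\<lambda>x. indicator {a<..b} x * g x)"
      by (auto simp: indicator_def)
    ultimately show "(\<lambda>x. indicator {a<..b} x * g x) \<in> borel_measurable lebesgue" by simp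
    show "AE x in lebesgue. (\<lambda>n. g x * \<psi> n x) \<longlonglongrightarrow> indicator {a<..b} x * g x"
    proof (rule AE_I2)
      fix x
      have "\<forall>\<^sub>F n in sequentially. \<psi> n x = indicator {a<..b} x"
      proof -
        consider "x \<le> a" | "a < x" "x \<le> b" | "b < x" by linarith
        then show ?thesis
        proof cases
          case 1 then show ?thesis using P(4) by auto
        next
          case 2
          then have "\<forall>\<^sub>F n in sequentially. \<eta> n < x - a" using order_tendstoD(2)[OF \<eta>(3), of "x - a"] by simp
          then show ?thesis by eventually_elim (use 2 P(5) in auto)
        next
          case 3
          then have "\<forall>\<^sub>F n in sequentially. \<eta> n < x - b" using order_tendstoD(2)[OF \<eta>(3), of "x - b"] by simp
          then show ?thesis by eventually_elim (use 3 P(4) in auto)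
        qed
      qed
      then show "(\<lambda>n. g x * \<psi> n x) \<longlonglongrightarrow> indicator {a<..b} x * g x"
        by (intro tendsto_eventually) (auto elim!: eventually_mono)
    qed
    show "AE x in lebesgue. norm (g x * \<psi> n x) \<le> norm (indicator {a..b + 1} x *\<^sub>R g x)" for n
    proof (rule AE_I2)
      fix x
      show "norm (g x * \<psi> n x) \<le> norm (indicator {a..b + 1} x *\<^sub>R g x)"
      proof (cases "x \<in> {a..b + 1}")
        case True
        then show ?thesis using mult_left_mono[OF P(3)[of n x], of "\<bar>g x\<bar>"] by (simp add: abs_mult)
      next
        case False
        then show ?thesis using P(4)[of x n] \<eta>(2)[of n] by auto
      qed
    qed
  qed
  have "(LINT x|lebesgue. indicator {a<..b} x * g x) = (LINT x|lebesgue. indicator {a..b} x * g x)"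
  proof (rule integral_cong_AE)
    have gi: "integrable lebesgue (\<lambda>x. indicator {a..b} x *\<^sub>R g x)" 
      using g by (simp add: locally_integrable_def set_integrable_def)
    then show m: "(\<lambda>x. indicator {a..b} x * g x) \<in> borel_measurable lebesgue" by auto
    have "(\<lambda>x. indicator {a<..b} x * (indicator {a..b} x * g x)) \<in> borel_measurable lebesgue"
      by (intro borel_measurable_times borel_measurable_indicator m) simp
    moreover have "(\<lambda>x. indicator {a<..b} x * (indicator {a..b} x * g x)) = (\<lambda>x. indicator {a<..b} x * g x)"
      by (auto simp: indicator_def)
    ultimately show "(\<lambda>x. indicator {a<..b} x * g x) \<in> borel_measurable lebesgue" by simp
    have "AE x in lebesgue. x \<noteq> a"
      by (rule AE_completion) (rule AE_lborel_singleton)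
    then show "AE x in lebesgue. indicator {a<..b} x * g x = indicator {a..b} x * g x"
      by eventually_elim (auto simp: indicator_def)
  qed
  then show ?thesis using LIMSEQ_unique[OF L1 L2] by simp
qed

section \<open>Difference quotients in L2\<close>

lemma nn_integral_continuous_interval:
  fixes h :: "real \<Rightarrow> real"
  assumes "continuous_on {a..b} h" "\<And>x. x \<in> {a..b} \<Longrightarrow> h x \<ge> 0"
  shows "(\<integral>\<^sup>+x. ennreal (h x) * indicator {a..b} x \<partial>lebesgue) = ennreal (integral {a..b} h)"
proof -
  have "(h has_integral integral {a..b} h) {a..b}"
    by (intro integrable_integral integrable_continuous_interval assms)
  then show ?thesis
    unfolding nn_integral_completion by (intro nn_integral_has_integral_lebesgue' assms)
qed

lemma borel_measurable_lebesgue_affine: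
  fixes p :: "real \<Rightarrow> real"
  assumes "p \<in> borel_measurable lebesgue" "\<sigma> \<noteq> 0"
  shows "(\<lambda>x. p (\<sigma> * x + b)) \<in> borel_measurable lebesgue"
proof -
  have "(\<lambda>x::real. b + \<sigma> * x) \<in> lebesgue \<rightarrow>\<^sub>M lebesgue"
    using lebesgue_affine_measurable[of "\<lambda>_. \<sigma>" b] assms by simp
  from measurable_compose[OF this assms(1)] show ?thesis by (simp add: add.commute)
qed

lemma nn_integral_isometry:
  fixes p :: "real \<Rightarrow> real"
  assumes "p \<in> borel_measurable lebesgue" "\<bar>\<sigma>\<bar> = 1"
  shows "(\<integral>\<^sup>+x. ennreal ((p (\<sigma> * x + b))\<^sup>2) \<partial>lebesgue) = (\<integral>\<^sup>+x. ennreal ((p x)\<^sup>2) \<partial>lebesgue)"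
proof -
  have "\<sigma> \<noteq> 0" using assms by auto
  from nn_integral_real_affine_lebesgue[OF _ this, of "\<lambda>x. ennreal ((p x)\<^sup>2)" b] assms
  show ?thesis by (simp add: add.commute)
qed

lemma nn_integral_sq_add_le:
  fixes p q :: "real \<Rightarrow> real"
  assumes [measurable]: "p \<in> borel_measurable M" "q \<in> borel_measurable M" and \<theta>: "\<theta> > 0"
  shows "(\<integral>\<^sup>+x. ennreal ((p x + q x)\<^sup>2) \<partial>M) \<le>
     ennreal (1 + \<theta>) * (\<integral>\<^sup>+x. ennreal ((p x)\<^sup>2) \<partial>M) + ennreal (1 + 1 / \<theta>) * (\<integral>\<^sup>+x. ennreal ((q x)\<^sup>2) \<partial>M)"
proof -
  have le: "(a + b)\<^sup>2 \<le> (1 + \<theta>) * a\<^sup>2 + (1 + 1 / \<theta>) * b\<^sup>2" for a b :: real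
  proof -
    have "0 \<le> (\<theta> * a - b)\<^sup>2 / \<theta>" using \<theta> by simp
    also have "(\<theta> * a - b)\<^sup>2 / \<theta> = (1 + \<theta>) * a\<^sup>2 + (1 + 1 / \<theta>) * b\<^sup>2 - (a + b)\<^sup>2"
      using \<theta> by (simp add: power2_eq_square field_simps)
    finally show ?thesis by simp
  qed
  have "(\<integral>\<^sup>+x. ennreal ((p x + q x)\<^sup>2) \<partial>M) \<le> (\<integral>\<^sup>+x. ennreal (1 + \<theta>) * ennreal ((p x)\<^sup>2) + ennreal (1 + 1 / \<theta>) * ennreal ((q x)\<^sup>2) \<partial>M)"
  proof (rule nn_integral_mono)
    fix x
    have "ennreal (1 + \<theta>) * ennreal ((p x)\<^sup>2) + ennreal (1 + 1 / \<theta>) * ennreal ((q x)\<^sup>2)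
       = ennreal ((1 + \<theta>) * (p x)\<^sup>2 + (1 + 1 / \<theta>) * (q x)\<^sup>2)"
      using \<theta> by (simp add: ennreal_mult ennreal_plus)
    then show "ennreal ((p x + q x)\<^sup>2) \<le> ennreal (1 + \<theta>) * ennreal ((p x)\<^sup>2) + ennreal (1 + 1 / \<theta>) * ennreal ((q x)\<^sup>2)"
      using le[of "p x" "q x"] by (simp add: ennreal_leI)
  qed
  also have "\<dots> = ennreal (1 + \<theta>) * (\<integral>\<^sup>+x. ennreal ((p x)\<^sup>2) \<partial>M) + ennreal (1 + 1 / \<theta>) * (\<integral>\<^sup>+x. ennreal ((q x)\<^sup>2) \<partial>M)"
    by (subst nn_integral_add) (auto simp: nn_integral_cmult)
  finally show ?thesis .
qed

text \<open>
  The variance of \<open>g\<close> over the interval is nonnegative.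
\<close>

lemma interval_mean_square:
  fixes g :: "real \<Rightarrow> real"
  assumes "g \<in> borel_measurable lebesgue" "(\<integral>\<^sup>+x. ennreal ((g x)\<^sup>2) \<partial>lebesgue) < \<infinity>" "h > 0"
    and gi: "integrable lebesgue (\<lambda>y. indicator {x..x + h} y * g y)"
  shows "ennreal ((LINT y|lebesgue. indicator {x..x + h} y * g y)\<^sup>2)
     \<le> ennreal h * (\<integral>\<^sup>+y. ennreal ((g y)\<^sup>2) * indicator {x..x + h} y \<partial>lebesgue)"
proof -
  note [measurable] = assms(1)
  let ?I = "{x..x + h}"
  have g2: "integrable lebesgue (\<lambda>y. (g y)\<^sup>2)"
    using assms by (intro integrableI_nonneg) auto
  have g2i: "integrable lebesgue (\<lambda>y. indicator ?I y * (g y)\<^sup>2)"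
    using integrable_mult_indicator[OF _ g2, of ?I] by simp
  have one: "integrable lebesgue (indicator ?I :: real \<Rightarrow> real)" "(LINT y|lebesgue. indicator ?I y) = h"
    using assms(3) by auto
  define avg where "avg = (LINT y|lebesgue. indicator ?I y * g y) / h"
  have "0 \<le> (LINT y|lebesgue. indicator ?I y * (g y)\<^sup>2 - 2 * avg * (indicator ?I y * g y) + avg\<^sup>2 * indicator ?I y)"
  proof (rule Bochner_Integration.integral_nonneg)
    fix y
    have "indicator ?I y * (g y)\<^sup>2 - 2 * avg * (indicator ?I y * g y) + avg\<^sup>2 * indicator ?I y = indicator ?I y * (g y - avg)\<^sup>2"
      by (simp add: power2_eq_square algebra_simps)
    also have "\<dots> \<ge> 0" by simp
    finally show "0 \<le> indicator ?I y * (g y)\<^sup>2 - 2 * avg * (indicator ?I y * g y) + avg\<^sup>2 * indicator ?I y" .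
  qed
  also have "\<dots> = (LINT y|lebesgue. indicator ?I y * (g y)\<^sup>2) - 2 * avg * (LINT y|lebesgue. indicator ?I y * g y) + avg\<^sup>2 * h"
    using g2i gi one by simp
  finally have "(LINT y|lebesgue. indicator ?I y * g y)\<^sup>2 \<le> h * (LINT y|lebesgue. indicator ?I y * (g y)\<^sup>2)"
    using assms(3) by (simp add: avg_def power2_eq_square divide_simps mult.commute split: if_splits)
  then have "ennreal ((LINT y|lebesgue. indicator ?I y * g y)\<^sup>2) \<le> ennreal (h * (LINT y|lebesgue. indicator ?I y * (g y)\<^sup>2))"
    by (rule ennreal_leI)
  also have "\<dots> = ennreal h * ennreal (LINT y|lebesgue. indicator ?I y * (g y)\<^sup>2)"
    using assms(3) by (simp add: ennreal_mult')
  also have "ennreal (LINT y|lebesgue. indicator ?I y * (g y)\<^sup>2) = (\<integral>\<^sup>+y. ennreal (indicator ?I y * (g y)\<^sup>2) \<partial>lebesgue)"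
    using g2i by (intro nn_integral_eq_integral[symmetric]) auto
  also have "\<dots> = (\<integral>\<^sup>+y. ennreal ((g y)\<^sup>2) * indicator ?I y \<partial>lebesgue)"
    by (intro nn_integral_cong) (auto simp: indicator_def)
  finally show ?thesis .
qed

lemma window_measurable:
  fixes g :: "real \<Rightarrow> real"
  assumes [measurable]: "g \<in> borel_measurable lborel"
  shows "(\<lambda>(x, y). ennreal ((g y)\<^sup>2) * indicator {x..x + h} y) \<in> borel_measurable (lborel \<Otimes>\<^sub>M lborel)"
proof -
  have "(\<lambda>(x, y). ennreal ((g y)\<^sup>2) * indicator {x..x + h} y) = (\<lambda>z. ennreal ((g (snd z))\<^sup>2) * indicator {z. fst z \<le> snd z \<and> snd z \<le> fst z + h} z)"
    by (auto simp: fun_eq_iff indicator_def)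
  moreover have "\<dots> \<in> borel_measurable (lborel \<Otimes>\<^sub>M lborel)" by measurable
  ultimately show ?thesis by simp
qed

lemma nn_integral_sliding_window:
  fixes g :: "real \<Rightarrow> real"
  assumes "g \<in> borel_measurable lebesgue" "h > 0"
  shows "(\<integral>\<^sup>+x. (\<integral>\<^sup>+y. ennreal ((g y)\<^sup>2) * indicator {x..x + h} y \<partial>lebesgue) \<partial>lebesgue)
    = ennreal h * (\<integral>\<^sup>+y. ennreal ((g y)\<^sup>2) \<partial>lebesgue)"
proof -
  obtain g' where g'[measurable]: "g' \<in> borel_measurable lborel" and ae: "AE x in lborel. g x = g' x"
    using completion_ex_borel_measurable_real[OF assms(1)] by blast
  have 1: "(\<integral>\<^sup>+y. ennreal ((g y)\<^sup>2) * indicator A y \<partial>lborel) = (\<integral>\<^sup>+y. ennreal ((g' y)\<^sup>2) * indicator A y \<partial>lborel)" for A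
    by (rule nn_integral_cong_AE) (use ae in \<open>auto elim!: eventually_mono\<close>)
  have "(\<integral>\<^sup>+x. (\<integral>\<^sup>+y. ennreal ((g' y)\<^sup>2) * indicator {x..x + h} y \<partial>lborel) \<partial>lborel)
      = (\<integral>\<^sup>+y. (\<integral>\<^sup>+x. ennreal ((g' y)\<^sup>2) * indicator {x..x + h} y \<partial>lborel) \<partial>lborel)"
    using lborel_pair.Fubini'[OF window_measurable[OF g']] by simp
  also have "\<dots> = (\<integral>\<^sup>+y. (\<integral>\<^sup>+x. ennreal ((g' y)\<^sup>2) * indicator {y - h..y} x \<partial>lborel) \<partial>lborel)"
    by (intro nn_integral_cong) (auto simp: indicator_def)
  also have "\<dots> = (\<integral>\<^sup>+y. ennreal h * (ennreal ((g' y)\<^sup>2)) \<partial>lborel)"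
    using assms(2) by (intro nn_integral_cong) (simp add: nn_integral_cmult_indicator mult.commute)
  also have "\<dots> = ennreal h * (\<integral>\<^sup>+y. ennreal ((g' y)\<^sup>2) \<partial>lborel)"
    by (rule nn_integral_cmult) measurable
  finally show ?thesis
    using 1[of UNIV] by (simp add: nn_integral_completion 1)
qed

lemma AE_lebesgue_affine:
  fixes P :: "real \<Rightarrow> bool"
  assumes "AE x in lebesgue. P x" "\<sigma> \<noteq> 0"
  shows "AE x in lebesgue. P (\<sigma> * x + b)"
proof -
  obtain Z where Z: "Z \<in> null_sets lborel" "{x \<in> space lborel. \<not> P x} \<subseteq> Z"
    using assms(1) unfolding AE_completion_iff by (auto elim!: AE_E simp: null_sets_def)
  have "AE x in lborel. (x :: real) \<notin> Z" by (rule AE_not_in[OF Z(1)])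
  then have "AE x in lborel. b + \<sigma> * x \<notin> Z"
    using Z(1) assms(2) by (intro AE_borel_affine) (auto simp: null_sets_def)
  then show ?thesis
    using Z(2) by (intro AE_completion) (auto elim!: eventually_mono simp: add.commute)
qed

text \<open>
  The increment over \<open>{x..x + h}\<close> is the integral of \<open>g\<close>. By the Cauchy-Schwarz inequality its square is
  at most \<open>h\<close> times the integral of \<open>g\<^sup>2\<close> over a window of length \<open>h\<close>, and sliding the window over the
  line contributes another factor \<open>h\<close>.
\<close>

lemma difference_quotient_L2_bound:
  fixes v g w :: "real \<Rightarrow> real"
  assumes vg: "has_weak_deriv v g" and vw: "AE x in lebesgue. v x = w x"
    and N: "AE x in lebesgue. isCont w x"
    and g: "g \<in> borel_measurable lebesgue" "(\<integral>\<^sup>+x. ennreal ((g x)\<^sup>2) \<partial>lebesgue) < \<infinity>" and h: "h > 0"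
  shows "(\<integral>\<^sup>+x. ennreal ((w (x + h) - w x)\<^sup>2) \<partial>lebesgue) \<le> ennreal (h\<^sup>2) * (\<integral>\<^sup>+x. ennreal ((g x)\<^sup>2) \<partial>lebesgue)"
proof -
  have N': "AE x in lebesgue. isCont w (x + h)"
    using AE_lebesgue_affine[OF N, of 1 h] by simp
  have gi: "integrable lebesgue (\<lambda>y. indicator {x..x + h} y * g y)" for x
    using vg by (simp add: has_weak_deriv_def locally_integrable_def set_integrable_def)
  have "(\<integral>\<^sup>+x. ennreal ((w (x + h) - w x)\<^sup>2) \<partial>lebesgue)
     \<le> (\<integral>\<^sup>+x. ennreal h * (\<integral>\<^sup>+y. ennreal ((g y)\<^sup>2) * indicator {x..x + h} y \<partial>lebesgue) \<partial>lebesgue)"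
  proof (rule nn_integral_mono_AE)
    show "AE x in lebesgue. ennreal ((w (x + h) - w x)\<^sup>2) \<le> ennreal h * (\<integral>\<^sup>+y. ennreal ((g y)\<^sup>2) * indicator {x..x + h} y \<partial>lebesgue)"
      using N N'
    proof eventually_elim
      case (elim x)
      have "(LINT y|lebesgue. indicator {x..x + h} y * g y) = w (x + h) - w x"
        by (rule weak_derivative_increment[OF vg vw elim]) (use h in simp)
      then show ?case using interval_mean_square[OF g h gi, of x] by simp
    qed
  qed
  also have "\<dots> = ennreal h * (ennreal h * (\<integral>\<^sup>+y. ennreal ((g y)\<^sup>2) \<partial>lebesgue))"
  proof -
    obtain g' where g'[measurable]: "g' \<in> borel_measurable lborel" and ae: "AE x in lborel. g x = g' x"
      using completion_ex_borel_measurable_real[OF g(1)] by blast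
    have 1: "(\<integral>\<^sup>+y. ennreal ((g y)\<^sup>2) * indicator A y \<partial>lebesgue) = (\<integral>\<^sup>+y. ennreal ((g' y)\<^sup>2) * indicator A y \<partial>lborel)" for A
      unfolding nn_integral_completion
      by (rule nn_integral_cong_AE) (use ae in \<open>auto elim!: eventually_mono\<close>)
    have "(\<lambda>x. \<integral>\<^sup>+y. ennreal ((g' y)\<^sup>2) * indicator {x..x + h} y \<partial>lborel) \<in> borel_measurable lborel"
      using lborel.borel_measurable_nn_integral[OF window_measurable[OF g', of h]] by simp
    then have "(\<integral>\<^sup>+x. ennreal h * (\<integral>\<^sup>+y. ennreal ((g' y)\<^sup>2) * indicator {x..x + h} y \<partial>lborel) \<partial>lborel)
      = ennreal h * (\<integral>\<^sup>+x. (\<integral>\<^sup>+y. ennreal ((g' y)\<^sup>2) * indicator {x..x + h} y \<partial>lborel) \<partial>lborel)"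
      by (rule nn_integral_cmult)
    then have "(\<integral>\<^sup>+x. ennreal h * (\<integral>\<^sup>+y. ennreal ((g y)\<^sup>2) * indicator {x..x + h} y \<partial>lebesgue) \<partial>lebesgue)
      = ennreal h * (\<integral>\<^sup>+x. (\<integral>\<^sup>+y. ennreal ((g y)\<^sup>2) * indicator {x..x + h} y \<partial>lebesgue) \<partial>lebesgue)"
      unfolding 1 by (simp add: nn_integral_completion)
    then show ?thesis using nn_integral_sliding_window[OF g(1) h] by simp
  qed
  also have "\<dots> = ennreal (h\<^sup>2) * (\<integral>\<^sup>+x. ennreal ((g x)\<^sup>2) \<partial>lebesgue)"
    using h by (simp add: mult.assoc[symmetric] ennreal_mult'[symmetric] power2_eq_square)
  finally show ?thesis .
qed

lemma nn_integral_le_liminf: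
  fixes f :: "real \<Rightarrow> real" and fn :: "nat \<Rightarrow> real \<Rightarrow> ennreal"
  assumes "\<And>n. fn n \<in> borel_measurable M" "\<And>x. (\<lambda>n. fn n x) \<longlonglongrightarrow> ennreal (f x)"
    and "\<And>n. integral\<^sup>N M (fn n) \<le> C"
  shows "(\<integral>\<^sup>+x. ennreal (f x) \<partial>M) \<le> C"
proof -
  have "(\<integral>\<^sup>+x. ennreal (f x) \<partial>M) = (\<integral>\<^sup>+x. liminf (\<lambda>n. fn n x) \<partial>M)"
    using lim_imp_Liminf[OF sequentially_bot assms(2)] by simp
  also have "\<dots> \<le> liminf (\<lambda>n. integral\<^sup>N M (fn n))"
    by (rule nn_integral_liminf) (rule assms(1))
  also have "\<dots> \<le> limsup (\<lambda>n. C)"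
    by (rule order_trans[OF Liminf_le_Limsup Limsup_mono]) (auto simp: assms(3))
  also have "\<dots> = C" by (simp add: Limsup_const)
  finally show ?thesis .
qed

section \<open>Symmetry, monotonicity and the gradient bound\<close>

text \<open>
  Initial values are attained in \<open>L\<^sup>2\<close>. Nonnegative integrals are used because they need no
  integrability of the difference.
\<close>

definition attains :: "(real \<Rightarrow> real \<Rightarrow> real) \<Rightarrow> (real \<Rightarrow> real) \<Rightarrow> bool" where
  "attains u v \<longleftrightarrow> v \<in> borel_measurable lebesgue \<and>
     ((\<lambda>s. \<integral>\<^sup>+x. ennreal ((u x s - v x)\<^sup>2) \<partial>lebesgue) \<longlongrightarrow> 0) (at_right 0)"

lemma continuous_lebesgue_measurable:
  fixes k :: "real \<Rightarrow> real"
  assumes "continuous_on UNIV k"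
  shows "k \<in> borel_measurable lebesgue"
  using borel_measurable_continuous_onI[OF assms] by (intro measurable_completion) simp

text \<open>
  The nonlinearity is taken globally Lipschitz; as \<open>u\<close> is bounded and nonnegative, the given \<open>f\<close> can be
  truncated to satisfy this without changing the equation.
\<close>

locale reaction_solution =
  fixes F :: "real \<Rightarrow> real" and L M :: real and u ux uxx ut :: "real \<Rightarrow> real \<Rightarrow> real"
  assumes lipschitz: "\<bar>F a - F b\<bar> \<le> L * \<bar>a - b\<bar>"
    and cl: "classical u ux uxx ut"
    and pde: "0 < t \<Longrightarrow> ut x t = uxx x t + F (u x t)"
    and bounds: "0 < t \<Longrightarrow> 0 \<le> u x t" "0 < t \<Longrightarrow> u x t \<le> M"
begin

lemmas D = classicalD[OF cl]

lemma L_nonneg: "L \<ge> 0" using lipschitz[of 1 0] by simp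

lemma M_nonneg: "M \<ge> 0" using bounds[of 1] by (meson order_trans zero_less_one)

lemma F_continuous: "continuous_on S F"
proof (rule continuous_on_subset[OF _ subset_UNIV])
  show "continuous_on UNIV F"
  proof (rule lipschitz_on_continuous_on[of L])
    show "L-lipschitz_on UNIV F"
      using L_nonneg lipschitz by (auto simp: lipschitz_on_def dist_real_def)
  qed
qed

lemma u_x_continuous: "0 < t \<Longrightarrow> continuous_on S (\<lambda>x. u x t)"
  by (intro strip_continuous_compose[OF D(4)] continuous_intros) auto

lemma isometry_difference:
  fixes b c :: real
  assumes "\<bar>p\<bar> = 1" "\<bar>q\<bar> = 1"
  defines "w \<equiv> \<lambda>x t. u (p * x + b) t - u (q * x + c) t"
  obtains wx wxx wt where "classical w wx wxx wt"
    "\<And>x t. t > 0 \<Longrightarrow> \<bar>wt x t - wxx x t\<bar> \<le> L * \<bar>w x t\<bar>" "\<And>x t. t > 0 \<Longrightarrow> \<bar>w x t\<bar> \<le> M"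
proof -
  have sq: "p\<^sup>2 = 1" "q\<^sup>2 = 1" using assms by (auto simp: abs_if power2_eq_square split: if_splits)
  note C = classical_diff[OF classical_affine[OF cl, of 0 p b] classical_affine[OF cl, of 0 q c], simplified sq, simplified]
  show ?thesis
  proof (rule that)
    show "classical w (\<lambda>x t. p * ux (p * x + b) t - q * ux (q * x + c) t)
     (\<lambda>x t. uxx (p * x + b) t - uxx (q * x + c) t) (\<lambda>x t. ut (p * x + b) t - ut (q * x + c) t)"
      using C by (simp add: w_def)
    show "\<bar>(ut (p * x + b) t - ut (q * x + c) t) - (uxx (p * x + b) t - uxx (q * x + c) t)\<bar> \<le> L * \<bar>w x t\<bar>" if "t > 0" for x t
      using lipschitz[of "u (p * x + b) t" "u (q * x + c) t"] by (simp add: pde that w_def)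
    show "\<bar>w x t\<bar> \<le> M" if "t > 0" for x t
      using bounds[OF that, of "p * x + b"] bounds[OF that, of "q * x + c"] by (simp add: w_def abs_le_iff)
  qed
qed

lemma isometry_difference_attained:
  assumes "\<bar>p\<bar> = 1" "\<bar>q\<bar> = 1" "attains u v" "s > 0"
  shows "(\<integral>\<^sup>+x. ennreal (((u (p * x + b) s - u (q * x + c) s) - (v (p * x + b) - v (q * x + c)))\<^sup>2) \<partial>lebesgue)
    \<le> 4 * (\<integral>\<^sup>+x. ennreal ((u x s - v x)\<^sup>2) \<partial>lebesgue)"
proof -
  have [measurable]: "v \<in> borel_measurable lebesgue" using assms by (simp add: attains_def)
  have [measurable]: "(\<lambda>x. u x s) \<in> borel_measurable lebesgue"
    using u_x_continuous assms by (auto intro: continuous_lebesgue_measurable)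
  define d where "d x = u x s - v x" for x
  have [measurable]: "d \<in> borel_measurable lebesgue" unfolding d_def[abs_def] by measurable
  have dp: "(\<lambda>x. d (p * x + b)) \<in> borel_measurable lebesgue" "(\<lambda>x. - d (q * x + c)) \<in> borel_measurable lebesgue"
    using borel_measurable_lebesgue_affine[of d] assms by (force intro: borel_measurable_uminus)+
  have "(\<integral>\<^sup>+x. ennreal ((d (p * x + b) + (- d (q * x + c)))\<^sup>2) \<partial>lebesgue)
    \<le> ennreal (1 + 1) * (\<integral>\<^sup>+x. ennreal ((d (p * x + b))\<^sup>2) \<partial>lebesgue) + ennreal (1 + 1 / 1) * (\<integral>\<^sup>+x. ennreal ((- d (q * x + c))\<^sup>2) \<partial>lebesgue)"
    by (rule nn_integral_sq_add_le[OF dp]) simp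
  also have "\<dots> = 2 * (\<integral>\<^sup>+x. ennreal ((d x)\<^sup>2) \<partial>lebesgue) + 2 * (\<integral>\<^sup>+x. ennreal ((d x)\<^sup>2) \<partial>lebesgue)"
    using nn_integral_isometry[of d p b] nn_integral_isometry[of d q c] assms by simp
  also have "\<dots> = 4 * (\<integral>\<^sup>+x. ennreal ((d x)\<^sup>2) \<partial>lebesgue)"
    by (simp add: distrib_right[symmetric])
  finally show ?thesis by (simp add: d_def algebra_simps)
qed

text \<open>
  The two compared functions are compositions of \<open>u\<close> with reflections or translations that agree at \<open>a\<close>.
  They solve the same equation, so their difference satisfies a linear differential inequality.
\<close>

lemma isometry_comparison:
  assumes pq: "\<bar>p\<bar> = 1" "\<bar>q\<bar> = 1" and v: "attains u v" and a: "p * a + b = q * a + c"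
    and le: "AE x in lebesgue. x \<ge> a \<longrightarrow> v (q * x + c) \<le> v (p * x + b)"
    and "t > 0" "x \<ge> a"
  shows "u (q * x + c) t \<le> u (p * x + b) t"
proof -
  define w where "w x t = u (p * x + b) t - u (q * x + c) t" for x t
  define w0 where "w0 x = v (p * x + b) - v (q * x + c)" for x
  obtain wx wxx wt where w: "classical w wx wxx wt"
    "\<And>x t. t > 0 \<Longrightarrow> \<bar>wt x t - wxx x t\<bar> \<le> L * \<bar>w x t\<bar>" "\<And>x t. t > 0 \<Longrightarrow> \<bar>w x t\<bar> \<le> M"
    using isometry_difference[OF pq, of b c] by (auto simp: w_def[abs_def])
  have "w x t \<ge> 0"
  proof (rule comparison_on_half_line[OF w])
    show "w a t = 0" for t using a by (simp add: w_def)
    fix R :: real assume R: "R > 0"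
    let ?N = "\<lambda>s. \<integral>\<^sup>+x. ennreal ((u x s - v x)\<^sup>2) \<partial>lebesgue"
    have "((\<lambda>s. 4 * ?N s) \<longlongrightarrow> 4 * 0) (at_right 0)"
      by (intro ennreal_tendsto_cmult) (use v in \<open>auto simp: attains_def\<close>)
    then have N4: "((\<lambda>s. 4 * ?N s) \<longlongrightarrow> 0) (at_right 0)" by simp
    have le4: "ennreal (integral {a..a + R} (\<lambda>x. (max 0 (- w x s))\<^sup>2)) \<le> 4 * ?N s" if "s > 0" for s
    proof -
      have c: "continuous_on {a..a + R} (\<lambda>x. (max 0 (- w x s))\<^sup>2)"
        by (intro continuous_intros strip_continuous_compose[OF classicalD(4)[OF w(1)]]) (use that in auto)
      have "ennreal (integral {a..a + R} (\<lambda>x. (max 0 (- w x s))\<^sup>2)) = (\<integral>\<^sup>+x. ennreal ((max 0 (- w x s))\<^sup>2) * indicator {a..a + R} x \<partial>lebesgue)"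
        using nn_integral_continuous_interval[OF c] by simp
      also have "\<dots> \<le> (\<integral>\<^sup>+x. ennreal ((w x s - w0 x)\<^sup>2) \<partial>lebesgue)"
      proof (rule nn_integral_mono_AE)
        show "AE x in lebesgue. ennreal ((max 0 (- w x s))\<^sup>2) * indicator {a..a + R} x \<le> ennreal ((w x s - w0 x)\<^sup>2)"
          using le
        proof eventually_elim
          case (elim x)
          show ?case
          proof (cases "x \<in> {a..a + R}")
            case True
            then have "w0 x \<ge> 0" using elim by (simp add: w0_def)
            then have "(max 0 (- w x s)) \<le> \<bar>w x s - w0 x\<bar>" by auto
            then have "(max 0 (- w x s))\<^sup>2 \<le> (w x s - w0 x)\<^sup>2" by (metis max.cobounded1 power2_abs power_mono)
            then show ?thesis using True by (simp add: ennreal_leI)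
          qed simp
        qed
      qed
      also have "\<dots> \<le> 4 * ?N s"
        using isometry_difference_attained[OF pq v that, of b c] by (simp add: w_def w0_def)
      finally show ?thesis .
    qed
    have "((\<lambda>s. ennreal (integral {a..a + R} (\<lambda>x. (max 0 (- w x s))\<^sup>2))) \<longlongrightarrow> 0) (at_right 0)"
      by (rule tendsto_sandwich[OF _ _ tendsto_const N4])
        (auto simp: eventually_at_right_less intro!: eventually_mono[OF eventually_at_right_less[of 0]] le4)
    then show "((\<lambda>s. integral {a..a + R} (\<lambda>x. (max 0 (- w x s))\<^sup>2)) \<longlongrightarrow> 0) (at_right 0)"
    proof -
      assume lim: "((\<lambda>s. ennreal (integral {a..a + R} (\<lambda>x. (max 0 (- w x s))\<^sup>2))) \<longlongrightarrow> 0) (at_right 0)"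
      have "0 \<le> integral {a..a + R} (\<lambda>x. (max 0 (- w x s))\<^sup>2)" for s
        by (cases "(\<lambda>x. (max 0 (- w x s))\<^sup>2) integrable_on {a..a + R}")
          (auto intro: integral_nonneg simp: not_integrable_integral)
      then show ?thesis
        using tendsto_enn2real[of _ 0, OF lim[folded ennreal_0]] by simp
    qed
  qed (use L_nonneg assms in auto)
  then show ?thesis by (simp add: w_def)
qed

text \<open>
  Reflection at \<open>0\<close>, compared in both orders, gives evenness. Reflection at the midpoint of \<open>x\<close> and \<open>y\<close>
  gives monotonicity.
\<close>

lemma even_and_decreasing:
  assumes v: "attains u v"
    and even: "AE x in lebesgue. v (- x) = v x"
    and dec: "\<And>a. a > 0 \<Longrightarrow> AE x in lebesgue. x \<ge> a \<longrightarrow> v x \<le> v (2 * a - x)"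
    and t: "t > 0"
  shows "u (- x) t = u x t" "0 \<le> x \<Longrightarrow> x \<le> y \<Longrightarrow> u y t \<le> u x t"
proof -
  have "u (- x) t = u x t" if "x \<ge> 0" for x
  proof (rule antisym)
    show "u (- x) t \<le> u x t"
    proof -
      have "AE x in lebesgue. x \<ge> 0 \<longrightarrow> v (- 1 * x + 0) \<le> v (1 * x + 0)"
        using even by eventually_elim simp
      from isometry_comparison[OF _ _ v _ this t that] show ?thesis by simp
    qed
    show "u x t \<le> u (- x) t"
    proof -
      have "AE x in lebesgue. x \<ge> 0 \<longrightarrow> v (1 * x + 0) \<le> v (- 1 * x + 0)"
        using even by eventually_elim simp
      from isometry_comparison[OF _ _ v _ this t that] show ?thesis by simp
    qed
  qed
  from this[of x] this[of "- x"] show "u (- x) t = u x t" by fastforce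
  assume xy: "0 \<le> x" "x \<le> y"
  show "u y t \<le> u x t"
  proof (cases "x = y")
    case False
    define a where "a = (x + y) / 2"
    have "a > 0" "y \<ge> a" "2 * a - y = x" using xy False by (auto simp: a_def field_simps)
    then show ?thesis
      using isometry_comparison[of "- 1" 1 v a "2 * a" 0 t y] v dec[of a] t by simp
  qed simp
qed

text \<open>
  The increment \<open>u(x + h, t) - u(x, t)\<close> is a difference of two solutions, so the integral of its square
  grows at most by the factor \<open>exp (2 L t)\<close>. Divide by \<open>h\<^sup>2\<close> and apply Fatou's lemma.
\<close>

lemma gradient_L2_bound:
  assumes v: "attains u v" and t: "t > 0" and J: "J \<ge> 0"
    and vh: "\<And>h. h > 0 \<Longrightarrow> (\<integral>\<^sup>+x. ennreal ((v (x + h) - v x)\<^sup>2) \<partial>lebesgue) \<le> ennreal (h\<^sup>2 * J)"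
  shows "(\<integral>\<^sup>+x. ennreal ((ux x t)\<^sup>2) \<partial>lebesgue) \<le> ennreal (exp (2 * L * t) * J)"
proof -
  have quot: "(\<integral>\<^sup>+x. ennreal ((u (x + h) t - u x t)\<^sup>2) * indicator {- real n..real n} x \<partial>lebesgue) \<le> ennreal (h\<^sup>2 * (exp (2 * L * t) * J))"
    if h: "h > 0" for h n
  proof -
    define w where "w x t = u (1 * x + h) t - u (1 * x + 0) t" for x t
    define w0 where "w0 x = v (1 * x + h) - v (1 * x + 0)" for x
    obtain wx wxx wt where w: "classical w wx wxx wt"
      "\<And>x t. t > 0 \<Longrightarrow> \<bar>wt x t - wxx x t\<bar> \<le> L * \<bar>w x t\<bar>" "\<And>x t. t > 0 \<Longrightarrow> \<bar>w x t\<bar> \<le> M"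
      using isometry_difference[of 1 1 h 0] by (auto simp: w_def[abs_def])
    have wc: "continuous_on S (\<lambda>x. w x s)" if "s > 0" for s S
      by (intro strip_continuous_compose[OF classicalD(4)[OF w(1)]] continuous_intros) (use that in auto)
    have w0m: "w0 \<in> borel_measurable lebesgue"
      unfolding w0_def[abs_def] using v by (intro borel_measurable_diff borel_measurable_lebesgue_affine) (auto simp: attains_def)
    have "integral {- real n..real n} (\<lambda>x. (w x t)\<^sup>2) \<le> exp (2 * L * t) * (h\<^sup>2 * J)"
    proof (rule cutoff_growth[OF w(1,2), where P = "\<lambda>z. z\<^sup>2" and ?P1.0 = "\<lambda>z. 2 * z" and ?P2.0 = "\<lambda>_. 2" and Q = "M\<^sup>2" and \<sigma> = 1 and a = 0])
      show "((\<lambda>z. z\<^sup>2) has_real_derivative 2 * z) (at z)" "((\<lambda>z. 2 * z) has_real_derivative 2) (at z)" for z :: real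
        by (auto intro!: derivative_eq_intros)
      show "(w x t)\<^sup>2 \<le> M\<^sup>2" if "t > 0" for x t
        using w(3)[OF that, of x] M_nonneg by (simp add: abs_le_square_iff[symmetric])
      show "\<bar>2 * z\<bar> * \<bar>z\<bar> \<le> 2 * z\<^sup>2" for z :: real by (simp add: abs_mult power2_eq_square)
      fix R e :: real assume R: "R > 0" and e: "e > 0"
      let ?N = "\<lambda>s. \<integral>\<^sup>+x. ennreal ((u x s - v x)\<^sup>2) \<partial>lebesgue"
      \<comment> \<open>In \<open>(p + q)\<^sup>2 \<le> (1 + \<theta>) p\<^sup>2 + (1 + 1/\<theta>) q\<^sup>2\<close> the excess \<open>\<theta> h\<^sup>2 J\<close> has to be at most \<open>e / 2\<close>.\<close>
      define \<theta> where "\<theta> = e / (2 * (h\<^sup>2 * J + 1))"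
      have hJ: "h\<^sup>2 * J \<ge> 0" using J by simp
      have \<theta>: "\<theta> > 0" "\<theta> * (h\<^sup>2 * J) \<le> e / 2"
      proof -
        show "\<theta> > 0" using e hJ by (simp add: \<theta>_def)
        have "\<theta> * (h\<^sup>2 * J) \<le> \<theta> * (h\<^sup>2 * J + 1)" using \<open>\<theta> > 0\<close> by (intro mult_left_mono) auto
        also have "\<dots> = e / 2"
        proof -
          have "c > 0 \<Longrightarrow> e / (2 * c) * c = e / 2" for c :: real by simp
          from this[of "h\<^sup>2 * J + 1"] show ?thesis using hJ unfolding \<theta>_def by linarith
        qed
        finally show "\<theta> * (h\<^sup>2 * J) \<le> e / 2" .
      qed
      have "((\<lambda>s. ennreal (1 + 1 / \<theta>) * (4 * ?N s)) \<longlongrightarrow> ennreal (1 + 1 / \<theta>) * (4 * 0)) (at_right 0)"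
        by (intro ennreal_tendsto_cmult) (use v in \<open>auto simp: attains_def\<close>)
      then have "\<forall>\<^sub>F s in at_right 0. ennreal (1 + 1 / \<theta>) * (4 * ?N s) < ennreal (e / 2)"
        using e by (intro order_tendstoD(2)) auto
      moreover have "\<forall>\<^sub>F s in at_right 0. s > (0::real)" by (simp add: eventually_at_right_less)
      ultimately show "\<forall>\<^sub>F s in at_right 0. integral {0 - 1 * R..0 + R} (\<lambda>x. (w x s)\<^sup>2) \<le> h\<^sup>2 * J + e"
      proof eventually_elim
        case (elim s)
        have wm: "(\<lambda>x. w x s) \<in> borel_measurable lebesgue"
          by (intro continuous_lebesgue_measurable wc elim)
        have "ennreal (integral {- R..R} (\<lambda>x. (w x s)\<^sup>2)) = (\<integral>\<^sup>+x. ennreal ((w x s)\<^sup>2) * indicator {- R..R} x \<partial>lebesgue)"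
          by (rule nn_integral_continuous_interval[symmetric]) (auto intro!: continuous_intros wc elim)
        also have "\<dots> \<le> (\<integral>\<^sup>+x. ennreal ((w0 x + (w x s - w0 x))\<^sup>2) \<partial>lebesgue)"
          by (intro nn_integral_mono) (auto simp: indicator_def)
        also have "\<dots> \<le> ennreal (1 + \<theta>) * (\<integral>\<^sup>+x. ennreal ((w0 x)\<^sup>2) \<partial>lebesgue) + ennreal (1 + 1 / \<theta>) * (\<integral>\<^sup>+x. ennreal ((w x s - w0 x)\<^sup>2) \<partial>lebesgue)"
          by (intro nn_integral_sq_add_le \<theta> w0m borel_measurable_diff wm)
        also have "\<dots> \<le> ennreal (1 + \<theta>) * ennreal (h\<^sup>2 * J) + ennreal (1 + 1 / \<theta>) * (4 * ?N s)"
          using isometry_difference_attained[OF _ _ v elim(2), of 1 1 h 0] vh[OF h]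
          by (intro add_mono mult_left_mono) (auto simp: w_def w0_def)
        also have "\<dots> \<le> ennreal (1 + \<theta>) * ennreal (h\<^sup>2 * J) + ennreal (e / 2)"
          using elim by (intro add_mono) auto
        also have "\<dots> = ennreal ((1 + \<theta>) * (h\<^sup>2 * J) + e / 2)"
          using \<theta> hJ e by (simp add: ennreal_mult' ennreal_plus)
        finally have "integral {- R..R} (\<lambda>x. (w x s)\<^sup>2) \<le> (1 + \<theta>) * (h\<^sup>2 * J) + e / 2"
          using \<theta> hJ e by (subst (asm) ennreal_le_iff) auto
        then show ?case using \<theta>(2) by (simp add: distrib_right)
      qed
    qed (use L_nonneg t in \<open>auto intro!: continuous_intros\<close>)
    then have "ennreal (integral {- real n..real n} (\<lambda>x. (w x t)\<^sup>2)) \<le> ennreal (h\<^sup>2 * (exp (2 * L * t) * J))"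
      by (intro ennreal_leI) (simp add: mult_ac)
    also have "ennreal (integral {- real n..real n} (\<lambda>x. (w x t)\<^sup>2)) = (\<integral>\<^sup>+x. ennreal ((w x t)\<^sup>2) * indicator {- real n..real n} x \<partial>lebesgue)"
      by (rule nn_integral_continuous_interval[symmetric]) (auto intro!: continuous_intros wc t)
    finally show ?thesis by (simp add: w_def)
  qed
  define h where "h n = 1 / real (Suc n)" for n
  have h: "h n > 0" "h \<longlonglongrightarrow> 0" for n
    using LIMSEQ_inverse_real_of_nat by (auto simp: h_def[abs_def] inverse_eq_divide)
  have m: "(\<lambda>x. ennreal (((u (x + h n) t - u x t) / h n)\<^sup>2) * indicator {- real n..real n} x) \<in> borel_measurable lebesgue" for n
  proof -
    have "(\<lambda>x. ((u (x + h n) t - u x t) / h n)\<^sup>2) \<in> borel_measurable lebesgue"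
      using t h(1)[of n] by (intro continuous_lebesgue_measurable continuous_intros strip_continuous_compose[OF D(4)]) auto
    then show ?thesis by (intro borel_measurable_times_ennreal measurable_compose[OF _ measurable_ennreal] borel_measurable_indicator) auto
  qed
  show ?thesis
  proof (rule nn_integral_le_liminf[OF m])
    fix x
    have "(\<lambda>n. (u (x + h n) t - u x t) / h n) \<longlonglongrightarrow> ux x t"
    proof -
      have "((\<lambda>h. (u (x + h) t - u x t) / h) \<longlongrightarrow> ux x t) (at 0)"
        using D(1)[OF t, of x UNIV] by (simp add: DERIV_def)
      moreover have "filterlim h (at 0) sequentially"
        using h by (auto simp: filterlim_at intro!: eventuallyI) (metis h(1) less_irrefl)
      ultimately show ?thesis by (rule filterlim_compose)
    qed
    then have "(\<lambda>n. ennreal (((u (x + h n) t - u x t) / h n)\<^sup>2)) \<longlonglongrightarrow> ennreal ((ux x t)\<^sup>2)"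
      by (intro tendsto_ennrealI tendsto_power)
    moreover have "\<forall>\<^sub>F n in sequentially. ennreal (((u (x + h n) t - u x t) / h n)\<^sup>2) * indicator {- real n..real n} x
        = ennreal (((u (x + h n) t - u x t) / h n)\<^sup>2)"
    proof -
      obtain N where "real N \<ge> \<bar>x\<bar>" using real_arch_simple by blast
      then show ?thesis by (auto simp: eventually_sequentially indicator_def intro!: exI[of _ N])
    qed
    ultimately show "(\<lambda>n. ennreal (((u (x + h n) t - u x t) / h n)\<^sup>2) * indicator {- real n..real n} x) \<longlonglongrightarrow> ennreal ((ux x t)\<^sup>2)"
      using Lim_transform_eventually eventually_mono by (smt (verit, best))
  next
    fix n
    have "(\<integral>\<^sup>+x. ennreal (((u (x + h n) t - u x t) / h n)\<^sup>2) * indicator {- real n..real n} x \<partial>lebesgue)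
      = (\<integral>\<^sup>+x. ennreal (1 / (h n)\<^sup>2) * (ennreal ((u (x + h n) t - u x t)\<^sup>2) * indicator {- real n..real n} x) \<partial>lebesgue)"
      by (intro nn_integral_cong) (simp add: mult.assoc[symmetric] ennreal_mult'[symmetric] power_divide)
    also have "\<dots> = ennreal (1 / (h n)\<^sup>2) * (\<integral>\<^sup>+x. ennreal ((u (x + h n) t - u x t)\<^sup>2) * indicator {- real n..real n} x \<partial>lebesgue)"
    proof (rule nn_integral_cmult)
      have "(\<lambda>x. (u (x + h n) t - u x t)\<^sup>2) \<in> borel_measurable lebesgue"
        using t by (intro continuous_lebesgue_measurable continuous_intros strip_continuous_compose[OF D(4)]) auto
      then show "(\<lambda>x. ennreal ((u (x + h n) t - u x t)\<^sup>2) * indicator {- real n..real n} x) \<in> borel_measurable lebesgue"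
        by (intro borel_measurable_times_ennreal measurable_compose[OF _ measurable_ennreal] borel_measurable_indicator) auto
    qed
    also have "\<dots> \<le> ennreal (1 / (h n)\<^sup>2) * ennreal ((h n)\<^sup>2 * (exp (2 * L * t) * J))"
      by (intro mult_left_mono quot h) auto
    also have "\<dots> = ennreal (exp (2 * L * t) * J)"
      using h(1)[of n] by (subst ennreal_mult'[symmetric]) auto
    finally show "(\<integral>\<^sup>+x. ennreal (((u (x + h n) t - u x t) / h n)\<^sup>2) * indicator {- real n..real n} x \<partial>lebesgue) \<le> ennreal (exp (2 * L * t) * J)" .
  qed
qed

end

section \<open>Convergence to one behind a spreading plateau\<close>

locale monostable_solution = reaction_solution +
  assumes F_nonpos: "s \<le> 0 \<Longrightarrow> F s = 0"
    and F_pos: "0 < s \<Longrightarrow> s < 1 \<Longrightarrow> F s > 0"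
    and F_neg: "s > 1 \<Longrightarrow> F s < 0"
    and F_one: "F 1 = 0"
    and even: "0 < t \<Longrightarrow> u (- x) t = u x t"
    and decreasing: "0 < t \<Longrightarrow> 0 \<le> x \<Longrightarrow> x \<le> y \<Longrightarrow> u y t \<le> u x t"
begin

lemma decreasing_abs: "0 < t \<Longrightarrow> \<bar>x\<bar> \<le> \<bar>y\<bar> \<Longrightarrow> u y t \<le> u x t"
  using decreasing[of t "\<bar>x\<bar>" "\<bar>y\<bar>"] even[of t x] even[of t y] by (auto simp: abs_if split: if_splits)

lemma F_nonneg: "s \<le> 1 \<Longrightarrow> F s \<ge> 0"
  using F_nonpos[of s] F_pos[of s] F_one by (cases "s \<le> 0"; cases "s = 1"; fastforce)

lemma positive_minimum:
  assumes "0 < a" "b < 1"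
  obtains m where "m > 0" "\<And>s. a \<le> s \<Longrightarrow> s \<le> b \<Longrightarrow> m \<le> F s"
proof (cases "a \<le> b")
  case True
  obtain s0 where "s0 \<in> {a..b}" "\<forall>s\<in>{a..b}. F s0 \<le> F s"
    using continuous_attains_inf[of "{a..b}" F] F_continuous True by auto
  then show ?thesis using that[of "F s0"] F_pos[of s0] assms by auto
next
  case False
  then show ?thesis using that[of 1] by auto
qed

lemma negative_maximum:
  assumes "1 < a"
  obtains m where "m > 0" "\<And>s. a \<le> s \<Longrightarrow> s \<le> b \<Longrightarrow> F s \<le> - m"
proof (cases "a \<le> b")
  case True
  obtain s0 where "s0 \<in> {a..b}" "\<forall>s\<in>{a..b}. F s \<le> F s0"
    using continuous_attains_sup[of "{a..b}" F] F_continuous True by auto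
  then show ?thesis using that[of "- F s0"] F_neg[of s0] assms by auto
next
  case False
  then show ?thesis using that[of 1] by auto
qed

text \<open>
  The barrier \<open>1 + \<epsilon> + k (t1 - t) + b x\<^sup>2\<close> exceeds \<open>M\<close> at the initial time and at \<open>\<bar>x\<bar> = R\<close>. Where \<open>u\<close>
  lies above it, \<open>F u \<le> - m\<close>, while the barrier moves and bends slowly compared with \<open>m\<close>. By
  monotonicity it suffices to bound \<open>u(0, t)\<close>.
\<close>

lemma eventually_below:
  assumes "\<epsilon> > 0"
  shows "\<exists>T>0. \<forall>t\<ge>T. \<forall>x. u x t \<le> 1 + \<epsilon>"
proof -
  obtain m where m: "m > 0" "\<And>s. 1 + \<epsilon> \<le> s \<Longrightarrow> s \<le> M \<Longrightarrow> F s \<le> - m"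
    using negative_maximum[of "1 + \<epsilon>" M] assms by auto
  define k where "k = m / 4"
  define b where "b = m / 8"
  define R where "R = sqrt ((M + 1) / b)"
  have R: "R > 0" using M_nonneg m by (auto simp: R_def b_def)
  have b: "2 * b = m / 4" "b * R\<^sup>2 = M + 1" using M_nonneg m by (auto simp: b_def R_def)
  have "u 0 t1 \<le> 1 + \<epsilon>" if t1: "t1 \<ge> 1 + M / k" for t1
  proof (rule ccontr)
    assume neg: "\<not> u 0 t1 \<le> 1 + \<epsilon>"
    have k: "k > 0" using m by (simp add: k_def)
    have "M / k \<ge> 0" using k M_nonneg by simp
    then have t1': "t1 \<ge> 1" using t1 by linarith
    have t1'': "k * (t1 - 1) \<ge> M"
      using t1 k by (simp add: field_simps)
    define D where "D x s = u x s - (1 + \<epsilon> + k * (t1 - s)) - b * x\<^sup>2" for x s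
    have cD: "continuous_on ({-R..R} \<times> {1..t1}) (\<lambda>(x, s). D x s)"
      unfolding D_def case_prod_beta
      by (intro continuous_intros strip_continuous_compose[OF D(4)]) auto
    obtain x t where xt: "x \<in> {-R..R}" "1 < t" "t \<le> t1" "D x t > 0"
      and mx: "\<And>y s. y \<in> {-R..R} \<Longrightarrow> s \<in> {1..t1} \<Longrightarrow> D y s \<le> D x t"
      and dt: "\<And>d. ((\<lambda>s. D x s) has_real_derivative d) (at t) \<Longrightarrow> d \<ge> 0"
    proof (rule parabolic_maximum_point[OF cD, of 0 t1])
      show "D x 1 \<le> 0" for x
      proof -
        have "0 \<le> b * x\<^sup>2" using b m by simp
        then show ?thesis using bounds(2)[of 1 x] t1'' assms by (simp add: D_def)
      qed
    qed (use R t1' neg in \<open>auto simp: D_def\<close>)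
    have t: "t > 0" using xt by simp
    have xR: "- R < x" "x < R"
    proof -
      have "k * (t1 - t) \<ge> 0" using k xt by simp
      then have "D R t < 0" "D (- R) t < 0" using b bounds(2)[OF t, of R] bounds(2)[OF t, of "- R"] assms by (auto simp: D_def)
      then show "- R < x" "x < R" using xt by (metis atLeastAtMost_iff less_eq_real_def not_less)+
    qed
    have "ut x t + k \<ge> 0"
      by (rule dt) (auto simp: D_def[abs_def] intro!: derivative_eq_intros D(3)[OF t])
    moreover have "uxx x t - 2 * b \<le> 0"
    proof (rule interior_maximum_second_derivative(2)[OF xR, of "\<lambda>x. D x t" "\<lambda>x. ux x t - 2 * b * x" "\<lambda>x. uxx x t - 2 * b"])
      show "D y t \<le> D x t" if "- R \<le> y" "y \<le> R" for y using mx[of y t] that xt by simp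
      show "((\<lambda>x. D x t) has_real_derivative ux y t - 2 * b * y) (at y)"
        "((\<lambda>x. ux x t - 2 * b * x) has_real_derivative uxx y t - 2 * b) (at y)" for y
        unfolding D_def by (rule derivative_eq_intros refl D(1,2)[OF t] | simp)+
      show "continuous_on UNIV (\<lambda>x. uxx x t - 2 * b)"
        using t by (intro continuous_intros strip_continuous_compose[OF D(6)]) auto
    qed
    moreover have "F (u x t) \<le> - m"
    proof (rule m(2)[OF _ bounds(2)[OF t]])
      have "0 \<le> k * (t1 - t)" "0 \<le> b * x\<^sup>2" using k xt b m by auto
      then show "1 + \<epsilon> \<le> u x t" using xt(4) by (simp add: D_def)
    qed
    ultimately show False using pde[OF t, of x] b m by (simp add: k_def)
  qed
  then have "\<forall>t\<ge>1 + M / k. \<forall>x. u x t \<le> 1 + \<epsilon>"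
    using decreasing_abs[of _ 0] M_nonneg m by (smt (verit, best) abs_ge_zero abs_zero divide_nonneg_nonneg k_def)
  moreover have "1 + M / k > 0" using M_nonneg m by (simp add: k_def add_pos_nonneg)
  ultimately show ?thesis by blast
qed

text \<open>
  The barrier \<open>1 - \<epsilon>/2 - k (t1 - t) - b x\<^sup>2\<close> rises from below \<open>q\<close> and is negative at \<open>\<bar>x\<bar> = R\<close>. Where \<open>u\<close>
  lies below it, \<open>u\<close> takes values between \<open>q\<close> and \<open>1 - \<epsilon>/2\<close>, and there \<open>F\<close> is at least \<open>m\<close>.
\<close>

lemma eventually_above:
  assumes "0 < q" "\<And>R. \<exists>T>0. \<forall>t\<ge>T. \<forall>x. \<bar>x\<bar> \<le> R \<longrightarrow> q \<le> u x t"
    and "\<epsilon> > 0" "\<epsilon> < 1"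
  shows "\<exists>T>0. \<forall>t\<ge>T. \<forall>x. \<bar>x\<bar> \<le> K \<longrightarrow> 1 - \<epsilon> \<le> u x t"
proof -
  obtain m where m: "m > 0" "\<And>s. q \<le> s \<Longrightarrow> s \<le> 1 - \<epsilon> / 2 \<Longrightarrow> m \<le> F s"
    using positive_minimum[of q "1 - \<epsilon> / 2"] assms by auto
  define k where "k = m / 4"
  define b where "b = min (m / 8) (\<epsilon> / (2 * (K\<^sup>2 + 1)))"
  have K1: "K\<^sup>2 + 1 > 0" by (smt (verit) zero_le_power2)
  have b: "b > 0" "2 * b \<le> m / 4" "b * K\<^sup>2 \<le> \<epsilon> / 2"
  proof -
    show b0: "b > 0" using m assms K1 by (simp add: b_def)
    show "2 * b \<le> m / 4" by (simp add: b_def)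
    have "b * K\<^sup>2 \<le> b * (K\<^sup>2 + 1)" using b0 by (intro mult_left_mono) auto
    also have "\<dots> \<le> \<epsilon> / (2 * (K\<^sup>2 + 1)) * (K\<^sup>2 + 1)" using K1 by (intro mult_right_mono) (auto simp: b_def)
    also have "\<dots> = \<epsilon> / 2"
      using nonzero_divide_mult_cancel_right[of "K\<^sup>2 + 1" \<epsilon>] K1 by (simp add: field_simps)
    finally show "b * K\<^sup>2 \<le> \<epsilon> / 2" .
  qed
  define R where "R = sqrt (1 / b)"
  have R: "R > 0" "b * R\<^sup>2 = 1" using b by (auto simp: R_def)
  obtain T where T: "T > 0" "\<And>t x. t \<ge> T \<Longrightarrow> \<bar>x\<bar> \<le> R \<Longrightarrow> q \<le> u x t" using assms(2)[of R] by blast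
  have k: "k > 0" using m by (simp add: k_def)
  have "1 - \<epsilon> \<le> u K t1" if t1: "t1 \<ge> T + 1 / k" for t1
  proof (rule ccontr)
    assume neg: "\<not> 1 - \<epsilon> \<le> u K t1"
    have "1 / k > 0" using k by simp
    then have t1': "t1 \<ge> T" using t1 by linarith
    have t1'': "k * (t1 - T) \<ge> 1"
      using t1 k by (simp add: field_simps)
    have K: "\<bar>K\<bar> \<le> R"
    proof -
      have "b * K\<^sup>2 \<le> b * R\<^sup>2" using b R assms by simp
      then have "K\<^sup>2 \<le> R\<^sup>2" using b by simp
      then show ?thesis using R by (simp add: abs_le_square_iff[symmetric])
    qed
    define D where "D x s = (1 - \<epsilon> / 2 - k * (t1 - s)) - b * x\<^sup>2 - u x s" for x s
    have cD: "continuous_on ({-R..R} \<times> {T..t1}) (\<lambda>(x, s). D x s)"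
      unfolding D_def case_prod_beta
      by (intro continuous_intros strip_continuous_compose[OF D(4)]) (use T in auto)
    obtain x t where xt: "x \<in> {-R..R}" "T < t" "t \<le> t1" "D x t > 0"
      and mx: "\<And>y s. y \<in> {-R..R} \<Longrightarrow> s \<in> {T..t1} \<Longrightarrow> D y s \<le> D x t"
      and dt: "\<And>d. ((\<lambda>s. D x s) has_real_derivative d) (at t) \<Longrightarrow> d \<ge> 0"
    proof (rule parabolic_maximum_point[OF cD, of K t1])
      show "D x T \<le> 0" for x
      proof -
        have "0 \<le> b * x\<^sup>2" using b by simp
        then show ?thesis using bounds(1)[OF T(1), of x] t1'' assms by (simp add: D_def)
      qed
      show "0 < D K t1" using neg b by (simp add: D_def)
    qed (use K t1' in auto)
    have t: "t > 0" using xt T by simp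
    have kt: "k * (t1 - t) \<ge> 0" using k xt by simp
    have xR: "- R < x" "x < R"
    proof -
      have "D R t < 0" "D (- R) t < 0"
        using R bounds(1)[OF t, of R] bounds(1)[OF t, of "- R"] assms kt by (auto simp: D_def)
      then show "- R < x" "x < R" using xt by (metis atLeastAtMost_iff less_eq_real_def not_less)+
    qed
    have "k - ut x t \<ge> 0"
      by (rule dt) (auto simp: D_def[abs_def] intro!: derivative_eq_intros D(3)[OF t])
    moreover have "- 2 * b - uxx x t \<le> 0"
    proof (rule interior_maximum_second_derivative(2)[OF xR, of "\<lambda>x. D x t" "\<lambda>x. - 2 * b * x - ux x t" "\<lambda>x. - 2 * b - uxx x t"])
      show "D y t \<le> D x t" if "- R \<le> y" "y \<le> R" for y using mx[of y t] that xt by simp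
      show "((\<lambda>x. D x t) has_real_derivative - 2 * b * y - ux y t) (at y)"
        "((\<lambda>x. - 2 * b * x - ux x t) has_real_derivative - 2 * b - uxx y t) (at y)" for y
        unfolding D_def by (rule derivative_eq_intros refl D(1,2)[OF t] | simp)+
      show "continuous_on UNIV (\<lambda>x. - 2 * b - uxx x t)"
        using t by (intro continuous_intros strip_continuous_compose[OF D(6)]) auto
    qed
    moreover have "m \<le> F (u x t)"
    proof (rule m(2))
      show "q \<le> u x t" using T(2)[of t x] xt by auto
      have "0 \<le> b * x\<^sup>2" using b by auto
      then show "u x t \<le> 1 - \<epsilon> / 2" using xt(4) kt by (simp add: D_def)
    qed
    ultimately show False using pde[OF t, of x] b m by (simp add: k_def)
  qed
  then have "1 - \<epsilon> \<le> u x t" if "t \<ge> T + 1 / k" "\<bar>x\<bar> \<le> K" for x t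
    using decreasing_abs[of t x K] that T k
    by (smt (verit, best) divide_pos_pos)
  moreover have "T + 1 / k > 0" using T k by (simp add: add_pos_nonneg)
  ultimately show ?thesis by blast
qed

lemma locally_uniform_convergence:
  assumes "0 < q" "\<And>R. \<exists>T>0. \<forall>t\<ge>T. \<forall>x. \<bar>x\<bar> \<le> R \<longrightarrow> q \<le> u x t" "compact K"
  shows "uniform_limit K (\<lambda>t x. u x t) (\<lambda>x. 1) at_top"
proof (rule uniform_limitI)
  fix e :: real assume "e > 0"
  define \<epsilon> where "\<epsilon> = min (e / 2) (1 / 2)"
  have \<epsilon>: "\<epsilon> > 0" "\<epsilon> < 1" "\<epsilon> < e" using \<open>e > 0\<close> by (auto simp: \<epsilon>_def)
  obtain B where B: "\<And>x. x \<in> K \<Longrightarrow> \<bar>x\<bar> \<le> B"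
    using compact_imp_bounded[OF assms(3)] unfolding bounded_iff by auto
  obtain T1 where T1: "\<And>t x. t \<ge> T1 \<Longrightarrow> \<bar>x\<bar> \<le> B \<Longrightarrow> 1 - \<epsilon> \<le> u x t"
    using eventually_above[OF assms(1,2) \<epsilon>(1,2)] by blast
  obtain T2 where T2: "\<And>t x. t \<ge> T2 \<Longrightarrow> u x t \<le> 1 + \<epsilon>"
    using eventually_below[OF \<epsilon>(1)] by blast
  show "\<forall>\<^sub>F t in at_top. \<forall>x\<in>K. dist (u x t) 1 < e"
    using eventually_ge_at_top[of T1] eventually_ge_at_top[of T2]
  proof eventually_elim
    case (elim t)
    show ?case
    proof
      fix x assume "x \<in> K"
      then have "1 - \<epsilon> \<le> u x t" "u x t \<le> 1 + \<epsilon>" using T1[OF elim(1) B] T2[OF elim(2)] by auto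
      then show "dist (u x t) 1 < e" using \<epsilon> by (simp add: dist_real_def abs_less_iff)
    qed
  qed
qed

end

section \<open>Spreading from a large plateau\<close>

text \<open>
  The function \<open>w\<close> falls from \<open>q\<close>, with slope zero, to \<open>0\<close> and is a subsolution in a frame moving with
  speed \<open>c\<close>. As a function of its height, its steepness is
  \<open>sqrt (2 (G q - G w)) - c (q - w)\<close>: the first term alone gives a stationary solution, and the
  correction produces the speed, since \<open>w'' + c w' + F w = c F(w) (q - w) / sqrt (2 (G q - G w)) \<ge> 0\<close>.
  The profile is found by solving this first order equation for \<open>\<rho> = sqrt (q - w)\<close>, because the
  equation for \<open>\<rho>\<close> is not singular at the top. The hypothesis on \<open>\<kappa>\<close> bounds the steepness from below and
  so the length \<open>len\<close> from above.
\<close>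

lemma travelling_profile:
  fixes F G :: "real \<Rightarrow> real"
  assumes F: "continuous_on UNIV F" "\<And>s. 0 \<le> s \<Longrightarrow> s \<le> q \<Longrightarrow> F s \<ge> 0"
    and G: "\<And>s. (G has_real_derivative F s) (at s)"
    and q: "q > 0" "\<kappa> > 0" "\<And>s. 0 \<le> s \<Longrightarrow> s \<le> q \<Longrightarrow> \<kappa> * (q - s) \<le> G q - G s"
  obtains c len w w1 w2 where "c > 0" "len > 0" "len\<^sup>2 \<le> 8 * q / \<kappa>" "w 0 = q" "w len = 0" "w1 0 = 0"
    "continuous_on {0..len} w" "continuous_on {0..len} w1" "\<And>x. x \<in> {0..len} \<Longrightarrow> 0 \<le> w x \<and> w x \<le> q"
    "\<And>x. 0 < x \<Longrightarrow> x < len \<Longrightarrow> (w has_real_derivative w1 x) (at x)"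
    "\<And>x. 0 < x \<Longrightarrow> x < len \<Longrightarrow> (w1 has_real_derivative w2 x) (at x)"
    "\<And>x. 0 < x \<Longrightarrow> x < len \<Longrightarrow> w2 x + c * w1 x + F (w x) \<ge> 0"
proof -
  define b where "b = sqrt q"
  have b: "b > 0" "b\<^sup>2 = q" using q by (auto simp: b_def)
  \<comment> \<open>The quotient \<open>(G q - G (q - r\<^sup>2)) / r\<^sup>2\<close>, in a form that is continuous at \<open>r = 0\<close>.\<close>
  define H where "H r = integral {0..1} (\<lambda>\<theta>. F (q - \<theta> * r\<^sup>2))" for r
  have G_cont: "continuous_on S G" for S
    using G by (auto intro!: continuous_at_imp_continuous_on DERIV_isCont)
  have H_eq: "r\<^sup>2 * H r = G q - G (q - r\<^sup>2)" for r
  proof -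
    have "((\<lambda>\<theta>. r\<^sup>2 * F (q - \<theta> * r\<^sup>2)) has_integral (- G (q - 1 * r\<^sup>2)) - (- G (q - 0 * r\<^sup>2))) {0..1}"
    proof (rule fundamental_theorem_of_calculus)
      fix x :: real
      have "((\<lambda>\<theta>. q - \<theta> * r\<^sup>2) has_real_derivative - r\<^sup>2) (at x)"
        by (auto intro!: derivative_eq_intros)
      from DERIV_minus[OF DERIV_chain2[OF G this]]
      have "((\<lambda>\<theta>. - G (q - \<theta> * r\<^sup>2)) has_real_derivative r\<^sup>2 * F (q - x * r\<^sup>2)) (at x)"
        by (simp add: mult.commute)
      then show "((\<lambda>\<theta>. - G (q - \<theta> * r\<^sup>2)) has_vector_derivative r\<^sup>2 * F (q - x * r\<^sup>2)) (at x within {0..1})"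
        by (simp add: has_real_derivative_iff_has_vector_derivative[symmetric] has_field_derivative_at_within)
    qed simp
    from integral_unique[OF this] show ?thesis by (simp add: H_def)
  qed
  have H_cont: "continuous_on UNIV H"
  proof -
    have "continuous_on (UNIV \<times> cbox 0 1) (\<lambda>(r, \<theta>). F (q - \<theta> * r\<^sup>2))"
      unfolding case_prod_beta
      by (intro continuous_on_compose2[OF F(1)] continuous_intros) auto
    from integral_continuous_on_param[OF this] show ?thesis by (simp add: H_def[abs_def])
  qed
  have H_ge: "H r \<ge> \<kappa>" if "r \<in> {0..b}" for r
  proof -
    have *: "H r \<ge> \<kappa>" if "r \<in> {0<..<b}" for r
    proof -
      have "r\<^sup>2 \<le> b\<^sup>2" using that by (intro power_mono) auto
      then have "\<kappa> * r\<^sup>2 \<le> H r * r\<^sup>2" using q(3)[of "q - r\<^sup>2"] b H_eq[of r] by (simp add: mult.commute)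
      moreover have "r\<^sup>2 > 0" using that by simp
      ultimately show ?thesis by (simp only: mult_le_cancel_right_pos)
    qed
    have "r \<in> closure {0<..<b}" using that b by simp
    then show ?thesis
      by (rule continuous_ge_on_closure[rotated]) (use * continuous_on_subset[OF H_cont] in auto)
  qed
  \<comment> \<open>With this speed the correction takes away at most half of the steepness.\<close>
  define c where "c = sqrt (2 * \<kappa>) / (2 * b)"
  have c: "c > 0" using b q by (simp add: c_def)
  define \<nu> where "\<nu> r = sqrt (2 * H r) / 2 - c * r / 2" for r
  have \<nu>_cont: "continuous_on S \<nu>" for S
    unfolding \<nu>_def by (intro continuous_intros continuous_on_subset[OF H_cont]) auto
  have \<nu>_ge: "\<nu> r \<ge> sqrt (2 * \<kappa>) / 4" if "r \<in> {0..b}" for r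
  proof -
    have "sqrt (2 * \<kappa>) \<le> sqrt (2 * H r)" using H_ge[OF that] by simp
    moreover have "c * r \<le> c * b" using that c by simp
    moreover have "c * b = sqrt (2 * \<kappa>) / 2" using b by (simp add: c_def)
    ultimately show ?thesis unfolding \<nu>_def by linarith
  qed
  have k0: "sqrt (2 * \<kappa>) / 4 > 0" using q by simp
  have \<nu>_pos: "\<nu> r > 0" if "r \<in> {0..b}" for r using \<nu>_ge[OF that] k0 by linarith
  define X where "X r = integral {0..r} (\<lambda>r. 1 / \<nu> r)" for r
  have inv_cont: "continuous_on {0..b} (\<lambda>r. 1 / \<nu> r)"
  proof (intro continuous_intros \<nu>_cont ballI)
    show "\<nu> r \<noteq> 0" if "r \<in> {0..b}" for r using \<nu>_pos[OF that] by simp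
  qed
  have dX: "(X has_real_derivative 1 / \<nu> r) (at r within {0..b})" if "r \<in> {0..b}" for r
    unfolding X_def[abs_def] by (rule integral_has_real_derivative[OF inv_cont that])
  have X_cont: "continuous_on {0..b} X"
    unfolding continuous_on_eq_continuous_within using dX DERIV_continuous by blast
  have X0: "X 0 = 0" by (simp add: X_def)
  have X_mono: "X r < X s" if "0 \<le> r" "r < s" "s \<le> b" for r s
  proof (rule DERIV_pos_imp_increasing_open[OF that(2)])
    fix x assume x: "r < x" "x < s"
    have "at x within {0..b} = at x" using x that by (intro at_within_interior) (auto simp: interior_atLeastAtMost_real)
    then show "\<exists>y. DERIV X x :> y \<and> 0 < y" using dX[of x] \<nu>_pos[of x] x that by auto
  next
    show "continuous_on {r..s} X" by (rule continuous_on_subset[OF X_cont]) (use that in auto)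
  qed
  define len where "len = X b"
  have len0: "len > 0" using X_mono[of 0 b] X0 b by (simp add: len_def)
  have len_le: "len\<^sup>2 \<le> 8 * q / \<kappa>"
  proof -
    have "X b \<le> integral {0..b} (\<lambda>r. 4 / sqrt (2 * \<kappa>))"
      unfolding X_def
    proof (rule integral_le)
      show "1 / \<nu> r \<le> 4 / sqrt (2 * \<kappa>)" if "r \<in> {0..b}" for r
        using \<nu>_ge[OF that] \<nu>_pos[OF that] k0 by (simp add: field_simps)
    qed (auto intro!: integrable_continuous_interval inv_cont)
    also have "\<dots> = 4 / sqrt (2 * \<kappa>) * b" using b by simp
    finally have "len\<^sup>2 \<le> (4 / sqrt (2 * \<kappa>) * b)\<^sup>2" using len0 by (intro power_mono) (auto simp: len_def)
    also have "\<dots> = 8 * q / \<kappa>" using b q by (simp add: power_mult_distrib power_divide)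
    finally show ?thesis .
  qed
  have X_inj: "inj_on X {0..b}"
    by (rule linorder_inj_onI') (use X_mono in \<open>force+\<close>)
  have X_im: "X ` {0..b} = {0..len}"
  proof
    show "X ` {0..b} \<subseteq> {0..len}"
      using X_mono X0 unfolding len_def by (force simp: le_less)
    show "{0..len} \<subseteq> X ` {0..b}"
    proof
      fix y assume "y \<in> {0..len}"
      then show "y \<in> X ` {0..b}"
        using IVT'[of X 0 y b] X_cont X0 b by (auto simp: len_def)
    qed
  qed
  define \<rho> where "\<rho> = the_inv_into {0..b} X"
  have \<rho>X: "\<rho> (X r) = r" if "r \<in> {0..b}" for r
    unfolding \<rho>_def by (rule the_inv_into_f_f[OF X_inj that])
  have X\<rho>: "X (\<rho> x) = x" "\<rho> x \<in> {0..b}" if "x \<in> {0..len}" for x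
    using that f_the_inv_into_f[OF X_inj] the_inv_into_into[OF X_inj, of x "{0..b}"] X_im by (auto simp: \<rho>_def)
  have \<rho>_cont: "continuous_on {0..len} \<rho>"
    using continuous_on_inv[OF X_cont compact_Icc, of \<rho>] \<rho>X X_im by simp
  have \<rho>0: "\<rho> 0 = 0" "\<rho> len = b" using \<rho>X[of 0] \<rho>X[of b] X0 b by (auto simp: len_def)
  have \<rho>_int: "\<rho> x \<in> {0<..<b}" if "0 < x" "x < len" for x
  proof -
    have "\<rho> x \<noteq> 0" "\<rho> x \<noteq> b" using X\<rho>(1)[of x] that X0 by (auto simp: len_def)
    then show ?thesis using X\<rho>(2)[of x] that by auto
  qed
  have d\<rho>: "(\<rho> has_real_derivative \<nu> (\<rho> x)) (at x)" if x: "0 < x" "x < len" for x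
  proof -
    have "(\<rho> has_real_derivative inverse (1 / \<nu> (\<rho> x))) (at x)"
    proof (rule DERIV_inverse_function[OF _ _ x])
      have "at (\<rho> x) within {0..b} = at (\<rho> x)" using \<rho>_int[OF x] by (intro at_within_interior) (auto simp: interior_atLeastAtMost_real)
      then show "DERIV X (\<rho> x) :> 1 / \<nu> (\<rho> x)" using dX[of "\<rho> x"] \<rho>_int[OF x] by simp
      show "1 / \<nu> (\<rho> x) \<noteq> 0" using \<nu>_pos[of "\<rho> x"] \<rho>_int[OF x] by simp
      show "X (\<rho> y) = y" if "0 < y" "y < len" for y using X\<rho> that by auto
      show "isCont \<rho> x" by (rule continuous_on_interior[OF \<rho>_cont]) (use x in \<open>auto simp: interior_atLeastAtMost_real\<close>)
    qed
    then show ?thesis by simp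
  qed
  define w where "w x = q - (\<rho> x)\<^sup>2" for x
  define S where "S x = sqrt (2 * (G q - G (w x)))" for x
  define w1 where "w1 x = - (S x - c * (q - w x))" for x
  define w2 where "w2 x = (F (w x) / S x - c) * w1 x" for x
  have w_cont: "continuous_on {0..len} w" unfolding w_def by (intro continuous_intros \<rho>_cont)
  have w_range: "0 \<le> w x \<and> w x \<le> q" if "x \<in> {0..len}" for x
    using X\<rho>(2)[OF that] b power_mono[of "\<rho> x" b 2] by (simp add: w_def)
  have w1_eq: "w1 x = - (2 * \<rho> x * \<nu> (\<rho> x))" if "x \<in> {0..len}" for x
  proof -
    have r: "\<rho> x \<ge> 0" using X\<rho>(2)[OF that] by simp
    have "S x = sqrt ((\<rho> x)\<^sup>2 * (2 * H (\<rho> x)))" using H_eq[of "\<rho> x"] by (simp add: S_def w_def)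
    also have "\<dots> = \<rho> x * sqrt (2 * H (\<rho> x))" using r by (simp add: real_sqrt_mult)
    finally show ?thesis by (simp add: w1_def w_def \<nu>_def power2_eq_square algebra_simps)
  qed
  have dw: "(w has_real_derivative w1 x) (at x)" if x: "0 < x" "x < len" for x
  proof -
    have "(w has_real_derivative - (2 * \<rho> x * \<nu> (\<rho> x))) (at x)"
      unfolding w_def[abs_def] by (auto intro!: derivative_eq_intros d\<rho>[OF x])
    then show ?thesis using w1_eq[of x] x by simp
  qed
  have Spos: "S x > 0" if x: "0 < x" "x < len" for x
  proof -
    have "(\<rho> x)\<^sup>2 * H (\<rho> x) > 0" using H_ge[of "\<rho> x"] \<rho>_int[OF x] q by simp
    then show ?thesis using H_eq[of "\<rho> x"] by (simp add: S_def w_def)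
  qed
  have dw1: "(w1 has_real_derivative w2 x) (at x)" if x: "0 < x" "x < len" for x
  proof -
    have pos: "2 * (G q - G (w x)) > 0" using Spos[OF x] by (simp add: S_def)
    have "((\<lambda>x. 2 * (G q - G (w x))) has_real_derivative - (2 * (F (w x) * w1 x))) (at x)"
      by (auto intro!: derivative_eq_intros DERIV_chain2[OF G dw[OF x]])
    from DERIV_chain2[OF DERIV_real_sqrt[OF pos] this]
    have "(S has_real_derivative inverse (S x) / 2 * - (2 * (F (w x) * w1 x))) (at x)"
      unfolding S_def[abs_def] by simp
    then have "(S has_real_derivative - (F (w x) * w1 x) / S x) (at x)" by (simp add: field_simps)
    then have "(w1 has_real_derivative - (- (F (w x) * w1 x) / S x - c * (0 - w1 x))) (at x)"
      unfolding w1_def[abs_def]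
      by (intro DERIV_minus DERIV_diff DERIV_cmult DERIV_const dw[OF x, unfolded w1_def])
    then show ?thesis by (simp add: w2_def algebra_simps)
  qed
  show ?thesis
  proof (rule that[OF c len0 len_le _ _ _ w_cont _ w_range dw dw1])
    show "w 0 = q" "w len = 0" "w1 0 = 0" using \<rho>0 b by (auto simp: w_def w1_def S_def)
    show "continuous_on {0..len} w1"
      unfolding w1_def S_def by (intro continuous_intros w_cont continuous_on_compose2[OF G_cont[of UNIV] w_cont]) auto
    show "w2 x + c * w1 x + F (w x) \<ge> 0" if x: "0 < x" "x < len" for x
    proof -
      have "w2 x + c * w1 x + F (w x) = F (w x) / S x * (c * (q - w x))"
        using Spos[OF x] by (simp add: w2_def w1_def field_simps)
      also have "\<dots> \<ge> 0" using Spos[OF x] F(2)[of "w x"] w_range[of x] c x by simp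
      finally show ?thesis .
    qed
  qed auto
qed

context monostable_solution
begin

definition G :: "real \<Rightarrow> real" where "G s = integral {0..s} F"

lemma G_derivative: "(G has_real_derivative F s) (at s)"
  unfolding G_def[abs_def]
  by (rule primitive_of_right_supported_derivative) (use F_continuous F_nonpos in auto)

lemma G_continuous: "continuous_on S G"
  using G_derivative by (auto intro!: continuous_at_imp_continuous_on DERIV_isCont)

lemma G_zero: "G 0 = 0" by (simp add: G_def)

lemma F_linear_bound: "\<bar>F s\<bar> \<le> L * \<bar>s\<bar>"
  using lipschitz[of s 0] F_nonpos[of 0] by simp

text \<open>
  As \<open>F\<close> vanishes at zero, \<open>G\<close> is Lipschitz with a constant proportional to the size of its arguments; this
  makes the potential part of the energy continuous in \<open>L\<^sup>2\<close>.
\<close>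

lemma G_difference: "\<bar>G a - G b\<bar> \<le> L * ((\<bar>a\<bar> + \<bar>b\<bar>) * \<bar>a - b\<bar>)"
proof -
  have *: "\<bar>G a - G b\<bar> \<le> L * ((\<bar>a\<bar> + \<bar>b\<bar>) * \<bar>a - b\<bar>)" if ba: "b < a" for a b
  proof -
    obtain z where z: "b < z" "z < a" "G a - G b = (a - b) * F z"
      using MVT2[OF ba, of G F] G_derivative by blast
    have "\<bar>F z\<bar> \<le> L * (\<bar>a\<bar> + \<bar>b\<bar>)"
      by (rule order_trans[OF F_linear_bound]) (use z L_nonneg in \<open>auto intro!: mult_left_mono\<close>)
    then have "\<bar>a - b\<bar> * \<bar>F z\<bar> \<le> \<bar>a - b\<bar> * (L * (\<bar>a\<bar> + \<bar>b\<bar>))" by (intro mult_left_mono) auto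
    then show ?thesis using z(3) by (simp add: abs_mult mult_ac)
  qed
  show ?thesis
    using *[of a b] *[of b a] by (cases a b rule: linorder_cases) (auto simp: abs_minus_commute add.commute)
qed

lemma G_quadratic: "\<bar>G s\<bar> \<le> L * s\<^sup>2"
  using G_difference[of s 0] by (simp add: G_zero power2_eq_square)

text \<open>
  The profile is compared with \<open>u\<close> to the right of the moving point \<open>c (t - t1)\<close>. At that point \<open>u\<close> is
  decreasing and the profile has slope zero, so the slopes agree even if their difference is maximal there; to the left,
  monotonicity of \<open>u\<close> replaces the comparison. Multiplying the difference by \<open>exp (- K t)\<close> with \<open>K > L\<close>
  turns the inequality at a positive maximum into a strict one.
\<close>

lemma spreading_from_plateau:
  assumes q: "0 < q" "q < 1" "\<kappa> > 0" "\<And>s. 0 \<le> s \<Longrightarrow> s \<le> q \<Longrightarrow> \<kappa> * (q - s) \<le> G q - G s"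
    and t1: "t1 > 0" and init: "q \<le> u (sqrt (8 * q / \<kappa>)) t1"
  shows "\<exists>c>0. \<forall>t\<ge>t1. \<forall>x. \<bar>x\<bar> \<le> c * (t - t1) \<longrightarrow> q \<le> u x t"
proof -
  have Fnn: "F s \<ge> 0" if "0 \<le> s" "s \<le> q" for s using F_nonneg[of s] that q by simp
  obtain c len w w1 w2 where P: "c > 0" "len > 0" "len\<^sup>2 \<le> 8 * q / \<kappa>" "w 0 = q" "w len = 0" "w1 0 = 0"
    "continuous_on {0..len} w" "continuous_on {0..len} w1" "\<And>x. x \<in> {0..len} \<Longrightarrow> 0 \<le> w x \<and> w x \<le> q"
    "\<And>x. 0 < x \<Longrightarrow> x < len \<Longrightarrow> (w has_real_derivative w1 x) (at x)"
    "\<And>x. 0 < x \<Longrightarrow> x < len \<Longrightarrow> (w1 has_real_derivative w2 x) (at x)"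
    "\<And>x. 0 < x \<Longrightarrow> x < len \<Longrightarrow> w2 x + c * w1 x + F (w x) \<ge> 0"
    using travelling_profile[OF F_continuous Fnn G_derivative q(1,3,4)] by blast
  define K where "K = L + 1"
  have "q \<le> u (c * (t2 - t1)) t2" if t2: "t2 \<ge> t1" for t2
  proof (rule ccontr)
    assume neg: "\<not> q \<le> u (c * (t2 - t1)) t2"
    define D where "D x s = exp (- K * (s - t1)) * (w x - u (x + c * (s - t1)) s)" for x s
    have cD: "continuous_on ({0..len} \<times> {t1..t2}) (\<lambda>(x, s). D x s)"
      unfolding D_def case_prod_beta
      by (intro continuous_intros strip_continuous_compose[OF D(4)] continuous_on_compose2[OF P(7)])
        (use t1 in auto)
    obtain x t where xt: "x \<in> {0..len}" "t1 < t" "t \<le> t2" "D x t > 0"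
      and mx: "\<And>y s. y \<in> {0..len} \<Longrightarrow> s \<in> {t1..t2} \<Longrightarrow> D y s \<le> D x t"
      and dt: "\<And>d. ((\<lambda>s. D x s) has_real_derivative d) (at t) \<Longrightarrow> d \<ge> 0"
    proof (rule parabolic_maximum_point[OF cD, of 0 t2])
      show "D x t1 \<le> 0" if x: "x \<in> {0..len}" for x
      proof -
        have "len \<le> sqrt (8 * q / \<kappa>)" using P(2,3) real_le_rsqrt by blast
        then have "u (sqrt (8 * q / \<kappa>)) t1 \<le> u x t1" using x t1 by (intro decreasing) auto
        then show ?thesis using P(9)[OF x] init by (simp add: D_def)
      qed
      show "0 < D 0 t2" using neg P(4) by (simp add: D_def)
    qed (use P t2 in auto)
    have t: "t > 0" using xt t1 by simp
    define z where "z = c * (t - t1)"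
    have z: "z \<ge> 0" using P xt by (simp add: z_def)
    define k where "k y = w y - u (y + z) t" for y
    define k1 where "k1 y = w1 y - ux (y + z) t" for y
    have kpos: "k x > 0" using xt(4) by (simp add: D_def k_def z_def zero_less_mult_iff)
    have kmax: "k y \<le> k x" if "y \<in> {0..len}" for y
      using mx[OF that, of t] xt by (simp add: D_def k_def z_def)
    have xlen: "x < len"
    proof -
      have "k len \<le> 0" using bounds(1)[OF t] P(5) by (simp add: k_def)
      then have "x \<noteq> len" using kpos by auto
      then show ?thesis using xt by auto
    qed
    have shift: "((\<lambda>y. y + z) has_real_derivative 1) (at y)" for y by (auto intro!: derivative_eq_intros)
    have dk: "(k has_real_derivative k1 y) (at y)" if "0 < y" "y < len" for y
      unfolding k_def[abs_def] k1_def
      using DERIV_diff[OF P(10)[OF that] DERIV_chain2[OF D(1)[OF t] shift]] by simp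
    have dk1: "(k1 has_real_derivative w2 y - uxx (y + z) t) (at y)" if "0 < y" "y < len" for y
      unfolding k1_def[abs_def]
      using DERIV_diff[OF P(11)[OF that] DERIV_chain2[OF D(2)[OF t] shift]] by simp
    have ck: "continuous_on {0..len} k" and ck1: "continuous_on {0..len} k1"
      unfolding k_def k1_def
      by (intro continuous_intros P(7,8) strip_continuous_compose[OF D(4)] strip_continuous_compose[OF D(5)]; use t in simp)+
    have k1x: "k1 x = 0"
    proof (cases "x = 0")
      case False
      then show ?thesis
        by (intro DERIV_local_max[OF dk, of x "min x (len - x)"] allI impI kmax) (use xt xlen in auto)
    next
      case True
      have ge: "k1 0 \<ge> 0"
      proof -
        have "ux z t \<le> 0"
        proof (rule ccontr)
          assume "\<not> ux z t \<le> 0"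
          then obtain e where e: "e > 0" "\<And>h. 0 < h \<Longrightarrow> h < e \<Longrightarrow> u z t < u (z + h) t"
            using DERIV_pos_inc_right[OF D(1)[OF t, of z UNIV]] by auto
          then show False using decreasing[OF t z, of "z + e / 2"] e(1) e(2)[of "e / 2"] by linarith
        qed
        then show ?thesis using P(6) by (simp add: k1_def)
      qed
      have "\<not> k1 0 > 0"
      proof
        assume pos: "k1 0 > 0"
        have "continuous (at 0 within {0..len}) k1" using ck1 P(2) by (simp add: continuous_on_eq_continuous_within)
        then have "\<forall>\<^sub>F y in at 0 within {0..len}. k1 y > 0"
          using pos by (intro order_tendstoD(1)) (auto simp: continuous_within)
        then obtain d where d: "d > 0" "\<And>y. y \<in> {0..len} \<Longrightarrow> y \<noteq> 0 \<Longrightarrow> dist y 0 < d \<Longrightarrow> k1 y > 0"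
          unfolding eventually_at by auto
        define r where "r = min (d / 2) (len / 2)"
        have r: "0 < r" "r < d" "r < len" using d P(2) by (auto simp: r_def)
        have "k 0 < k r"
        proof (rule DERIV_pos_imp_increasing_open[of 0 r k])
          show "\<exists>y'. DERIV k y :> y' \<and> 0 < y'" if "0 < y" "y < r" for y
            using dk[of y] d(2)[of y] that r by auto
          show "continuous_on {0..r} k" by (rule continuous_on_subset[OF ck]) (use r in auto)
        qed (use r in simp)
        then show False using kmax[of r] True r by simp
      qed
      then show ?thesis using ge True by simp
    qed
    define A where "A y = uxx (y + z) t + c * w1 y + F (w y)" for y
    \<comment> \<open>\<open>A\<close> bounds the second derivative of \<open>u - w\<close> from above; if it were negative at \<open>x\<close>, then \<open>w - u\<close> would be strictly convex to the right of its maximum.\<close>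
    have "A x \<ge> 0"
    proof (rule ccontr)
      assume neg: "\<not> A x \<ge> 0"
      have cA: "continuous_on {0..len} A"
        unfolding A_def
        by (intro continuous_intros P(8) strip_continuous_compose[OF D(6)] continuous_on_compose2[OF F_continuous P(7), of UNIV])
          (use t in auto)
      then have "continuous (at x within {0..len}) A" using xt by (simp add: continuous_on_eq_continuous_within)
      then have "\<forall>\<^sub>F y in at x within {0..len}. A y < 0"
        using neg by (intro order_tendstoD(2)) (auto simp: continuous_within)
      then obtain d where d: "d > 0" "\<And>y. y \<in> {0..len} \<Longrightarrow> y \<noteq> x \<Longrightarrow> dist y x < d \<Longrightarrow> A y < 0"
        unfolding eventually_at by auto
      define r where "r = min d (len - x)"
      have r: "r > 0" "x + r \<le> len" "r \<le> d" using d xlen by (auto simp: r_def)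
      show False
      proof (rule right_maximum_no_strict_convexity[OF r(1), of x k k1 "\<lambda>y. w2 y - uxx (y + z) t"])
        show "k y \<le> k x" if "x \<le> y" "y < x + r" for y using kmax[of y] that r xt by simp
        show "continuous_on {x..<x + r} k" "continuous_on {x..<x + r} k1"
          by (rule continuous_on_subset[OF ck] continuous_on_subset[OF ck1]; use r xt in auto)+
        fix y assume y: "x < y" "y < x + r"
        then have y': "0 < y" "y < len" using xt r by auto
        show "(k has_real_derivative k1 y) (at y)" "(k1 has_real_derivative w2 y - uxx (y + z) t) (at y)"
          using dk dk1 y' by auto
        have "A y < 0" using d(2)[of y] y y' r by (simp add: dist_real_def)
        then show "w2 y - uxx (y + z) t > 0" using P(12)[OF y'] by (simp add: A_def)
      qed (rule k1x)
    qed
    then have "ut (x + z) t + c * ux (x + z) t \<ge> F (u (x + z) t) - F (w x)"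
      using pde[OF t, of "x + z"] k1x by (simp add: A_def k1_def)
    moreover have "F (u (x + z) t) - F (w x) \<ge> - (L * k x)"
      using lipschitz[of "u (x + z) t" "w x"] kpos by (simp add: k_def abs_if split: if_splits)
    moreover have "exp (- K * (t - t1)) * (- K * k x - c * ux (x + z) t - ut (x + z) t) \<ge> 0"
    proof (rule dt)
      have "((\<lambda>s. u (x + c * (s - t1)) s) has_real_derivative (c * ux (x + z) t + ut (x + z) t)) (at t)"
      proof -
        have "((\<lambda>s. x + c * (s - t1)) has_real_derivative c) (at t)" by (auto intro!: derivative_eq_intros)
        from classical_along_curve[OF cl t this] show ?thesis by (simp add: z_def mult.commute)
      qed
      then show "((\<lambda>s. D x s) has_real_derivative exp (- K * (t - t1)) * (- K * k x - c * ux (x + z) t - ut (x + z) t)) (at t)"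
        unfolding D_def
        by (auto intro!: derivative_eq_intros simp: k_def z_def algebra_simps)
    qed
    then have "- K * k x - c * ux (x + z) t - ut (x + z) t \<ge> 0" by (simp add: zero_le_mult_iff)
    ultimately show False using kpos by (simp add: K_def algebra_simps)
  qed
  note edge = this
  have "q \<le> u x t" if t: "t \<ge> t1" and x: "\<bar>x\<bar> \<le> c * (t - t1)" for x t
  proof -
    have "u (c * (t - t1)) t \<le> u x t" by (rule decreasing_abs) (use t x t1 in auto)
    then show ?thesis using edge[OF t] by simp
  qed
  then show ?thesis using P(1) by blast
qed

end

section \<open>Dissipation of the energy\<close>

text \<open>
  The square of \<open>cutoff1\<close> is at most \<open>16 / R\<^sup>2\<close> times \<open>cutoff\<close>.
\<close>

lemma cutoff1_cross_term:
  assumes "R > 0" "\<bar>x - a\<bar> \<le> R"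
  shows "- (cutoff1 a R x * p * q) \<le> cutoff a R x * q\<^sup>2 / 2 + 8 / R\<^sup>2 * p\<^sup>2"
proof -
  define y where "y = (x - a) / R"
  define s where "s = 1 - y\<^sup>2"
  have y: "y\<^sup>2 \<le> 1" using assms by (simp add: y_def abs_square_le_1)
  have b: "cutoff a R x = s\<^sup>2" "cutoff1 a R x = - 4 * y / R * s"
    using assms by (simp_all add: cutoff_def cutoff1_def s_def y_def power2_eq_square)
  have "0 \<le> (s * q - 4 * y / R * p)\<^sup>2" by simp
  moreover have "(s * q - 4 * y / R * p)\<^sup>2 = 2 * (s\<^sup>2 * q\<^sup>2 / 2 + 8 * y\<^sup>2 / R\<^sup>2 * p\<^sup>2 - 4 * y / R * s * p * q)"
    by (simp add: power2_eq_square algebra_simps)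
  moreover have "0 \<le> 2 * (a - b) \<Longrightarrow> b \<le> a" for a b :: real by simp
  ultimately have "4 * y / R * s * p * q \<le> s\<^sup>2 * q\<^sup>2 / 2 + 8 * y\<^sup>2 / R\<^sup>2 * p\<^sup>2"
    by metis
  moreover have "8 / R\<^sup>2 * p\<^sup>2 * y\<^sup>2 \<le> 8 / R\<^sup>2 * p\<^sup>2 * 1"
    using y by (intro mult_left_mono) auto
  ultimately show ?thesis by (simp add: b mult_ac)
qed

text \<open>
  The mixed derivative of \<open>w\<close> in \<open>x\<close> and \<open>t\<close> need not exist. The difference of the integrals at two
  times is therefore integrated by parts first, which leaves only an increment of \<open>w\<close> in time.
\<close>

lemma weighted_gradient_square_derivative:
  assumes w: "classical w wx wxx wt" and t: "t > 0"
    and d\<rho>: "\<And>x. (\<rho> has_real_derivative \<rho>1 x) (at x)" "continuous_on UNIV \<rho>1"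
    and bdry: "\<rho> \<alpha> = 0" "\<rho> \<beta> = 0" and ab: "\<alpha> \<le> \<beta>"
  shows "((\<lambda>s. integral {\<alpha>..\<beta>} (\<lambda>x. \<rho> x * ((wx x s)\<^sup>2 / 2))) has_real_derivative
    - integral {\<alpha>..\<beta>} (\<lambda>x. (\<rho>1 x * wx x t + \<rho> x * wxx x t) * wt x t)) (at t)"
proof -
  note D = classicalD[OF w]
  have c\<rho>: "continuous_on UNIV \<rho>" using d\<rho>(1) by (auto intro!: continuous_at_imp_continuous_on DERIV_isCont)
  note cc = continuous_on_compose2[OF c\<rho>] continuous_on_compose2[OF d\<rho>(2)]
    strip_continuous_compose[OF D(4)] strip_continuous_compose[OF D(5)] strip_continuous_compose[OF D(6)] strip_continuous_compose[OF D(7)]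
  \<comment> \<open>The difference quotient of \<open>w\<close> in time, in a form that is jointly continuous also at \<open>s = t\<close>.\<close>
  define Q where "Q x s = integral {0..1} (\<lambda>\<theta>. wt x (t + \<theta> * (s - t)))" for x s
  have seg: "t + \<theta> * (s - t) > 0" if "\<theta> \<in> {0..1}" "s > 0" for \<theta> s
  proof -
    have "t + \<theta> * (s - t) = (1 - \<theta>) * t + \<theta> * s" by (simp add: algebra_simps)
    moreover have "0 \<le> (1 - \<theta>) * t" "0 \<le> \<theta> * s" using that t by auto
    moreover have "(1 - \<theta>) * t \<noteq> 0 \<or> \<theta> * s \<noteq> 0" using that t by auto
    ultimately show ?thesis by linarith
  qed
  have Q_cont: "continuous_on ({0<..} \<times> UNIV) (\<lambda>(s, x). Q x s)"
  proof -
    have "continuous_on (({0<..} \<times> UNIV) \<times> cbox 0 1) (\<lambda>(p, \<theta>). wt (snd p) (t + \<theta> * (fst p - t)))"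
      unfolding case_prod_beta by (intro continuous_intros cc) (use seg in auto)
    from integral_continuous_on_param[OF this] show ?thesis by (simp add: Q_def case_prod_beta)
  qed
  have Q: "w x s - w x t = (s - t) * Q x s" if s: "s > 0" for x s
  proof -
    have "((\<lambda>\<theta>. (s - t) * wt x (t + \<theta> * (s - t))) has_integral (w x (t + 1 * (s - t)) - w x (t + 0 * (s - t)))) {0..1}"
    proof (rule fundamental_theorem_of_calculus)
      fix \<theta> :: real assume \<theta>: "\<theta> \<in> {0..1}"
      have "((\<lambda>\<theta>. t + \<theta> * (s - t)) has_real_derivative (s - t)) (at \<theta>)"
        by (auto intro!: derivative_eq_intros)
      from DERIV_chain2[OF D(3)[OF seg[OF \<theta> s]] this]
      have "((\<lambda>\<theta>. w x (t + \<theta> * (s - t))) has_real_derivative (s - t) * wt x (t + \<theta> * (s - t))) (at \<theta>)"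
        by (simp add: mult.commute)
      then show "((\<lambda>\<theta>. w x (t + \<theta> * (s - t))) has_vector_derivative (s - t) * wt x (t + \<theta> * (s - t))) (at \<theta> within {0..1})"
        by (simp add: has_real_derivative_iff_has_vector_derivative[symmetric] has_field_derivative_at_within)
    qed simp
    from integral_unique[OF this] show ?thesis by (simp add: Q_def)
  qed
  have Qt: "Q x t = wt x t" for x by (simp add: Q_def)
  define B where "B s = integral {\<alpha>..\<beta>} (\<lambda>x. \<rho> x * ((wx x s)\<^sup>2 / 2))" for s
  define \<Phi> where "\<Phi> s = integral {\<alpha>..\<beta>} (\<lambda>x. - ((\<rho>1 x * (wx x s + wx x t) + \<rho> x * (wxx x s + wxx x t)) * Q x s / 2))" for s
  have Qc: "continuous_on S (\<lambda>x. Q x s)" if "s > 0" for S s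
  proof -
    have "continuous_on S (\<lambda>x. (\<lambda>(s, x). Q x s) (s, x))"
      by (rule continuous_on_compose2[OF Q_cont]) (use that in \<open>auto intro!: continuous_intros\<close>)
    then show ?thesis by simp
  qed
  have \<Phi>_cont: "continuous_on {0<..} \<Phi>"
  proof -
    have Qc2: "continuous_on ({0<..} \<times> cbox \<alpha> \<beta>) (\<lambda>p. Q (snd p) (fst p))"
      by (rule continuous_on_subset[OF Q_cont[unfolded case_prod_beta]]) auto
    have "continuous_on ({0<..} \<times> cbox \<alpha> \<beta>) (\<lambda>(s, x). - ((\<rho>1 x * (wx x s + wx x t) + \<rho> x * (wxx x s + wxx x t)) * Q x s / 2))"
      unfolding case_prod_beta by (intro continuous_intros cc Qc2) (use t in auto)
    from integral_continuous_on_param[OF this] show ?thesis by (simp add: \<Phi>_def[abs_def])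
  qed
  have diff: "B s - B t = (s - t) * \<Phi> s" if s: "s > 0" for s
  proof -
    let ?p = "\<lambda>x. \<rho> x * (wx x s + wx x t)"
    let ?p' = "\<lambda>x. \<rho>1 x * (wx x s + wx x t) + \<rho> x * (wxx x s + wxx x t)"
    have dp: "((\<lambda>x. ?p x * (w x s - w x t)) has_real_derivative
        ?p' x * (w x s - w x t) + ?p x * (wx x s - wx x t)) (at x within {\<alpha>..\<beta>})" for x
    proof -
      have "(\<rho> has_real_derivative \<rho>1 x) (at x within {\<alpha>..\<beta>})" using d\<rho>(1) has_field_derivative_at_within by blast
      from DERIV_mult[OF DERIV_mult[OF this DERIV_add[OF D(2)[OF s] D(2)[OF t]]] DERIV_diff[OF D(1)[OF s] D(1)[OF t]]]
      show ?thesis by (simp add: algebra_simps)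
    qed
    have "((\<lambda>x. ?p' x * (w x s - w x t) + ?p x * (wx x s - wx x t)) has_integral (?p \<beta> * (w \<beta> s - w \<beta> t) - ?p \<alpha> * (w \<alpha> s - w \<alpha> t))) {\<alpha>..\<beta>}"
      using dp by (intro fundamental_theorem_of_calculus ab) (simp add: has_real_derivative_iff_has_vector_derivative[symmetric])
    then have hz: "((\<lambda>x. ?p' x * (w x s - w x t) + ?p x * (wx x s - wx x t)) has_integral 0) {\<alpha>..\<beta>}"
      using bdry by simp
    have i: "h integrable_on {\<alpha>..\<beta>}" if "continuous_on {\<alpha>..\<beta>} h" for h :: "real \<Rightarrow> real"
      using that integrable_continuous_interval by blast
    have "B s - B t = integral {\<alpha>..\<beta>} (\<lambda>x. \<rho> x * ((wx x s)\<^sup>2 / 2) - \<rho> x * ((wx x t)\<^sup>2 / 2))"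
      unfolding B_def
      by (rule integral_diff[symmetric]) (auto intro!: i continuous_intros cc simp: s t)
    also have "\<dots> = integral {\<alpha>..\<beta>} (\<lambda>x. (?p' x * (w x s - w x t) + ?p x * (wx x s - wx x t)) / 2 - ?p' x * (w x s - w x t) / 2)"
      by (rule arg_cong[where f = "integral {\<alpha>..\<beta>}"]) (simp add: fun_eq_iff power2_eq_square field_simps)
    also have "\<dots> = integral {\<alpha>..\<beta>} (\<lambda>x. (?p' x * (w x s - w x t) + ?p x * (wx x s - wx x t)) / 2) - integral {\<alpha>..\<beta>} (\<lambda>x. ?p' x * (w x s - w x t) / 2)"
      by (rule integral_diff) (auto intro!: i continuous_intros cc simp: s t)
    also have "integral {\<alpha>..\<beta>} (\<lambda>x. (?p' x * (w x s - w x t) + ?p x * (wx x s - wx x t)) / 2) = 0"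
      using integral_unique[OF hz] by simp
    also have "integral {\<alpha>..\<beta>} (\<lambda>x. ?p' x * (w x s - w x t) / 2) = integral {\<alpha>..\<beta>} (\<lambda>x. (s - t) * (?p' x * Q x s / 2))"
      by (rule arg_cong[where f = "integral {\<alpha>..\<beta>}"]) (simp add: fun_eq_iff Q[OF s])
    finally show ?thesis by (simp add: \<Phi>_def)
  qed
  have "isCont \<Phi> t"
    using \<Phi>_cont t by (simp add: continuous_on_eq_continuous_at)
  then have "(\<Phi> \<longlongrightarrow> \<Phi> t) (at t)" by (simp add: isCont_def)
  moreover have "\<forall>\<^sub>F s in at t. \<Phi> s = (B s - B t) / (s - t)"
  proof -
    have "\<forall>\<^sub>F s in at t. s \<in> {0<..} - {t}" using t eventually_at_in_open[of "{0<..}" t] by simp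
    then show ?thesis by eventually_elim (use diff in auto)
  qed
  ultimately have "((\<lambda>s. (B s - B t) / (s - t)) \<longlongrightarrow> \<Phi> t) (at t)" by (rule Lim_transform_eventually)
  then have "(B has_real_derivative \<Phi> t) (at t)" by (simp add: has_field_derivative_iff)
  moreover have "\<Phi> t = - integral {\<alpha>..\<beta>} (\<lambda>x. (\<rho>1 x * wx x t + \<rho> x * wxx x t) * wt x t)"
  proof -
    have "\<Phi> t = integral {\<alpha>..\<beta>} (\<lambda>x. - ((\<rho>1 x * wx x t + \<rho> x * wxx x t) * wt x t))"
      unfolding \<Phi>_def Qt by (rule arg_cong[where f = "integral {\<alpha>..\<beta>}"]) (simp add: fun_eq_iff algebra_simps)
    then show ?thesis by simp
  qed
  ultimately show ?thesis by (simp add: B_def[abs_def])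
qed

text \<open>
  The growth of the gradient bound in time is harmless: it only has to be finite on bounded time
  intervals, so that cutoff errors vanish.
\<close>

locale finite_energy_solution = monostable_solution +
  fixes J :: real
  assumes J: "J \<ge> 0"
    and gradient: "0 < t \<Longrightarrow> (\<integral>\<^sup>+x. ennreal ((ux x t)\<^sup>2) \<partial>lebesgue) \<le> ennreal (exp (2 * L * t) * J)"
    and square_integrable: "0 < t \<Longrightarrow> integrable lebesgue (\<lambda>x. (u x t)\<^sup>2)"
begin

definition energy_density :: "real \<Rightarrow> real \<Rightarrow> real" where
  "energy_density t x = (ux x t)\<^sup>2 / 2 - G (u x t)"

definition E :: "real \<Rightarrow> real" where
  "E t = (LINT x|lebesgue. energy_density t x)"

lemma gradient_integrable:
  assumes "0 < t"
  shows "integrable lebesgue (\<lambda>x. (ux x t)\<^sup>2)" "(LINT x|lebesgue. (ux x t)\<^sup>2) \<le> exp (2 * L * t) * J"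
proof -
  have m: "(\<lambda>x. (ux x t)\<^sup>2) \<in> borel_measurable lebesgue"
    by (intro continuous_lebesgue_measurable continuous_intros strip_continuous_compose[OF D(5)]) (use assms in auto)
  show i: "integrable lebesgue (\<lambda>x. (ux x t)\<^sup>2)"
    using gradient[OF assms] by (intro integrableI_nonneg m) (auto intro: le_less_trans)
  have "ennreal (LINT x|lebesgue. (ux x t)\<^sup>2) = (\<integral>\<^sup>+x. ennreal ((ux x t)\<^sup>2) \<partial>lebesgue)"
    using i by (intro nn_integral_eq_integral[symmetric]) auto
  also have "\<dots> \<le> ennreal (exp (2 * L * t) * J)" by (rule gradient[OF assms])
  finally show "(LINT x|lebesgue. (ux x t)\<^sup>2) \<le> exp (2 * L * t) * J"
    using J by (subst (asm) ennreal_le_iff) auto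
qed

lemma G_integrable:
  assumes "0 < t" shows "integrable lebesgue (\<lambda>x. G (u x t))"
proof (rule Bochner_Integration.integrable_bound)
  show "integrable lebesgue (\<lambda>x. L * (u x t)\<^sup>2)" using square_integrable[OF assms] by simp
  show "(\<lambda>x. G (u x t)) \<in> borel_measurable lebesgue"
    by (intro continuous_lebesgue_measurable continuous_on_compose2[OF G_continuous u_x_continuous[OF assms]]) auto
  show "AE x in lebesgue. norm (G (u x t)) \<le> norm (L * (u x t)\<^sup>2)"
    using G_quadratic by (intro AE_I2) (simp add: order_trans[OF _ abs_ge_self])
qed

lemma energy_density_integrable:
  assumes "0 < t" shows "integrable lebesgue (energy_density t)"
  unfolding energy_density_def[abs_def]
  using gradient_integrable(1)[OF assms] G_integrable[OF assms] by simp

definition E_loc :: "real \<Rightarrow> real \<Rightarrow> real" where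
  "E_loc R t = integral {- R..R} (\<lambda>x. cutoff 0 R x * energy_density t x)"

lemma energy_density_continuous: "0 < t \<Longrightarrow> continuous_on S (energy_density t)"
  unfolding energy_density_def[abs_def]
  by (intro continuous_intros strip_continuous_compose[OF D(5)] continuous_on_compose2[OF G_continuous u_x_continuous]) auto

lemma E_loc_tendsto:
  assumes t: "0 < t" shows "(\<lambda>n. E_loc (real (Suc n)) t) \<longlonglongrightarrow> E t"
proof -
  let ?f = "\<lambda>n x. indicator {- real (Suc n)..real (Suc n)} x * (cutoff 0 (real (Suc n)) x * energy_density t x)"
  have eq: "E_loc (real (Suc n)) t = (LINT x|lebesgue. ?f n x)" for n
  proof -
    have "(\<lambda>x. cutoff 0 (real (Suc n)) x * energy_density t x) absolutely_integrable_on {- real (Suc n)..real (Suc n)}"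
      by (intro absolutely_integrable_continuous_real continuous_intros energy_density_continuous t) auto
    from set_lebesgue_integral_eq_integral(2)[OF this]
    show ?thesis by (simp add: E_loc_def set_lebesgue_integral_def)
  qed
  have "(\<lambda>n. LINT x|lebesgue. ?f n x) \<longlonglongrightarrow> (LINT x|lebesgue. energy_density t x)"
  proof (rule integral_dominated_convergence)
    show "integrable lebesgue (\<lambda>x. norm (energy_density t x))"
      using energy_density_integrable[OF t] by simp
    show "energy_density t \<in> borel_measurable lebesgue" using energy_density_integrable[OF t] by simp
    show "(\<lambda>x. ?f n x) \<in> borel_measurable lebesgue" for n
      by (intro borel_measurable_times borel_measurable_indicator continuous_lebesgue_measurable continuous_intros energy_density_continuous t) auto
    show "AE x in lebesgue. (\<lambda>n. ?f n x) \<longlonglongrightarrow> energy_density t x"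
    proof (rule AE_I2)
      fix x
      have "(\<lambda>n. x / real (Suc n)) \<longlonglongrightarrow> 0"
        by (intro tendsto_divide_0[OF tendsto_const] filterlim_at_top_imp_at_infinity filterlim_compose[OF filterlim_real_sequentially filterlim_Suc])
      then have "(\<lambda>n. (1 - (x / real (Suc n))\<^sup>2)\<^sup>2 * energy_density t x) \<longlonglongrightarrow> (1 - 0\<^sup>2)\<^sup>2 * energy_density t x"
        by (intro tendsto_intros)
      moreover have "\<forall>\<^sub>F n in sequentially. (1 - (x / real (Suc n))\<^sup>2)\<^sup>2 * energy_density t x = ?f n x"
      proof -
        obtain N where "real N \<ge> \<bar>x\<bar>" using real_arch_simple by blast
        then show ?thesis by (auto simp: eventually_sequentially indicator_def cutoff_def intro!: exI[of _ N])
      qed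
      ultimately show "(\<lambda>n. ?f n x) \<longlonglongrightarrow> energy_density t x"
        using Lim_transform_eventually by fastforce
    qed
    show "AE x in lebesgue. norm (?f n x) \<le> norm (energy_density t x)" for n
    proof (rule AE_I2)
      fix x
      show "norm (?f n x) \<le> norm (energy_density t x)"
      proof (cases "x \<in> {- real (Suc n)..real (Suc n)}")
        case True
        then have "0 \<le> cutoff 0 (real (Suc n)) x" "cutoff 0 (real (Suc n)) x \<le> 1" by (auto intro!: cutoff_bounds)
        then show ?thesis by (simp add: abs_mult indicator_def mult_left_le_one_le)
      qed simp
    qed
  qed
  then show ?thesis unfolding eq E_def .
qed

lemma E_loc_derivative:
  assumes t: "0 < t" and R: "R > 0"
  shows "(E_loc R has_real_derivative
    integral {- R..R} (\<lambda>x. - (cutoff 0 R x * (ut x t)\<^sup>2) - cutoff1 0 R x * ux x t * ut x t)) (at t)"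
proof -
  note cc = strip_continuous_compose[OF D(4)] strip_continuous_compose[OF D(5)] strip_continuous_compose[OF D(6)] strip_continuous_compose[OF D(7)]
    continuous_on_compose2[OF G_continuous[of UNIV]] continuous_on_compose2[OF F_continuous[of UNIV]]
  have i: "h integrable_on {- R..R}" if "continuous_on {- R..R} h" for h :: "real \<Rightarrow> real"
    using that integrable_continuous_interval by blast
  have 1: "((\<lambda>s. integral {- R..R} (\<lambda>x. cutoff 0 R x * ((ux x s)\<^sup>2 / 2))) has_real_derivative
    - integral {- R..R} (\<lambda>x. (cutoff1 0 R x * ux x t + cutoff 0 R x * uxx x t) * ut x t)) (at t)"
  proof (rule weighted_gradient_square_derivative[OF cl t])
    show "cutoff 0 R (- R) = 0" "cutoff 0 R R = 0" using R by (simp_all add: cutoff_def)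
  qed (use R cutoff_derivatives in \<open>auto intro!: continuous_intros\<close>)
  have 2: "((\<lambda>s. integral {- R..R} (\<lambda>x. cutoff 0 R x * G (u x s))) has_real_derivative
    integral {- R..R} (\<lambda>x. cutoff 0 R x * (F (u x t) * ut x t))) (at t)"
  proof -
    have "((\<lambda>s. integral (cbox (- R) R) (\<lambda>x. cutoff 0 R x * G (u x s))) has_real_derivative
      integral (cbox (- R) R) (\<lambda>x. cutoff 0 R x * (F (u x t) * ut x t))) (at t within {0<..})"
    proof (rule leibniz_rule_field_derivative)
      fix s x :: real assume "s \<in> {0<..}"
      then show "((\<lambda>s. cutoff 0 R x * G (u x s)) has_real_derivative cutoff 0 R x * (F (u x s) * ut x s)) (at s within {0<..})"
        using DERIV_cmult[OF DERIV_chain2[OF G_derivative D(3)]] by auto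
    next
      fix s :: real assume "s \<in> {0<..}"
      then show "(\<lambda>x. cutoff 0 R x * G (u x s)) integrable_on cbox (- R) R"
        by (auto intro!: i continuous_intros cc R)
    next
      show "continuous_on ({0<..} \<times> cbox (- R) R) (\<lambda>(s, x). cutoff 0 R x * (F (u x s) * ut x s))"
        unfolding case_prod_beta by (intro continuous_intros cc R) auto
    qed (use t in auto)
    then show ?thesis using t at_within_open[of t "{0<..}"] by simp
  qed
  have eq: "E_loc R s = integral {- R..R} (\<lambda>x. cutoff 0 R x * ((ux x s)\<^sup>2 / 2)) - integral {- R..R} (\<lambda>x. cutoff 0 R x * G (u x s))"
    if "s > 0" for s
    unfolding E_loc_def energy_density_def right_diff_distrib
    by (rule integral_diff) (auto intro!: i continuous_intros cc R simp: that)
  have "((\<lambda>s. integral {- R..R} (\<lambda>x. cutoff 0 R x * ((ux x s)\<^sup>2 / 2)) - integral {- R..R} (\<lambda>x. cutoff 0 R x * G (u x s))) has_real_derivative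
     - integral {- R..R} (\<lambda>x. (cutoff1 0 R x * ux x t + cutoff 0 R x * uxx x t) * ut x t) - integral {- R..R} (\<lambda>x. cutoff 0 R x * (F (u x t) * ut x t))) (at t)"
    by (rule DERIV_diff[OF 1 2])
  also have "- integral {- R..R} (\<lambda>x. (cutoff1 0 R x * ux x t + cutoff 0 R x * uxx x t) * ut x t) - integral {- R..R} (\<lambda>x. cutoff 0 R x * (F (u x t) * ut x t))
     = integral {- R..R} (\<lambda>x. - ((cutoff1 0 R x * ux x t + cutoff 0 R x * uxx x t) * ut x t) - cutoff 0 R x * (F (u x t) * ut x t))"
    unfolding integral_neg[symmetric]
    by (rule integral_diff[symmetric]) (auto intro!: i continuous_intros cc R simp: t)
  also have "\<dots> = integral {- R..R} (\<lambda>x. - (cutoff 0 R x * (ut x t)\<^sup>2) - cutoff1 0 R x * ux x t * ut x t)"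
    by (rule arg_cong[where f = "integral {- R..R}"]) (simp add: fun_eq_iff pde[OF t] power2_eq_square algebra_simps)
  finally have d: "((\<lambda>s. integral {- R..R} (\<lambda>x. cutoff 0 R x * ((ux x s)\<^sup>2 / 2)) - integral {- R..R} (\<lambda>x. cutoff 0 R x * G (u x s))) has_real_derivative
     integral {- R..R} (\<lambda>x. - (cutoff 0 R x * (ut x t)\<^sup>2) - cutoff1 0 R x * ux x t * ut x t)) (at t)" .
  have "\<forall>\<^sub>F s in nhds t. s > 0" using t eventually_nhds_in_open[of "{0<..}" t] by simp
  then show ?thesis
    by (subst DERIV_cong_ev[OF refl _ refl]) (use d in \<open>auto elim!: eventually_mono simp: eq\<close>)
qed

text \<open>
  In the localised energy the weight produces the term \<open>cutoff1 * u\<^sub>x * u\<^sub>t\<close>. Half of the dissipation absorbs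
  it up to an error of order \<open>1 / R\<^sup>2\<close>; this is where the factor \<open>1 / 2\<close> comes from.
\<close>

lemma energy_dissipation:
  assumes s: "0 < s" "s \<le> t" and A: "A \<ge> 0" and \<eta>: "\<eta> \<ge> 0"
    and ge: "\<And>\<tau>. s \<le> \<tau> \<Longrightarrow> \<tau> \<le> t \<Longrightarrow> \<eta> \<le> integral {- A..A} (\<lambda>x. (ut x \<tau>)\<^sup>2)"
  shows "E t \<le> E s - \<eta> * (t - s) / 2"
proof -
  define C where "C R = - ((1 - (A / R)\<^sup>2)\<^sup>2 * \<eta> / 2) + 8 / R\<^sup>2 * (exp (2 * L * t) * J)" for R
  have loc: "E_loc R t \<le> E_loc R s + C R * (t - s)" if R: "R > A" for R
  proof -
    have R0: "R > 0" using R A by simp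
    have le: "integral {- R..R} (\<lambda>x. - (cutoff 0 R x * (ut x \<tau>)\<^sup>2) - cutoff1 0 R x * ux x \<tau> * ut x \<tau>) \<le> C R"
      if \<tau>: "s \<le> \<tau>" "\<tau> \<le> t" for \<tau>
    proof -
      have \<tau>0: "\<tau> > 0" using \<tau> s by simp
      note cc = strip_continuous_compose[OF D(5)] strip_continuous_compose[OF D(7)]
      have i: "h integrable_on {a..b}" if "continuous_on {a..b} h" for h :: "real \<Rightarrow> real" and a b
        using that integrable_continuous_interval by blast
      have "integral {- R..R} (\<lambda>x. - (cutoff 0 R x * (ut x \<tau>)\<^sup>2) - cutoff1 0 R x * ux x \<tau> * ut x \<tau>)
        \<le> integral {- R..R} (\<lambda>x. 8 / R\<^sup>2 * (ux x \<tau>)\<^sup>2 - cutoff 0 R x * (ut x \<tau>)\<^sup>2 / 2)"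
      proof (rule integral_le)
        fix x assume "x \<in> {- R..R}"
        then have "\<bar>x - 0\<bar> \<le> R" by auto
        from cutoff1_cross_term[OF R0 this, of "ux x \<tau>" "ut x \<tau>"]
        show "- (cutoff 0 R x * (ut x \<tau>)\<^sup>2) - cutoff1 0 R x * ux x \<tau> * ut x \<tau> \<le> 8 / R\<^sup>2 * (ux x \<tau>)\<^sup>2 - cutoff 0 R x * (ut x \<tau>)\<^sup>2 / 2"
          by linarith
      qed (use R0 \<tau>0 in \<open>auto intro!: i continuous_intros cc\<close>)
      also have "\<dots> = 8 / R\<^sup>2 * integral {- R..R} (\<lambda>x. (ux x \<tau>)\<^sup>2) - integral {- R..R} (\<lambda>x. cutoff 0 R x * (ut x \<tau>)\<^sup>2) / 2"
        by (subst integral_diff) (use R0 \<tau>0 in \<open>auto intro!: i continuous_intros cc\<close>)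
      also have "\<dots> \<le> C R"
      proof -
        have "integral {- R..R} (\<lambda>x. (ux x \<tau>)\<^sup>2) \<le> exp (2 * L * t) * J"
        proof -
          have ai: "(\<lambda>x. (ux x \<tau>)\<^sup>2) absolutely_integrable_on {- R..R}"
            by (intro absolutely_integrable_continuous_real continuous_intros cc) (simp_all add: \<tau>0)
          have "integral {- R..R} (\<lambda>x. (ux x \<tau>)\<^sup>2) = (LINT x|lebesgue. indicator {- R..R} x * (ux x \<tau>)\<^sup>2)"
            using set_lebesgue_integral_eq_integral(2)[OF ai] by (simp add: set_lebesgue_integral_def)
          also have "\<dots> \<le> (LINT x|lebesgue. (ux x \<tau>)\<^sup>2)"
            using ai gradient_integrable(1)[OF \<tau>0]
            by (intro Bochner_Integration.integral_mono) (auto simp: set_integrable_def indicator_def)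
          also have "\<dots> \<le> exp (2 * L * \<tau>) * J" by (rule gradient_integrable(2)[OF \<tau>0])
          also have "\<dots> \<le> exp (2 * L * t) * J"
            using \<tau> L_nonneg J by (intro mult_right_mono) (auto intro!: mult_left_mono)
          finally show ?thesis .
        qed
        moreover have "(1 - (A / R)\<^sup>2)\<^sup>2 * \<eta> \<le> integral {- R..R} (\<lambda>x. cutoff 0 R x * (ut x \<tau>)\<^sup>2)"
        proof -
          have "(1 - (A / R)\<^sup>2)\<^sup>2 * \<eta> \<le> (1 - (A / R)\<^sup>2)\<^sup>2 * integral {- A..A} (\<lambda>x. (ut x \<tau>)\<^sup>2)"
            by (intro mult_left_mono ge \<tau>) auto
          also have "\<dots> = integral {- A..A} (\<lambda>x. (1 - (A / R)\<^sup>2)\<^sup>2 * (ut x \<tau>)\<^sup>2)" by simp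
          also have "\<dots> \<le> integral {- A..A} (\<lambda>x. cutoff 0 R x * (ut x \<tau>)\<^sup>2)"
            by (intro integral_le i continuous_intros cc R0 mult_right_mono cutoff_ge) (use R R0 \<tau>0 in auto)
          also have "\<dots> \<le> integral {- R..R} (\<lambda>x. cutoff 0 R x * (ut x \<tau>)\<^sup>2)"
            by (intro integral_subset_le i continuous_intros cc R0) (use R R0 \<tau>0 in \<open>auto simp: cutoff_def\<close>)
          finally show ?thesis .
        qed
        moreover have "8 / R\<^sup>2 * integral {- R..R} (\<lambda>x. (ux x \<tau>)\<^sup>2) \<le> 8 / R\<^sup>2 * (exp (2 * L * t) * J)"
          by (intro mult_left_mono calculation(1)) auto
        ultimately show ?thesis unfolding C_def by linarith
      qed
      finally show ?thesis .
    qed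
    have "E_loc R t - C R * t \<le> E_loc R s - C R * s"
    proof (rule DERIV_nonpos_imp_nonincreasing[OF s(2), of "\<lambda>\<tau>. E_loc R \<tau> - C R * \<tau>"])
      fix \<tau> assume \<tau>: "s \<le> \<tau>" "\<tau> \<le> t"
      have "((\<lambda>\<tau>. E_loc R \<tau> - C R * \<tau>) has_real_derivative
         integral {- R..R} (\<lambda>x. - (cutoff 0 R x * (ut x \<tau>)\<^sup>2) - cutoff1 0 R x * ux x \<tau> * ut x \<tau>) - C R * 1) (at \<tau>)"
        by (intro DERIV_diff E_loc_derivative DERIV_cmult DERIV_ident) (use \<tau> s R0 in auto)
      then show "\<exists>y. ((\<lambda>\<tau>. E_loc R \<tau> - C R * \<tau>) has_real_derivative y) (at \<tau>) \<and> y \<le> 0"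
        using le[OF \<tau>] by force
    qed
    then show ?thesis by (simp add: algebra_simps)
  qed
  have inf: "filterlim (\<lambda>n. real (Suc n)) at_infinity sequentially"
    by (intro filterlim_at_top_imp_at_infinity filterlim_compose[OF filterlim_real_sequentially filterlim_Suc])
  have "(\<lambda>n. - ((1 - (A / real (Suc n))\<^sup>2)\<^sup>2 * \<eta> / 2) + 8 / (real (Suc n))\<^sup>2 * (exp (2 * L * t) * J))
     \<longlonglongrightarrow> - ((1 - 0\<^sup>2)\<^sup>2 * \<eta> / 2) + 0 * (exp (2 * L * t) * J)"
    by (intro tendsto_intros tendsto_divide_0[OF tendsto_const] inf) simp_all
  then have C: "(\<lambda>n. C (real (Suc n))) \<longlonglongrightarrow> - (\<eta> / 2)"
    by (simp add: C_def)
  have R1: "(\<lambda>n. E_loc (real (Suc n)) s + C (real (Suc n)) * (t - s)) \<longlonglongrightarrow> E s + - (\<eta> / 2) * (t - s)"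
    using s by (intro tendsto_intros C E_loc_tendsto)
  have L1: "(\<lambda>n. E_loc (real (Suc n)) t) \<longlonglongrightarrow> E t"
    using s by (intro E_loc_tendsto) auto
  obtain N where N: "real N > A" using reals_Archimedean2 by blast
  have "E t \<le> E s + - (\<eta> / 2) * (t - s)"
    by (rule LIMSEQ_le[OF L1 R1]) (use N in \<open>auto intro!: exI[of _ N] loc\<close>)
  then show ?thesis by simp
qed

end

section \<open>Negative energy forces spreading\<close>

lemma integrable_inverse_one_plus_square:
  "integrable lebesgue (\<lambda>x::real. 1 / (1 + x\<^sup>2))"
proof -
  have half: "(\<integral>\<^sup>+x. ennreal (1 / (1 + x\<^sup>2)) * indicator {0..} x \<partial>lborel) = ennreal (pi / 2 - arctan 0)"
  proof (rule nn_integral_FTC_atLeast)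
    show "(arctan \<longlongrightarrow> pi / 2) at_top" by (rule tendsto_arctan_at_top)
    show "DERIV arctan x :> 1 / (1 + x\<^sup>2)" for x
      using DERIV_arctan[of x] by (simp add: inverse_eq_divide)
  qed auto
  have "(\<integral>\<^sup>+x. ennreal (1 / (1 + x\<^sup>2)) * indicator {..0} x \<partial>lborel)
      = (\<integral>\<^sup>+x. ennreal (1 / (1 + x\<^sup>2)) * indicator {0..} x \<partial>lborel)"
    by (subst nn_integral_real_affine[where c = "-1" and t = 0])
      (auto intro!: nn_integral_cong simp: indicator_def)
  note half2 = this[unfolded half]
  have "(\<integral>\<^sup>+x. ennreal (1 / (1 + x\<^sup>2)) \<partial>lborel)
    \<le> (\<integral>\<^sup>+x. ennreal (1 / (1 + x\<^sup>2)) * indicator {..0} x + ennreal (1 / (1 + x\<^sup>2)) * indicator {0..} x \<partial>lborel)"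
    by (intro nn_integral_mono) (auto simp: indicator_def)
  also have "\<dots> = ennreal (pi / 2 - arctan 0) + ennreal (pi / 2 - arctan 0)"
    by (subst nn_integral_add) (auto simp: half half2)
  finally have "(\<integral>\<^sup>+x. ennreal (1 / (1 + x\<^sup>2)) \<partial>lborel) < \<infinity>"
    by (rule le_less_trans) (simp add: ennreal_add_eq_top less_top)
  moreover have "(\<lambda>x::real. 1 / (1 + x\<^sup>2)) \<in> borel_measurable lebesgue"
    by (intro continuous_lebesgue_measurable continuous_intros) (auto simp: add_nonneg_eq_0_iff)
  ultimately show ?thesis
    by (intro integrableI_nonneg) (auto simp: nn_integral_completion)
qed

context monostable_solution
begin

text \<open>
  By \<open>locally_uniform_convergence\<close> this property implies convergence to one; below, its failure is
  played off against negative energy.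
\<close>

definition spreads :: "real \<Rightarrow> bool" where
  "spreads q \<longleftrightarrow> 0 < q \<and> (\<forall>R. \<exists>T>0. \<forall>t\<ge>T. \<forall>x. \<bar>x\<bar> \<le> R \<longrightarrow> q \<le> u x t)"

lemma G_mono: "0 \<le> a \<Longrightarrow> a \<le> b \<Longrightarrow> b \<le> 1 \<Longrightarrow> G a \<le> G b"
  by (rule DERIV_nonneg_imp_nondecreasing) (use G_derivative F_nonneg in force)+

lemma G_nonneg: "0 \<le> s \<Longrightarrow> s \<le> 1 \<Longrightarrow> 0 \<le> G s"
  using G_mono[of 0 s] G_zero by simp

lemma G_pos:
  assumes "0 < s" "s < 1" shows "0 < G s"
proof -
  have "G 0 < G s"
  proof (rule DERIV_pos_imp_increasing_open[of 0 s G])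
    show "\<exists>y. DERIV G x :> y \<and> 0 < y" if "0 < x" "x < s" for x
      using G_derivative[of x] F_pos[of x] that assms by auto
    show "continuous_on {0..s} G" using G_derivative by (auto intro!: continuous_at_imp_continuous_on DERIV_isCont)
  qed (use assms in simp)
  then show ?thesis by (simp add: G_zero)
qed

lemma G_le_G_one:
  assumes "0 \<le> s" shows "G s \<le> G 1"
proof (cases "s \<le> 1")
  case True
  then show ?thesis using G_mono[of s 1] assms by simp
next
  case False
  show ?thesis
  proof (rule DERIV_nonpos_imp_nonincreasing[of 1 s G])
    show "\<exists>y. DERIV G x :> y \<and> y \<le> 0" if "1 \<le> x" "x \<le> s" for x
      using G_derivative[of x] F_neg[of x] F_one that by (cases "x = 1") (auto intro: less_imp_le)
  qed (use False in simp)
qed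

text \<open>
  Maximising \<open>G s - \<kappa> s\<close> over \<open>{0..d}\<close> selects a height \<open>q\<close> below which \<open>G\<close> grows at least like \<open>\<kappa> s\<close>, which
  is what the subsolution of height \<open>q\<close> needs. The value \<open>\<kappa> = G d / (2 d)\<close> keeps the maximum positive, so
  \<open>q > 0\<close>. If \<open>u \<ge> d\<close> up to \<open>x\<close> and \<open>x\<close> exceeded the length of the profile, the solution would spread.
  The height is capped at \<open>1 / 2\<close> to stay where \<open>F\<close> is positive.
\<close>

lemma spreading_or_decay:
  assumes ns: "\<And>q. \<not> spreads q" and t: "t > 0" and x: "x > 0"
  defines "d \<equiv> min (u x t) (1 / 2)"
  shows "G d * x\<^sup>2 \<le> 16 * d\<^sup>2"
proof (cases "d > 0")
  case False
  then have "d = 0" using bounds(1)[OF t, of x] by (auto simp: d_def min_def split: if_splits)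
  then show ?thesis by (simp add: G_zero)
next
  case True
  have d: "d \<le> 1 / 2" "d \<le> u x t" by (auto simp: d_def)
  have Gd: "G d > 0" using G_pos[of d] True d by simp
  define \<kappa> where "\<kappa> = G d / (2 * d)"
  have \<kappa>: "\<kappa> > 0" "\<kappa> * d = G d / 2" using Gd True by (auto simp: \<kappa>_def)
  have "continuous_on {0..d} (\<lambda>s. G s - \<kappa> * s)"
    using G_derivative by (intro continuous_intros) (auto intro!: continuous_at_imp_continuous_on DERIV_isCont)
  then obtain q where q: "q \<in> {0..d}" "\<And>s. s \<in> {0..d} \<Longrightarrow> G s - \<kappa> * s \<le> G q - \<kappa> * q"
    using continuous_attains_sup[of "{0..d}" "\<lambda>s. G s - \<kappa> * s"] True by auto
  have "q \<noteq> 0" using q(2)[of d] True Gd \<kappa> by (auto simp: G_zero)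
  then have q0: "0 < q" "q < 1" "q \<le> d" using q(1) d by auto
  have gap: "\<kappa> * (q - s) \<le> G q - G s" if "0 \<le> s" "s \<le> q" for s
    using q(2)[of s] that q(1) by (simp add: algebra_simps)
  have "x < sqrt (8 * q / \<kappa>)"
  proof (rule ccontr)
    assume "\<not> x < sqrt (8 * q / \<kappa>)"
    then have "u x t \<le> u (sqrt (8 * q / \<kappa>)) t"
      using q0 \<kappa> by (intro decreasing t) auto
    then have "q \<le> u (sqrt (8 * q / \<kappa>)) t" using q0 d by simp
    from spreading_from_plateau[OF q0(1,2) \<kappa>(1) gap t this]
    obtain c where c: "c > 0" "\<And>s x. s \<ge> t \<Longrightarrow> \<bar>x\<bar> \<le> c * (s - t) \<Longrightarrow> q \<le> u x s" by blast
    have "spreads q"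
      unfolding spreads_def
    proof (intro conjI allI q0)
      fix R :: real
      have "q \<le> u x s" if "s \<ge> t + \<bar>R\<bar> / c" "\<bar>x\<bar> \<le> R" for s x
      proof (rule c(2))
        have "\<bar>R\<bar> / c \<ge> 0" using c by simp
        then show "s \<ge> t" using that by linarith
        have "\<bar>R\<bar> \<le> c * (s - t)" using that(1) c(1) by (simp add: field_simps)
        then show "\<bar>x\<bar> \<le> c * (s - t)" using that by linarith
      qed
      moreover have "t + \<bar>R\<bar> / c > 0" using t c by (simp add: add_pos_nonneg)
      ultimately show "\<exists>T>0. \<forall>s\<ge>T. \<forall>x. \<bar>x\<bar> \<le> R \<longrightarrow> q \<le> u x s" by blast
    qed
    then show False using ns by blast
  qed
  then have "x\<^sup>2 < (sqrt (8 * q / \<kappa>))\<^sup>2" using x by (intro power_strict_mono) auto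
  also have "\<dots> = 8 * q / \<kappa>" using q0 \<kappa> by simp
  also have "\<dots> \<le> 8 * d / \<kappa>" using q0 \<kappa> by (intro divide_right_mono) auto
  also have "8 * d / \<kappa> = 16 * d\<^sup>2 / G d" using True by (simp add: \<kappa>_def power2_eq_square)
  finally have "x\<^sup>2 < 16 * d\<^sup>2 / G d" .
  then show ?thesis using Gd by (simp add: pos_less_divide_eq mult.commute)
qed

lemma uniformly_small_far_out:
  assumes ns: "\<And>q. \<not> spreads q" and t: "t > 0" and \<epsilon>: "0 < \<epsilon>" "\<epsilon> \<le> 1 / 2" and x: "x\<^sup>2 > 4 / G \<epsilon>"
  shows "u x t < \<epsilon>"
proof (rule ccontr)
  assume neg: "\<not> u x t < \<epsilon>"
  have G\<epsilon>: "G \<epsilon> > 0" using G_pos \<epsilon> by simp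
  have "x \<noteq> 0" using x G\<epsilon> by auto
  define d where "d = min (u \<bar>x\<bar> t) (1 / 2)"
  have "u \<bar>x\<bar> t = u x t" using even[OF t, of x] by (simp add: abs_if)
  then have d: "\<epsilon> \<le> d" "d \<le> 1 / 2" using neg \<epsilon> by (auto simp: d_def)
  have "G \<epsilon> * x\<^sup>2 \<le> G d * x\<^sup>2" using d \<epsilon> by (intro mult_right_mono G_mono) auto
  also have "\<dots> \<le> 16 * d\<^sup>2" using spreading_or_decay[OF ns t, of "\<bar>x\<bar>"] \<open>x \<noteq> 0\<close> by (simp add: d_def)
  also have "\<dots> \<le> 16 * (1 / 2)\<^sup>2" using d \<epsilon> by (intro mult_left_mono power_mono) auto
  finally have "G \<epsilon> * x\<^sup>2 \<le> 4" by (simp add: power2_eq_square)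
  then show False using x G\<epsilon> by (simp add: field_simps)
qed

lemma G_tail:
  assumes ns: "\<And>q. \<not> spreads q" and t: "t > 0" and x: "\<bar>x\<bar> \<ge> 1" and e: "u x t \<le> e" "e \<le> 1 / 2"
  shows "G (u x t) \<le> 32 * e\<^sup>2 / (1 + x\<^sup>2)"
proof -
  have x2: "x\<^sup>2 \<ge> 1" using x by (simp add: abs_square_le_1 one_le_power[of "\<bar>x\<bar>" 2, simplified])
  have eq: "u \<bar>x\<bar> t = u x t" using even[OF t, of x] by (simp add: abs_if)
  have "G (u x t) * x\<^sup>2 \<le> 16 * (u x t)\<^sup>2"
    using spreading_or_decay[OF ns t, of "\<bar>x\<bar>"] x e by (simp add: eq min_def)
  also have "\<dots> \<le> 16 * e\<^sup>2" using e bounds(1)[OF t] by (intro mult_left_mono power_mono) auto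
  finally have 1: "G (u x t) * x\<^sup>2 \<le> 16 * e\<^sup>2" .
  have "0 \<le> G (u x t)" using G_nonneg[of "u x t"] bounds(1)[OF t] e by simp
  then have "G (u x t) * (1 + x\<^sup>2) \<le> G (u x t) * (2 * x\<^sup>2)" using x2 by (intro mult_left_mono) auto
  also have "\<dots> = 2 * (G (u x t) * x\<^sup>2)" by simp
  also have "\<dots> \<le> 2 * (16 * e\<^sup>2)" by (rule mult_left_mono[OF 1]) simp
  finally show ?thesis by (simp add: pos_le_divide_eq add_pos_nonneg)
qed

lemma G_core:
  assumes "\<bar>x\<bar> \<le> X" "G v \<le> C" "C \<ge> 0"
  shows "G v \<le> C * (1 + X\<^sup>2) / (1 + x\<^sup>2)"
proof -
  have "x\<^sup>2 \<le> X\<^sup>2" using assms(1) by (metis abs_ge_zero power2_abs power_mono)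
  then have "C * (1 + x\<^sup>2) \<le> C * (1 + X\<^sup>2)" using assms by (intro mult_left_mono) auto
  then have "C \<le> C * (1 + X\<^sup>2) / (1 + x\<^sup>2)" by (simp add: pos_le_divide_eq add_pos_nonneg)
  then show ?thesis using assms by linarith
qed

text \<open>
  Far out the decay estimate applies with \<open>u \<le> 1 / 2\<close>; near the origin \<open>G\<close> is bounded by \<open>G 1\<close>.
\<close>

lemma G_uniform_bound:
  assumes ns: "\<And>q. \<not> spreads q"
  shows "\<exists>C. \<forall>t>0. \<forall>x. G (u x t) \<le> C / (1 + x\<^sup>2)"
proof -
  define X where "X = sqrt (4 / G (1 / 2)) + 1"
  have Gh: "G (1 / 2) > 0" using G_pos by simp
  have X: "X \<ge> 1" using Gh by (simp add: X_def)
  have G1: "G 1 \<ge> 0" using G_nonneg[of 1] by simp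
  define C where "C = max (G 1 * (1 + X\<^sup>2)) 8"
  have "G (u x t) \<le> C / (1 + x\<^sup>2)" if t: "t > 0" for t x
  proof (cases "\<bar>x\<bar> \<le> X")
    case True
    have "G (u x t) \<le> G 1 * (1 + X\<^sup>2) / (1 + x\<^sup>2)"
      by (rule G_core[OF True G_le_G_one G1]) (rule bounds(1)[OF t])
    also have "\<dots> \<le> C / (1 + x\<^sup>2)" by (intro divide_right_mono) (auto simp: C_def)
    finally show ?thesis .
  next
    case False
    have "(sqrt (4 / G (1 / 2)))\<^sup>2 < \<bar>x\<bar>\<^sup>2" using False Gh by (intro power_strict_mono) (auto simp: X_def)
    then have "4 / G (1 / 2) < x\<^sup>2" using Gh by simp
    from uniformly_small_far_out[OF ns t _ _ this] have "u x t \<le> 1 / 2" by simp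
    from G_tail[OF ns t _ this] have "G (u x t) \<le> 32 * (1 / 2)\<^sup>2 / (1 + x\<^sup>2)" using False X by simp
    also have "\<dots> \<le> C / (1 + x\<^sup>2)" by (intro divide_right_mono) (auto simp: C_def power2_eq_square)
    finally show ?thesis .
  qed
  then show ?thesis by blast
qed

lemma G_small_bound:
  assumes ns: "\<And>q. \<not> spreads q" and t: "t > 0" and e: "u 0 t \<le> e" "e \<le> 1 / 2"
  shows "G (u x t) \<le> (2 * G e + 32 * e\<^sup>2) / (1 + x\<^sup>2)"
proof -
  have ux: "u x t \<le> e" using decreasing_abs[OF t, of 0 x] e by simp
  have e0: "0 \<le> e" using bounds(1)[OF t, of 0] e by simp
  have Ge: "G (u x t) \<le> G e" "0 \<le> G e" using G_mono[of "u x t" e] bounds(1)[OF t] ux e e0 G_nonneg[of e] by auto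
  show ?thesis
  proof (cases "\<bar>x\<bar> \<le> 1")
    case True
    have "G (u x t) \<le> G e * (1 + 1\<^sup>2) / (1 + x\<^sup>2)" by (rule G_core[OF True Ge])
    also have "\<dots> \<le> (2 * G e + 32 * e\<^sup>2) / (1 + x\<^sup>2)" by (intro divide_right_mono) auto
    finally show ?thesis .
  next
    case False
    have "G (u x t) \<le> 32 * e\<^sup>2 / (1 + x\<^sup>2)" by (rule G_tail[OF ns t _ ux e(2)]) (use False in simp)
    also have "\<dots> \<le> (2 * G e + 32 * e\<^sup>2) / (1 + x\<^sup>2)" using Ge by (intro divide_right_mono) auto
    finally show ?thesis .
  qed
qed

end

context finite_energy_solution
begin

lemma E_lower_bound:
  assumes "t > 0" "\<And>x. G (u x t) \<le> C / (1 + x\<^sup>2)"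
  shows "E t \<ge> - (C * (LINT x|lebesgue. 1 / (1 + x\<^sup>2)))"
proof -
  have "- (C * (LINT x|lebesgue. 1 / (1 + x\<^sup>2))) = (LINT x|lebesgue. - (C * (1 / (1 + x\<^sup>2))))"
    by (simp only: Bochner_Integration.integral_minus integral_mult_right_zero)
  also have "\<dots> \<le> E t"
    unfolding E_def
  proof (rule Bochner_Integration.integral_mono)
    show "integrable lebesgue (\<lambda>x. - (C * (1 / (1 + x\<^sup>2))))"
      using integrable_inverse_one_plus_square by (intro integrable_minus integrable_mult_right) auto
    show "- (C * (1 / (1 + x\<^sup>2))) \<le> energy_density t x" for x
    proof -
      have "C * (1 / (1 + x\<^sup>2)) = C / (1 + x\<^sup>2)" by simp
      moreover have "0 \<le> (ux x t)\<^sup>2 / 2" by simp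
      ultimately show ?thesis using assms(2)[of x] unfolding energy_density_def by linarith
    qed
  qed (rule energy_density_integrable[OF assms(1)])
  finally show ?thesis .
qed

text \<open>
  Suppose \<open>u\<^sub>t\<close> were tiny in \<open>L\<^sup>2\<close> on a long interval. Between heights \<open>\<epsilon>\<close> and \<open>\<epsilon> / 2\<close>, which are taken at
  \<open>y1 < y2\<close>, either \<open>u\<close> needs a distance of at least one, and \<open>F u \<ge> m\<close> there lowers the slope by
  \<open>m\<close>, or it drops by \<open>\<epsilon> / 2\<close> within a shorter distance and is steep somewhere. Beyond \<open>y2\<close> the slope
  cannot recover as \<open>F u \<ge> 0\<close>, so \<open>u\<close> would be negative at \<open>A\<close>. Nonspreading bounds \<open>y2\<close> by \<open>X\<close>,
  uniformly in time.
\<close>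

lemma dissipation_while_not_spreading:
  assumes ns: "\<And>q. \<not> spreads q" and \<epsilon>: "0 < \<epsilon>" "\<epsilon> \<le> 1 / 2"
  obtains A \<eta> where "A > 0" "\<eta> > 0"
    "\<And>\<tau>. \<tau> > 0 \<Longrightarrow> u 0 \<tau> > \<epsilon> \<Longrightarrow> \<eta> \<le> integral {- A..A} (\<lambda>x. (ut x \<tau>)\<^sup>2)"
proof -
  obtain m where m: "m > 0" "\<And>s. \<epsilon> / 2 \<le> s \<Longrightarrow> s \<le> \<epsilon> \<Longrightarrow> m \<le> F s"
    using positive_minimum[of "\<epsilon> / 2" \<epsilon>] \<epsilon> by auto
  define \<mu> where "\<mu> = min m (\<epsilon> / 2)"
  have \<mu>: "\<mu> > 0" "\<mu> \<le> m" "\<mu> \<le> \<epsilon> / 2" using m \<epsilon> by (auto simp: \<mu>_def)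
  define X where "X = sqrt (4 / G (\<epsilon> / 2)) + 1"
  have Gh: "G (\<epsilon> / 2) > 0" using G_pos \<epsilon> by simp
  have X: "X \<ge> 1" using Gh by (simp add: X_def)
  define A where "A = X + \<epsilon> / \<mu> + 1"
  have A: "A > 0" "A > X" using X \<epsilon> \<mu> by (auto simp: A_def add_pos_pos)
  define \<eta> where "\<eta> = \<mu>\<^sup>2 / (4 * A)"
  show ?thesis
  proof (rule that[OF A(1), of \<eta>])
    show "\<eta> > 0" using \<mu> A by (simp add: \<eta>_def)
    fix \<tau> :: real assume \<tau>: "\<tau> > 0" and u0: "u 0 \<tau> > \<epsilon>"
    show "\<eta> \<le> integral {- A..A} (\<lambda>x. (ut x \<tau>)\<^sup>2)"
    proof (rule ccontr)
      assume small: "\<not> \<eta> \<le> integral {- A..A} (\<lambda>x. (ut x \<tau>)\<^sup>2)"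
      note cc = strip_continuous_compose[OF D(4)] strip_continuous_compose[OF D(5)] strip_continuous_compose[OF D(6)] strip_continuous_compose[OF D(7)]
        continuous_on_compose2[OF F_continuous[of UNIV]]
      have ic: "h integrable_on {a..b}" if "continuous_on {a..b} h" for h :: "real \<Rightarrow> real" and a b
        using that integrable_continuous_interval by blast
      have uc: "continuous_on S (\<lambda>x. u x \<tau>)" for S by (rule u_x_continuous[OF \<tau>])
      have uX: "u X \<tau> < \<epsilon> / 2"
      proof (rule uniformly_small_far_out[OF ns \<tau>])
        have "(sqrt (4 / G (\<epsilon> / 2)))\<^sup>2 < X\<^sup>2" using Gh by (intro power_strict_mono) (auto simp: X_def)
        then show "4 / G (\<epsilon> / 2) < X\<^sup>2" using Gh by simp
      qed (use \<epsilon> in auto)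
      obtain y1 where y1: "0 \<le> y1" "y1 \<le> X" "u y1 \<tau> = \<epsilon>"
        using IVT2'[of "\<lambda>x. u x \<tau>" X \<epsilon> 0] uc uX u0 X \<epsilon> by auto
      obtain y2 where y2: "y1 \<le> y2" "y2 \<le> X" "u y2 \<tau> = \<epsilon> / 2"
        using IVT2'[of "\<lambda>x. u x \<tau>" X "\<epsilon> / 2" y1] uc uX y1 \<epsilon> by auto
      have y12: "y1 < y2" using y1 y2 \<epsilon> by (cases "y1 = y2") auto
      have ux_y1: "ux y1 \<tau> \<le> 0"
      proof (rule ccontr)
        assume "\<not> ux y1 \<tau> \<le> 0"
        then obtain e where e: "e > 0" "\<And>h. 0 < h \<Longrightarrow> h < e \<Longrightarrow> u y1 \<tau> < u (y1 + h) \<tau>"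
          using DERIV_pos_inc_right[OF D(1)[OF \<tau>, of y1 UNIV]] by auto
        then show False using decreasing[OF \<tau> y1(1), of "y1 + e / 2"] e(1) e(2)[of "e / 2"] by linarith
      qed
      have slope: "ux x \<tau> \<le> ux y \<tau> + \<mu> / 2 - integral {y..x} (\<lambda>x. F (u x \<tau>))" if xy: "y1 \<le> y" "y \<le> x" "x \<le> A" for x y
      proof -
        \<comment> \<open>The value of \<open>r\<close> that balances the two terms of \<open>u\<^sub>t \<le> u\<^sub>t\<^sup>2 / (2 r) + r / 2\<close> after integration.\<close>
        define r where "r = \<mu> / (2 * A)"
        have r: "r > 0" using \<mu> A by (simp add: r_def)
        have "((\<lambda>x. uxx x \<tau>) has_integral (ux x \<tau> - ux y \<tau>)) {y..x}"
          by (rule fundamental_theorem_of_calculus)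
            (use xy D(2)[OF \<tau>] in \<open>auto simp: has_real_derivative_iff_has_vector_derivative[symmetric]\<close>)
        then have "ux x \<tau> - ux y \<tau> = integral {y..x} (\<lambda>x. uxx x \<tau>)" by (simp add: integral_unique)
        also have "\<dots> = integral {y..x} (\<lambda>x. ut x \<tau> - F (u x \<tau>))"
          using pde[OF \<tau>] by simp
        also have "\<dots> = integral {y..x} (\<lambda>x. ut x \<tau>) - integral {y..x} (\<lambda>x. F (u x \<tau>))"
          by (rule integral_diff) (use \<tau> in \<open>auto intro!: ic continuous_intros cc\<close>)
        also have "integral {y..x} (\<lambda>x. ut x \<tau>) \<le> integral {y..x} (\<lambda>x. (ut x \<tau>)\<^sup>2 / (2 * r) + r / 2)"
        proof (rule integral_le)
          show "ut x \<tau> \<le> (ut x \<tau>)\<^sup>2 / (2 * r) + r / 2" for x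
          proof -
            have "0 \<le> (ut x \<tau> - r)\<^sup>2 / (2 * r)" using r by simp
            also have "\<dots> = (ut x \<tau>)\<^sup>2 / (2 * r) + r / 2 - ut x \<tau>"
              using r by (simp add: power2_eq_square field_simps)
            finally show ?thesis by simp
          qed
        qed (use \<tau> r in \<open>auto intro!: ic continuous_intros cc\<close>)
        also have "integral {y..x} (\<lambda>x. (ut x \<tau>)\<^sup>2 / (2 * r) + r / 2) = integral {y..x} (\<lambda>x. (ut x \<tau>)\<^sup>2) / (2 * r) + (x - y) * r / 2"
          using xy by (subst integral_add) (use \<tau> r in \<open>auto intro!: ic continuous_intros cc\<close>)
        also have "integral {y..x} (\<lambda>x. (ut x \<tau>)\<^sup>2) / (2 * r) \<le> \<eta> / (2 * r)"
        proof (rule divide_right_mono)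
          have "integral {y..x} (\<lambda>x. (ut x \<tau>)\<^sup>2) \<le> integral {- A..A} (\<lambda>x. (ut x \<tau>)\<^sup>2)"
            by (intro integral_subset_le ic continuous_intros cc) (use xy \<tau> y1 A in auto)
          then show "integral {y..x} (\<lambda>x. (ut x \<tau>)\<^sup>2) \<le> \<eta>" using small by simp
        qed (use r in simp)
        also have "(x - y) * r / 2 \<le> A * r / 2" using xy y1 r by (intro divide_right_mono mult_right_mono) auto
        also have "\<eta> / (2 * r) + A * r / 2 = \<mu> / 2"
          using \<mu> A by (simp add: \<eta>_def r_def power2_eq_square field_simps)
        finally show ?thesis by simp
      qed
      have Fnn: "0 \<le> F (u x \<tau>)" if "y1 \<le> x" for x
        using decreasing[OF \<tau> y1(1) that] y1 \<epsilon> by (intro F_nonneg) simp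
      have steep: "ux x \<tau> \<le> - (\<mu> / 2)" if x: "y2 \<le> x" "x \<le> A" for x
      proof (cases "y2 - y1 \<ge> 1")
        case True
        have "m * 1 \<le> m * (y2 - y1)" using True m by (intro mult_left_mono) auto
        also have "\<dots> = integral {y1..y2} (\<lambda>_. m)" using y12 by simp
        also have "\<dots> \<le> integral {y1..y2} (\<lambda>x. F (u x \<tau>))"
        proof (rule integral_le)
          show "m \<le> F (u x \<tau>)" if "x \<in> {y1..y2}" for x
            using decreasing[OF \<tau> y1(1), of x] decreasing[OF \<tau>, of x y2] that y1 y2 by (intro m(2)) auto
        qed (use \<tau> in \<open>auto intro!: ic continuous_intros cc\<close>)
        also have "\<dots> \<le> integral {y1..x} (\<lambda>x. F (u x \<tau>))"
          by (intro integral_subset_le ic cc continuous_intros) (use \<tau> x Fnn in auto)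
        finally have "m \<le> integral {y1..x} (\<lambda>x. F (u x \<tau>))" by simp
        then show ?thesis using slope[of y1 x] ux_y1 x y12 \<mu> by simp
      next
        case False
        obtain z where z: "y1 < z" "z < y2" "u y2 \<tau> - u y1 \<tau> = (y2 - y1) * ux z \<tau>"
          using MVT2[OF y12, of "\<lambda>x. u x \<tau>" "\<lambda>x. ux x \<tau>"] D(1)[OF \<tau>] by blast
        have "ux z \<tau> \<le> - (\<epsilon> / 2)"
        proof -
          have eq: "(y2 - y1) * (- ux z \<tau>) = \<epsilon> / 2" using z(3) y1 y2 by simp
          then have "- ux z \<tau> > 0" using y12 \<epsilon> by (metis diff_gt_0_iff_gt half_gt_zero zero_less_mult_pos)
          then have "(y2 - y1) * (- ux z \<tau>) \<le> 1 * (- ux z \<tau>)" using False by (intro mult_right_mono) auto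
          then show ?thesis using eq by simp
        qed
        moreover have "0 \<le> integral {z..x} (\<lambda>x. F (u x \<tau>))"
          by (intro integral_nonneg ic cc continuous_intros) (use \<tau> Fnn z in auto)
        ultimately show ?thesis using slope[of z x] z x \<mu> by simp
      qed
      have yA: "y2 < A" using y2 A by simp
      obtain z where z: "y2 < z" "z < A" "u A \<tau> - u y2 \<tau> = (A - y2) * ux z \<tau>"
        using MVT2[OF yA, of "\<lambda>x. u x \<tau>" "\<lambda>x. ux x \<tau>"] D(1)[OF \<tau>] by blast
      have "(A - y2) * ux z \<tau> \<le> (A - y2) * (- (\<mu> / 2))"
        using steep[of z] z yA by (intro mult_left_mono) auto
      also have "\<dots> \<le> (\<epsilon> / \<mu> + 1) * (- (\<mu> / 2))"
        using y2 \<mu> by (intro mult_right_mono_neg) (auto simp: A_def)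
      also have "\<dots> = - (\<epsilon> / 2) - \<mu> / 2" using \<mu> by (simp add: field_simps)
      finally have "u A \<tau> < 0" using z(3) y2 \<mu> by simp
      then show False using bounds(1)[OF \<tau>, of A] by simp
    qed
  qed
qed

text \<open>
  A small \<open>u(0, t)\<close> would make the energy almost nonnegative, so \<open>u(0, t) > e\<close> for all later times.
  Then the dissipation has a positive lower bound, which contradicts the lower bound for the energy.
\<close>

lemma negative_energy_spreads:
  assumes s: "s > 0" and neg: "E s < 0"
  shows "\<exists>q. spreads q"
proof (rule ccontr)
  assume "\<nexists>q. spreads q"
  then have ns: "\<not> spreads q" for q by blast
  define I where "I = (LINT x|lebesgue. 1 / (1 + x\<^sup>2 :: real))"
  have E_le: "E t \<le> E s" if "t \<ge> s" for t
    using energy_dissipation[of s t 0 0] s that by simp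
  have G0: "(G \<longlongrightarrow> G 0) (at_right 0)"
    using DERIV_isCont[OF G_derivative, of 0] unfolding isCont_def by (rule tendsto_within_subset) simp
  have "((\<lambda>e. (2 * G e + 32 * e\<^sup>2) * I) \<longlongrightarrow> (2 * G 0 + 32 * 0\<^sup>2) * I) (at_right 0)"
    by (intro tendsto_intros G0)
  then have "\<forall>\<^sub>F e in at_right 0. (2 * G e + 32 * e\<^sup>2) * I < - E s"
    using neg by (intro order_tendstoD(2)) (auto simp: G_zero)
  moreover have "\<forall>\<^sub>F e in at_right 0. e \<in> {0<..<1 / 2 :: real}"
    by (rule eventually_at_right_real) simp
  ultimately have "\<forall>\<^sub>F e in at_right 0. (2 * G e + 32 * e\<^sup>2) * I < - E s \<and> e \<in> {0<..<1 / 2 :: real}"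
    by (rule eventually_conj)
  then obtain e where "(2 * G e + 32 * e\<^sup>2) * I < - E s \<and> e \<in> {0<..<1 / 2 :: real}"
    using eventually_happens'[OF trivial_limit_at_right_real] by blast
  then have e: "(2 * G e + 32 * e\<^sup>2) * I < - E s" "0 < e" "e \<le> 1 / 2" by auto
  have u0: "u 0 t > e" if t: "t \<ge> s" for t
  proof (rule ccontr)
    assume "\<not> u 0 t > e"
    then have "G (u x t) \<le> (2 * G e + 32 * e\<^sup>2) / (1 + x\<^sup>2)" for x
      using G_small_bound[OF ns _ _ e(3), of t x] t s by simp
    from E_lower_bound[OF _ this] have "E t \<ge> - ((2 * G e + 32 * e\<^sup>2) * I)" using t s by (simp add: I_def)
    then show False using E_le[OF t] e(1) by simp
  qed
  obtain A \<eta> where A: "A > 0" "\<eta> > 0"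
    "\<And>\<tau>. \<tau> > 0 \<Longrightarrow> u 0 \<tau> > e \<Longrightarrow> \<eta> \<le> integral {- A..A} (\<lambda>x. (ut x \<tau>)\<^sup>2)"
    using dissipation_while_not_spreading[OF ns e(2,3)] by blast
  obtain C where C: "\<And>t x. t > 0 \<Longrightarrow> G (u x t) \<le> C / (1 + x\<^sup>2)"
    using G_uniform_bound[OF ns] by blast
  define t where "t = s + 2 * (\<bar>C * I\<bar> + 1) / \<eta>"
  have t: "t \<ge> s" "\<eta> * (t - s) / 2 = \<bar>C * I\<bar> + 1" using A by (auto simp: t_def)
  have "E t \<le> E s - \<eta> * (t - s) / 2"
    by (rule energy_dissipation[OF s t(1), of A]) (use A s u0 in auto)
  moreover have "E t \<ge> - (C * I)"
    using E_lower_bound[OF _ C, of t] t s by (simp add: I_def)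
  ultimately show False using t(2) neg by linarith
qed

end

section \<open>The energy at positive times and the given solution\<close>

lemma AE_lebesgue_neq: "AE x in lebesgue. x \<noteq> (c :: real)"
  by (rule AE_completion) (rule AE_lborel_singleton)

lemma locally_integrable_measurable:
  assumes "locally_integrable g"
  shows "g \<in> borel_measurable lebesgue"
proof (rule borel_measurable_LIMSEQ_real)
  show "(\<lambda>x. indicator {- real n..real n} x * g x) \<in> borel_measurable lebesgue" for n
    using assms by (auto simp: locally_integrable_def set_integrable_def)
  show "(\<lambda>n. indicator {- real n..real n} x * g x) \<longlonglongrightarrow> g x" for x
  proof (rule tendsto_eventually)
    obtain N where "real N \<ge> \<bar>x\<bar>" using real_arch_simple by blast
    then show "\<forall>\<^sub>F n in sequentially. indicator {- real n..real n} x * g x = g x"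
      by (auto simp: eventually_sequentially indicator_def intro!: exI[of _ N])
  qed
qed

lemma L2_diff_integrable:
  assumes "p \<in> L2" "q \<in> L2"
  shows "integrable lebesgue (\<lambda>x. (p x - q x)\<^sup>2)"
proof (rule Bochner_Integration.integrable_bound)
  show "integrable lebesgue (\<lambda>x. 2 * (p x)\<^sup>2 + 2 * (q x)\<^sup>2)" using assms by (simp add: L2_def)
  show "(\<lambda>x. (p x - q x)\<^sup>2) \<in> borel_measurable lebesgue"
    using assms by (auto simp: L2_def intro!: borel_measurable_power borel_measurable_diff)
  have "(a - b)\<^sup>2 \<le> 2 * a\<^sup>2 + 2 * b\<^sup>2" for a b :: real
    using zero_le_power2[of "a + b"] by (simp add: power2_eq_square algebra_simps)
  then show "AE x in lebesgue. norm ((p x - q x)\<^sup>2) \<le> norm (2 * (p x)\<^sup>2 + 2 * (q x)\<^sup>2)"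
    by (intro AE_I2) simp
qed

lemma L2_curve_attains:
  assumes c: "continuous_curve {0..} L2 L2_norm (\<lambda>t x. u x t)" and T: "T \<ge> 0"
  shows "attains (\<lambda>x t. u x (t + T)) (\<lambda>x. u x T)"
    "((\<lambda>s. LINT x|lebesgue. (u x (s + T) - u x T)\<^sup>2) \<longlongrightarrow> 0) (at_right 0)"
proof -
  have L2: "(\<lambda>x. u x t) \<in> L2" if "t \<ge> 0" for t using c that by (auto simp: continuous_curve_def)
  have lim: "((\<lambda>s. L2_norm (\<lambda>x. u x s - u x T)) \<longlongrightarrow> 0) (at T within {0..})"
    using c T by (auto simp: continuous_curve_def)
  have "filterlim (\<lambda>s. s + T) (at T within {0..}) (at_right 0)"
    unfolding filterlim_at
  proof
    show "\<forall>\<^sub>F s in at_right 0. s + T \<in> {0..} \<and> s + T \<noteq> T"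
      using eventually_at_right_less[of 0] by eventually_elim (use T in auto)
    show "((\<lambda>s. s + T) \<longlongrightarrow> T) (at_right 0)" by (auto intro!: tendsto_eq_intros)
  qed
  from filterlim_compose[OF lim this]
  have "((\<lambda>s. (L2_norm (\<lambda>x. u x (s + T) - u x T))\<^sup>2) \<longlongrightarrow> 0\<^sup>2) (at_right 0)"
    by (intro tendsto_intros)
  moreover have "(L2_norm (\<lambda>x. u x (s + T) - u x T))\<^sup>2 = (LINT x|lebesgue. (u x (s + T) - u x T)\<^sup>2)" for s
    by (simp add: L2_norm_def)
  ultimately show R: "((\<lambda>s. LINT x|lebesgue. (u x (s + T) - u x T)\<^sup>2) \<longlongrightarrow> 0) (at_right 0)" by simp
  have "((\<lambda>s. ennreal (LINT x|lebesgue. (u x (s + T) - u x T)\<^sup>2)) \<longlongrightarrow> ennreal 0) (at_right 0)"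
    by (rule tendsto_ennrealI[OF R])
  moreover have "\<forall>\<^sub>F s in at_right 0. ennreal (LINT x|lebesgue. (u x (s + T) - u x T)\<^sup>2) = (\<integral>\<^sup>+x. ennreal ((u x (s + T) - u x T)\<^sup>2) \<partial>lebesgue)"
    using eventually_at_right_less[of 0]
  proof eventually_elim
    case (elim s)
    show ?case
      by (rule nn_integral_eq_integral[symmetric]) (use elim T in \<open>auto intro!: L2_diff_integrable L2\<close>)
  qed
  ultimately have "((\<lambda>s. \<integral>\<^sup>+x. ennreal ((u x (s + T) - u x T)\<^sup>2) \<partial>lebesgue) \<longlongrightarrow> ennreal 0) (at_right 0)"
    by (rule Lim_transform_eventually)
  then show "attains (\<lambda>x t. u x (t + T)) (\<lambda>x. u x T)"
    using L2[OF T] by (simp add: attains_def L2_def)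
qed

context finite_energy_solution
begin

text \<open>
  The gradient part of the energy is at most \<open>exp (2 L s) J / 2\<close>, and the potential part is continuous
  in \<open>L\<^sup>2\<close> down to the initial time.
\<close>

lemma energy_initially_negative:
  assumes v: "integrable lebesgue (\<lambda>x. (v x)\<^sup>2)"
    and lim: "((\<lambda>s. LINT x|lebesgue. (u x s - v x)\<^sup>2) \<longlongrightarrow> 0) (at_right 0)"
    and int: "\<And>s. s > 0 \<Longrightarrow> integrable lebesgue (\<lambda>x. (u x s - v x)\<^sup>2)"
    and Gv: "integrable lebesgue (\<lambda>x. G (v x))"
    and neg: "J / 2 - (LINT x|lebesgue. G (v x)) < 0"
  shows "\<exists>s>0. E s < 0"
proof -
  define V where "V = (LINT x|lebesgue. (v x)\<^sup>2)"
  define N where "N s = (LINT x|lebesgue. (u x s - v x)\<^sup>2)" for s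
  define a where "a = - (J / 2 - (LINT x|lebesgue. G (v x)))"
  have a: "a > 0" using neg by (simp add: a_def)
  have V: "V \<ge> 0" unfolding V_def by (rule Bochner_Integration.integral_nonneg) simp
  define \<theta> where "\<theta> = a / (4 * (L * V + 1))"
  have LV: "L * V + 1 > 0" using V L_nonneg by (simp add: add_nonneg_pos)
  have \<theta>: "\<theta> > 0" "L * (\<theta> * V) \<le> a / 4"
  proof -
    show t: "\<theta> > 0" using a LV by (simp add: \<theta>_def)
    have "L * (\<theta> * V) \<le> \<theta> * (L * V + 1)" using t by (simp add: algebra_simps)
    also have "\<dots> = a / 4" using LV unfolding \<theta>_def by (simp add: divide_simps)
    finally show "L * (\<theta> * V) \<le> a / 4" .
  qed
  define B where "B s = exp (2 * L * s) * J / 2 - J / 2 - a + L * (\<theta> * V) + L * (1 / \<theta> + 1) * N s" for s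
  have up: "E s \<le> B s" if s: "s > 0" for s
  proof -
    have "(LINT x|lebesgue. G (v x)) - (LINT x|lebesgue. G (u x s)) = (LINT x|lebesgue. G (v x) - G (u x s))"
      using Gv G_integrable[OF s] by simp
    also have "\<dots> \<le> (LINT x|lebesgue. L * \<theta> * (v x)\<^sup>2 + L * (1 / \<theta> + 1) * (u x s - v x)\<^sup>2)"
    proof (rule Bochner_Integration.integral_mono)
      show "integrable lebesgue (\<lambda>x. G (v x) - G (u x s))" using Gv G_integrable[OF s] by simp
      show "integrable lebesgue (\<lambda>x. L * \<theta> * (v x)\<^sup>2 + L * (1 / \<theta> + 1) * (u x s - v x)\<^sup>2)" using v int[OF s] by simp
      fix x
      define d where "d = \<bar>u x s - v x\<bar>"
      have "\<bar>v x\<bar> + \<bar>u x s\<bar> \<le> 2 * \<bar>v x\<bar> + d" "0 \<le> d" by (auto simp: d_def)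
      then have "(\<bar>v x\<bar> + \<bar>u x s\<bar>) * d \<le> (2 * \<bar>v x\<bar> + d) * d" by (intro mult_right_mono) auto
      also have "\<dots> \<le> \<theta> * (v x)\<^sup>2 + (1 / \<theta> + 1) * d\<^sup>2"
      proof -
        have "0 \<le> (\<theta> * \<bar>v x\<bar> - d)\<^sup>2 / \<theta>" using \<theta> by simp
        also have "\<dots> = \<theta> * (v x)\<^sup>2 + (1 / \<theta> + 1) * d\<^sup>2 - (2 * \<bar>v x\<bar> + d) * d"
          using \<theta>(1) by (simp add: power2_eq_square field_simps)
        finally show ?thesis by simp
      qed
      finally have "L * ((\<bar>v x\<bar> + \<bar>u x s\<bar>) * d) \<le> L * (\<theta> * (v x)\<^sup>2 + (1 / \<theta> + 1) * d\<^sup>2)"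
        using L_nonneg by (intro mult_left_mono)
      moreover have "G (v x) - G (u x s) \<le> L * ((\<bar>v x\<bar> + \<bar>u x s\<bar>) * d)"
        using G_difference[of "v x" "u x s"] by (simp add: d_def abs_minus_commute)
      ultimately show "G (v x) - G (u x s) \<le> L * \<theta> * (v x)\<^sup>2 + L * (1 / \<theta> + 1) * (u x s - v x)\<^sup>2"
        by (simp add: d_def algebra_simps)
    qed
    also have "\<dots> = L * \<theta> * V + L * (1 / \<theta> + 1) * N s"
      using v int[OF s] by (simp add: V_def N_def)
    finally have 1: "(LINT x|lebesgue. G (v x)) - (LINT x|lebesgue. G (u x s)) \<le> L * \<theta> * V + L * (1 / \<theta> + 1) * N s" .
    have "E s = (LINT x|lebesgue. (ux x s)\<^sup>2) / 2 - (LINT x|lebesgue. G (u x s))"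
      unfolding E_def energy_density_def using gradient_integrable(1)[OF s] G_integrable[OF s] by simp
    then show ?thesis using 1 gradient_integrable(2)[OF s] by (simp add: B_def a_def mult.assoc)
  qed
  have "((\<lambda>s. B s) \<longlongrightarrow>
      exp (2 * L * 0) * J / 2 - J / 2 - a + L * (\<theta> * V) + L * (1 / \<theta> + 1) * 0) (at_right 0)"
    unfolding B_def N_def by (intro tendsto_intros lim) simp_all
  then have "\<forall>\<^sub>F s in at_right 0. B s < 0"
    using \<theta>(2) a by (intro order_tendstoD(2)) auto
  then have "\<forall>\<^sub>F s in at_right 0. B s < 0 \<and> s > 0"
    using eventually_at_right_less[of 0] by (rule eventually_conj)
  then obtain s where "B s < 0 \<and> s > 0"
    using eventually_happens'[OF trivial_limit_at_right_real] by blast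
  then show ?thesis using up[of s] by (intro exI[of _ s]) linarith
qed

end

lemma C1_truncation_lipschitz:
  assumes "C1_on_nonneg f" "M \<ge> 0"
  shows "\<exists>L. \<forall>a b. \<bar>f (min M (max 0 a)) - f (min M (max 0 b))\<bar> \<le> L * \<bar>a - b\<bar>"
proof -
  obtain f' where f': "\<And>s. s \<ge> 0 \<Longrightarrow> (f has_real_derivative f' s) (at s within {0..})" "continuous_on {0..} f'"
    using assms(1) by (auto simp: C1_on_nonneg_def)
  have "continuous_on {0..M} f'" by (rule continuous_on_subset[OF f'(2)]) auto
  then have "compact (f' ` {0..M})" by (intro compact_continuous_image compact_Icc)
  then have "\<exists>L. \<forall>s\<in>{0..M}. \<bar>f' s\<bar> \<le> L"
    by (auto simp: bounded_iff dest!: compact_imp_bounded)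
  then obtain L where L: "\<And>s. s \<in> {0..M} \<Longrightarrow> \<bar>f' s\<bar> \<le> L" by blast
  have "\<bar>f (min M (max 0 a)) - f (min M (max 0 b))\<bar> \<le> L * \<bar>a - b\<bar>" for a b
  proof -
    have "norm (f (min M (max 0 a)) - f (min M (max 0 b))) \<le> L * norm (min M (max 0 a) - min M (max 0 b))"
    proof (rule field_differentiable_bound[of "{0..M}"])
      show "(f has_field_derivative f' z) (at z within {0..M})" if "z \<in> {0..M}" for z
        by (rule has_field_derivative_subset[OF f'(1)]) (use that in auto)
    qed (use L assms in auto)
    also have "\<dots> \<le> L * \<bar>a - b\<bar>"
      using L[of 0] assms(2) by (intro mult_left_mono) (auto intro: order_trans[OF abs_ge_zero])
    finally show ?thesis by simp
  qed
  then show ?thesis by blast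
qed

lemma C21_classical:
  assumes "C21 u"
  shows "classical u (dx u) (dx (dx u)) (dt u)"
proof -
  have "((\<lambda>y. u y t) has_real_derivative dx u x t) (at x)" "((\<lambda>y. dx u y t) has_real_derivative dx (dx u) x t) (at x)"
    "((\<lambda>s. u x s) has_real_derivative dt u x t) (at t)" if "t > 0" for x t
    using assms that unfolding C21_def dx_def[of u] dx_def[of "dx u"] dt_def
    by (auto simp: DERIV_deriv_iff_real_differentiable dx_def)
  then show ?thesis using assms by (auto simp: classical_def strip_continuous_def C21_def)
qed

lemma reflection_nonincreasing:
  fixes \<phi> :: "real \<Rightarrow> real"
  assumes even: "\<And>x. \<phi> (- x) = \<phi> x" and dec: "antimono_on {0<..} \<phi>"
    and "a > 0" "x \<ge> a" "x \<noteq> 2 * a"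
  shows "\<phi> x \<le> \<phi> (2 * a - x)"
proof -
  have "\<phi> (2 * a - x) = \<phi> \<bar>2 * a - x\<bar>" using even[of "2 * a - x"] by (simp add: abs_if)
  moreover have "\<phi> x \<le> \<phi> \<bar>2 * a - x\<bar>"
    by (rule monotone_onD[OF dec]) (use assms in auto)
  ultimately show ?thesis by simp
qed

text \<open>
  A monotone function has countably many discontinuities. This makes the initial datum an admissible
  representative in \<open>weak_derivative_increment\<close>.
\<close>

lemma AE_isCont_even_antimono:
  fixes \<phi> :: "real \<Rightarrow> real"
  assumes even: "\<And>x. \<phi> (- x) = \<phi> x" and dec: "antimono_on {0<..} \<phi>"
  shows "AE x in lebesgue. isCont \<phi> x"
proof -
  have "mono_on {0<..} (\<lambda>x. - \<phi> x)"
    using dec by (auto simp: monotone_on_def)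
  from mono_on_ctble_discont_open[OF _ this]
  have "countable {x \<in> {0<..}. \<not> isCont (\<lambda>x. - \<phi> x) x}" by simp
  moreover have "isCont (\<lambda>x. - \<phi> x) x \<longleftrightarrow> isCont \<phi> x" for x
    using continuous_minus[of "at x" \<phi>] continuous_minus[of "at x" "\<lambda>x. - \<phi> x"] by auto
  ultimately have c: "countable {x \<in> {0<..}. \<not> isCont \<phi> x}" by simp
  have "{x. \<not> isCont \<phi> x} \<subseteq> {x \<in> {0<..}. \<not> isCont \<phi> x} \<union> uminus ` {x \<in> {0<..}. \<not> isCont \<phi> x} \<union> {0}"
  proof
    fix x assume "x \<in> {x. \<not> isCont \<phi> x}"
    then have x: "\<not> isCont \<phi> x" by simp
    have nc: "\<not> isCont \<phi> (- x)"
    proof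
      assume "isCont \<phi> (- x)"
      moreover have "isCont (\<lambda>y. - y) x" by (intro continuous_intros)
      ultimately have "isCont (\<lambda>y. \<phi> (- y)) x" using isCont_o2 by blast
      then show False using x by (simp only: even)
    qed
    show "x \<in> {x \<in> {0<..}. \<not> isCont \<phi> x} \<union> uminus ` {x \<in> {0<..}. \<not> isCont \<phi> x} \<union> {0}"
    proof (rule linorder_cases[of x 0])
      assume "x < 0"
      then have "- x \<in> {x \<in> {0<..}. \<not> isCont \<phi> x}" using nc by simp
      then have "- (- x) \<in> uminus ` {x \<in> {0<..}. \<not> isCont \<phi> x}" by (rule imageI)
      then show ?thesis by simp
    qed (use x in simp_all)
  qed
  then have "countable {x. \<not> isCont \<phi> x}"
    by (rule countable_subset) (use c in simp)
  then have "{x. \<not> isCont \<phi> x} \<in> null_sets lborel" by (rule countable_imp_null_set_lborel)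
  then have "AE x in lborel. x \<notin> {x. \<not> isCont \<phi> x}" by (rule AE_not_in)
  then show ?thesis by (intro AE_completion) simp
qed

theorem lemma4p4:
  fixes f \<phi> :: "real \<Rightarrow> real" and u :: "real \<Rightarrow> real \<Rightarrow> real"
  assumes "C1_on_nonneg f"
    and "f 0 = 0" and "f 1 = 0"
    and "\<And>s. 0 < s \<Longrightarrow> s < 1 \<Longrightarrow> f s > 0"
    and "\<And>s. s > 1 \<Longrightarrow> f s < 0"
    and "(f has_real_derivative 0) (at 0 within {0..})"
    and "\<phi> \<in> L2 \<inter> Linf"
    and "\<And>x. \<phi> x \<ge> 0"
    and "\<And>x. \<phi> (- x) = \<phi> x"
    and "antimono_on {0<..} \<phi>"
    and "is_solution f \<phi> u"
    and "\<exists>T\<ge>0. (\<lambda>x. u x T) \<in> H1 \<inter> Linf \<and> energy f (\<lambda>x. u x T) < 0"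
  shows "\<forall>K. compact K \<longrightarrow> uniform_limit K (\<lambda>t x. u x t) (\<lambda>x. 1) at_top"
proof -
  obtain T where T: "T \<ge> 0" and vH1: "(\<lambda>x. u x T) \<in> H1" and vLinf: "(\<lambda>x. u x T) \<in> Linf"
    and neg: "energy f (\<lambda>x. u x T) < 0" using assms(12) by auto
  have C21: "C21 u" and nonneg: "\<And>x t. t > 0 \<Longrightarrow> 0 \<le> u x t"
    and curve: "continuous_curve {0..} L2 L2_norm (\<lambda>t x. u x t)"
    and eqn: "\<And>x t. t > 0 \<Longrightarrow> dt u x t = dx (dx u) x t + f (u x t)"
    and init: "AE x in lebesgue. u x 0 = \<phi> x"
    using assms(11) by (auto simp: is_solution_def)
  have "\<exists>M0. \<forall>x. \<forall>t>0. \<bar>u x t\<bar> \<le> M0" using assms(11) unfolding is_solution_def by blast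
  then obtain M0 where M0: "\<And>x t. t > 0 \<Longrightarrow> \<bar>u x t\<bar> \<le> M0" by blast
  define v where "v x = u x T" for x
  obtain Mv where Mv: "AE x in lebesgue. \<bar>v x\<bar> \<le> Mv" using vLinf by (auto simp: Linf_def v_def)
  \<comment> \<open>The truncation at \<open>M\<close> does not change \<open>f\<close> on the values taken by \<open>u\<close> and \<open>v\<close>; since \<open>M > 1\<close>, it keeps all signs of \<open>f\<close>.\<close>
  define M where "M = max 2 (max M0 Mv)"
  have M: "M \<ge> 2" "M0 \<le> M" "Mv \<le> M" by (auto simp: M_def)
  define F where "F s = f (min M (max 0 s))" for s
  obtain L where L: "\<And>a b. \<bar>F a - F b\<bar> \<le> L * \<bar>a - b\<bar>"
    using C1_truncation_lipschitz[OF assms(1), of M] M by (auto simp: F_def)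
  have F_eq: "F s = f s" if "0 \<le> s" "s \<le> M" for s using that by (simp add: F_def)
  have cl: "classical u (dx u) (dx (dx u)) (dt u)" by (rule C21_classical[OF C21])
  have uM: "u x t \<le> M" if "t > 0" for x t using M0[OF that, of x] M by simp
  interpret u: reaction_solution F L M u "dx u" "dx (dx u)" "dt u"
    by unfold_locales (use L cl nonneg uM eqn F_eq in auto)
  have L2u: "(\<lambda>x. u x t) \<in> L2" if "t \<ge> 0" for t using curve that by (auto simp: continuous_curve_def)
  have att0: "attains u (\<lambda>x. u x 0)" using L2_curve_attains(1)[OF curve, of 0] by simp
  have even0: "AE x in lebesgue. u (- x) 0 = u x 0"
    using init AE_lebesgue_affine[OF init, of "- 1" 0] by (auto simp: assms(9) elim!: eventually_elim2)
  have dec0: "AE x in lebesgue. x \<ge> a \<longrightarrow> u x 0 \<le> u (2 * a - x) 0" if "a > 0" for a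
  proof -
    have "AE x in lebesgue. u (2 * a - x) 0 = \<phi> (2 * a - x)"
      using AE_lebesgue_affine[OF init, of "- 1" "2 * a"] by simp
    then show ?thesis
      using init AE_lebesgue_neq[of "2 * a"]
      by eventually_elim (use reflection_nonincreasing[OF assms(9,10) that] in auto)
  qed
  note sym = u.even_and_decreasing[OF att0 even0 dec0]
  have v_L2: "v \<in> L2" using L2u[OF T] by (simp add: v_def[abs_def])
  have vm: "v \<in> borel_measurable lebesgue" and v2: "integrable lebesgue (\<lambda>x. (v x)\<^sup>2)"
    using v_L2 by (auto simp: L2_def)
  have att: "attains (\<lambda>x t. u x (t + T)) v"
    and lim: "((\<lambda>s. LINT x|lebesgue. (u x (s + T) - v x)\<^sup>2) \<longlongrightarrow> 0) (at_right 0)"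
    using L2_curve_attains[OF curve T] by (auto simp: v_def[abs_def])
  interpret s: reaction_solution F L M "\<lambda>x t. u x (t + T)" "\<lambda>x t. dx u x (t + T)" "\<lambda>x t. dx (dx u) x (t + T)" "\<lambda>x t. dt u x (t + T)"
  proof unfold_locales
    show "classical (\<lambda>x t. u x (t + T)) (\<lambda>x t. dx u x (t + T)) (\<lambda>x t. dx (dx u) x (t + T)) (\<lambda>x t. dt u x (t + T))"
      using classical_affine[OF cl T, of 1 0] by simp
  qed (use L T in \<open>auto intro: u.pde u.bounds\<close>)
  interpret s: monostable_solution F L M "\<lambda>x t. u x (t + T)" "\<lambda>x t. dx u x (t + T)" "\<lambda>x t. dx (dx u) x (t + T)" "\<lambda>x t. dt u x (t + T)"
  proof unfold_locales
    show "F s = 0" if "s \<le> 0" for s using that M assms(2) by (simp add: F_def)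
    show "F s > 0" if "0 < s" "s < 1" for s using that M assms(4) by (simp add: F_def)
    show "F s < 0" if "s > 1" for s using that M assms(5)[of "min M s"] by (simp add: F_def)
    show "F 1 = 0" using M assms(3) by (simp add: F_def)
    show "u (- x) (t + T) = u x (t + T)" if "0 < t" for x t using sym(1)[of "t + T" x] that T by simp
    show "u y (t + T) \<le> u x (t + T)" if "0 < t" "0 \<le> x" "x \<le> y" for x y t
      using sym(2)[of "t + T" x y] that T by simp
  qed
  define g where "g = weak_deriv v"
  have wd: "has_weak_deriv v g"
  proof -
    have "\<exists>g. has_weak_deriv v g" using vH1 by (auto simp: H1_def v_def[abs_def])
    then show ?thesis unfolding g_def weak_deriv_def by (rule someI_ex)
  qed
  have gm: "g \<in> borel_measurable lebesgue"
    using wd by (intro locally_integrable_measurable) (simp add: has_weak_deriv_def)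
  have v_range: "AE x in lebesgue. 0 \<le> v x \<and> v x \<le> M"
  proof (cases "T = 0")
    case True
    show ?thesis using Mv init
      by eventually_elim (use True assms(8) M in \<open>auto simp: v_def\<close>)
  next
    case False
    then show ?thesis using u.bounds[of T] T by (simp add: v_def)
  qed
  have pot: "AE x in lebesgue. potential f (v x) = - s.G (v x)"
    using v_range
  proof eventually_elim
    case (elim x)
    have "integral {0..v x} f = integral {0..v x} F"
      by (rule Henstock_Kurzweil_Integration.integral_cong) (use elim F_eq in auto)
    then show ?case by (simp add: potential_def s.G_def)
  qed
  have Gv: "integrable lebesgue (\<lambda>x. s.G (v x))"
  proof (rule Bochner_Integration.integrable_bound)
    show "integrable lebesgue (\<lambda>x. L * (v x)\<^sup>2)" using v2 by simp
    show "(\<lambda>x. s.G (v x)) \<in> borel_measurable lebesgue"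
      by (rule measurable_compose[OF vm borel_measurable_continuous_onI[OF s.G_continuous]])
    show "AE x in lebesgue. norm (s.G (v x)) \<le> norm (L * (v x)\<^sup>2)"
      using s.G_quadratic by (intro AE_I2) (simp add: order_trans[OF _ abs_ge_self])
  qed
  define h where "h x = (g x)\<^sup>2 / 2 - s.G (v x)" for x
  have e_eq: "energy f v = (LINT x|lebesgue. (g x)\<^sup>2 / 2 + potential f (v x))"
    by (simp add: energy_def g_def)
  have negv: "energy f v < 0" using neg by (simp add: v_def[abs_def])
  \<comment> \<open>The integral of a function that is not integrable is zero by convention, which is not negative.\<close>
  have int0: "integrable lebesgue (\<lambda>x. (g x)\<^sup>2 / 2 + potential f (v x))"
  proof (rule ccontr)
    assume "\<not> integrable lebesgue (\<lambda>x. (g x)\<^sup>2 / 2 + potential f (v x))"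
    then show False using negv by (simp add: e_eq not_integrable_integral_eq)
  qed
  have hm: "h \<in> borel_measurable lebesgue"
    unfolding h_def[abs_def] using gm borel_measurable_integrable[OF Gv] by measurable
  have ae: "AE x in lebesgue. (g x)\<^sup>2 / 2 + potential f (v x) = h x"
    using pot by eventually_elim (simp add: h_def)
  have hi: "integrable lebesgue h"
    using integrable_cong_AE[OF borel_measurable_integrable[OF int0] hm ae] int0 by simp
  have e_h: "energy f v = (LINT x|lebesgue. h x)"
    unfolding e_eq by (rule integral_cong_AE[OF borel_measurable_integrable[OF int0] hm ae])
  have g2: "integrable lebesgue (\<lambda>x. (g x)\<^sup>2)"
  proof -
    have "integrable lebesgue (\<lambda>x. 2 * (h x + s.G (v x)))" using hi Gv by simp
    then show ?thesis by (simp add: h_def)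
  qed
  define J where "J = (LINT x|lebesgue. (g x)\<^sup>2)"
  have J: "J \<ge> 0" unfolding J_def by (rule Bochner_Integration.integral_nonneg) simp
  have nnJ: "(\<integral>\<^sup>+x. ennreal ((g x)\<^sup>2) \<partial>lebesgue) = ennreal J"
    unfolding J_def by (rule nn_integral_eq_integral[OF g2]) simp
  have negJ: "J / 2 - (LINT x|lebesgue. s.G (v x)) < 0"
    using negv g2 Gv by (simp add: e_h h_def J_def)
  \<comment> \<open>At time zero \<open>v\<close> is only known to equal \<open>\<phi>\<close> almost everywhere; at later times it is continuous.\<close>
  define w where "w = (if T = 0 then \<phi> else v)"
  have vw: "AE x in lebesgue. v x = w x"
    using init by eventually_elim (simp add: w_def v_def)
  have wc: "AE x in lebesgue. isCont w x"
  proof (cases "T = 0")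
    case True
    then show ?thesis using AE_isCont_even_antimono[OF assms(9,10)] by (simp add: w_def)
  next
    case False
    then have "continuous_on UNIV v" using u.u_x_continuous[of T] T by (simp add: v_def[abs_def])
    then show ?thesis using False by (simp add: w_def continuous_on_eq_continuous_at)
  qed
  have vh: "(\<integral>\<^sup>+x. ennreal ((v (x + h) - v x)\<^sup>2) \<partial>lebesgue) \<le> ennreal (h\<^sup>2 * J)" if h: "h > 0" for h
  proof -
    have "AE x in lebesgue. v (x + h) = w (x + h)"
      using AE_lebesgue_affine[OF vw, of 1 h] by simp
    then have "AE x in lebesgue. ennreal ((v (x + h) - v x)\<^sup>2) = ennreal ((w (x + h) - w x)\<^sup>2)"
      using vw by eventually_elim simp
    then have "(\<integral>\<^sup>+x. ennreal ((v (x + h) - v x)\<^sup>2) \<partial>lebesgue) = (\<integral>\<^sup>+x. ennreal ((w (x + h) - w x)\<^sup>2) \<partial>lebesgue)"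
      by (rule nn_integral_cong_AE)
    also have "\<dots> \<le> ennreal (h\<^sup>2) * ennreal J"
      using difference_quotient_L2_bound[OF wd vw wc gm _ h] by (simp add: nnJ)
    finally show ?thesis using J by (simp add: ennreal_mult)
  qed
  interpret e: finite_energy_solution F L M "\<lambda>x t. u x (t + T)" "\<lambda>x t. dx u x (t + T)" "\<lambda>x t. dx (dx u) x (t + T)" "\<lambda>x t. dt u x (t + T)" J
  proof unfold_locales
    show "(\<integral>\<^sup>+x. ennreal ((dx u x (t + T))\<^sup>2) \<partial>lebesgue) \<le> ennreal (exp (2 * L * t) * J)" if "0 < t" for t
      by (rule s.gradient_L2_bound[OF att that J vh])
    show "integrable lebesgue (\<lambda>x. (u x (t + T))\<^sup>2)" if "0 < t" for t
      using L2u[of "t + T"] that T by (simp add: L2_def)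
  qed (rule J)
  have diff_int: "integrable lebesgue (\<lambda>x. (u x (t + T) - v x)\<^sup>2)" if "t > 0" for t
    by (rule L2_diff_integrable[OF L2u v_L2]) (use that T in simp)
  obtain t where t: "t > 0" "e.E t < 0"
    using e.energy_initially_negative[OF v2 lim diff_int Gv negJ] by blast
  obtain q where q: "s.spreads q" using e.negative_energy_spreads[OF t] by blast
  show ?thesis
  proof (intro allI impI uniform_limitI)
    fix K :: "real set" and \<epsilon> :: real
    assume K: "compact K" and \<epsilon>: "\<epsilon> > 0"
    have "uniform_limit K (\<lambda>t x. u x (t + T)) (\<lambda>x. 1) at_top"
      by (rule s.locally_uniform_convergence[of q]) (use q K in \<open>auto simp: s.spreads_def\<close>)
    then obtain t0 where t0: "\<And>t x. t \<ge> t0 \<Longrightarrow> x \<in> K \<Longrightarrow> dist (u x (t + T)) 1 < \<epsilon>"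
      using \<epsilon> unfolding uniform_limit_iff eventually_at_top_linorder by blast
    have "dist (u x t) 1 < \<epsilon>" if "t \<ge> t0 + T" "x \<in> K" for t x
      using t0[of "t - T" x] that by simp
    then show "\<forall>\<^sub>F t in at_top. \<forall>x\<in>K. dist (u x t) 1 < \<epsilon>"
      unfolding eventually_at_top_linorder by blast
  qed
qed

end
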